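(* Let $\{\Psi_{[t]}\}_{t>0}$ be the family of $2\times2$ rational matrix functions $$\Psi_{[t]}=\begin{pmatrix}\boldsymbol w^\#&\xi\end{pmatrix}\begin{pmatrix}u_0&0\\0&tu_1\end{pmatrix}\begin{pmatrix}\boldsymbol v^*\\ \vartheta^{\mathrm t}\end{pmatrix}=u_0\boldsymbol w^\#\boldsymbol v^*+tu_1\xi\vartheta^{\mathrm t},$$ where $u_0,u_1,\boldsymbol v,\boldsymbol w,\xi,\vartheta$ are as described in the context. Then for every $t\in(0,1]$ that is a nondisturbing number for the unit disk $\mathbb D$, $$\deg\mathbb P_+\Psi_{[t]}\le\deg\mathbb P_-\Psi_{[t]}-2. $$ Moreover, there are at most $\deg\mathbb P_-u_1$ numbers $t\in(0,1)$ for which the inequality $\deg\mathbb P_+\Psi_{[t]}\le\deg\mathbb P_-\Psi_{[t]}-2$ is violated.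
   Context: $\mathbb D$ is the open unit disk, $\mathbb T$ the unit circle, $\hat{\mathbb C}$ the Riemann sphere. For a matrix function $\Phi$ on $\mathbb T$ with Fourier coefficients $\hat\Phi(j)$, $(\mathbb P_+\Phi)(z)=\sum_{j\ge0}\hat\Phi(j)z^j$ and $\mathbb P_-\Phi=\Phi-\mathbb P_+\Phi$. For a rational matrix function $G$, $G^\#(\zeta)=\overline{G(1/\bar\zeta)}$ (entrywise conjugation) and $G^*=(G^\#)^{\mathrm t}$; these are rational. Data: $u_0,u_1$ are scalar rational functions with $|u_0|=|u_1|=1$ on $\mathbb T$ that are badly approximable, i.e. $\operatorname{dist}_{L^\infty(\mathbb T)}(u_j,H^\infty)=\|u_j\|_{L^\infty}$. $\boldsymbol v=\binom{v_1}{v_2}$ and $\boldsymbol w=\binom{w_1}{w_2}$ are rational inner and co-outer column functions: $v_1,v_2,w_1,w_2$ are rational functions in $H^\infty$ with $|v_1|^2+|v_2|^2=|w_1|^2+|w_2|^2=1$ on $\mathbb T$, $v_1,v_2$ have no common zeros in $\mathbb D$, and $w_1,w_2$ have no common zeros in $\mathbb D$. Finally $\xi=\binom{-w_2}{w_1}$ and $\vartheta=\binom{-v_2}{v_1}$. Disturbing numbers: let $t\in(0,1]$ and $\lambda\in\hat{\mathbb C}$ be such that both $u_0\boldsymbol w^\#\boldsymbol v^*$ and $tu_1\xi\vartheta^{\mathrm t}$ have a pole at $\lambda$. There is a cancellation at $\lambda$ if $\deg_\lambda(u_0\boldsymbol w^\#\boldsymbol v^*+tu_1\xi\vartheta^{\mathrm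 t})<\max\{\deg_\lambda u_0\boldsymbol w^\#\boldsymbol v^*,\deg_\lambda u_1\xi\vartheta^{\mathrm t}\}$. The number $t$ is nondisturbing for a set $\Lambda\subset\hat{\mathbb C}$ if there is no cancellation at any $\lambda\in\Lambda$. McMillan degree: a finite Blaschke–Potapov product of size $n\times n$ is $B=UB_1\cdots B_k$ with $U$ a constant unitary matrix and $B_j(z)=\frac{\lambda_j-z}{1-\bar\lambda_jz}P_j+(I-P_j)$, $\lambda_j\in\mathbb D$, $P_j$ orthogonal projections on $\mathbb C^n$; $\deg B=\sum_j\operatorname{rank}P_j$. If all poles (in $\hat{\mathbb C}$) of a rational $m\times n$ matrix function $\Phi$ lie in $\mathbb D$, $\deg\Phi$ is the smallest degree of an $n\times n$ finite Blaschke–Potapov product $B$ such that $\Phi B$ is bounded and analytic in $\mathbb D$ (constants have degree $0$). If $\Phi$ has no poles in the closed unit disk, $\deg\Phi=\deg\Phi_\flat$ with $\Phi_\flat(z)=\Phi(1/z)$. If $\Phi$ has no poles on $\mathbb T$, $\deg\Phi=\deg\mathbb P_-\Phi+\deg\mathbb P_+\Phi$. For arbitrary rational $\Phi$, $\deg\Phi=\deg\Phi_r$, where $\Phi_r(z)=\Phi(rz)$ and $r>0$ is such that $\Phi_r$ has no poles on $\mathbb T$. For $\lambda\in\hat{\mathbb C}$, $\deg_\lambda\Phi$ is the degree of the principal part of $\Phi$ at $\lambda$. *)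

theory Defs
  imports
    "HOL-Probability.Probability"
    "HOL-Computational_Algebra.Normalized_Fraction"
    "HOL-Computational_Algebra.Polynomial_Factorial"
    "HOL-Computational_Algebra.Field_as_Ring"
begin

section \<open>Scalar rational functions\<close>

type_synonym ratfun = "complex poly fract"

definition num :: "ratfun \<Rightarrow> complex poly" where
  "num f = fst (quot_of_fract f)"

definition den :: "ratfun \<Rightarrow> complex poly" where
  "den f = snd (quot_of_fract f)"

text \<open>Numerator and denominator are coprime here, so removable singularities do not occur.
  At a pole the value is \<open>0\<close>, by the convention for division.\<close>

definition eval :: "ratfun \<Rightarrow> complex \<Rightarrow> complex" where
  "eval f z = poly (num f) z / poly (den f) z"

definition rconst :: "complex \<Rightarrow> ratfun" where
  "rconst c = to_fract [:c:]"

definition rX :: ratfun where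
  "rX = to_fract [:0, 1:]"

text \<open>Points of the Riemann sphere.\<close>

datatype csphere = Fin complex | Infty

fun has_pole :: "ratfun \<Rightarrow> csphere \<Rightarrow> bool" where
  "has_pole f (Fin a) \<longleftrightarrow> poly (den f) a = 0"
| "has_pole f Infty \<longleftrightarrow> degree (den f) < degree (num f)"

text \<open>The composition \<open>f \<circ> g\<close>, for nonconstant \<open>g\<close>.\<close>

definition rcompose :: "ratfun \<Rightarrow> ratfun \<Rightarrow> ratfun" where
  "rcompose f g = poly (map_poly rconst (num f)) g / poly (map_poly rconst (den f)) g"

definition conj_coeffs :: "ratfun \<Rightarrow> ratfun" where
  "conj_coeffs f = Fract (map_poly cnj (num f)) (map_poly cnj (den f))"

text \<open>\<open>sharp f\<close> is the function \<open>\<zeta> \<mapsto> cnj (f (1 / cnj \<zeta>))\<close>, \<open>rflat f\<close> is \<open>z \<mapsto> f (1 / z)\<close>, and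
  \<open>dilate r f\<close> is \<open>z \<mapsto> f (r z)\<close>; see \<open>eval_sharp\<close>, \<open>eval_rflat\<close> and \<open>eval_dilate\<close> below.\<close>

definition sharp :: "ratfun \<Rightarrow> ratfun" where
  "sharp f = rcompose (conj_coeffs f) (1 / rX)"

definition rflat :: "ratfun \<Rightarrow> ratfun" where
  "rflat f = rcompose f (1 / rX)"

definition dilate :: "real \<Rightarrow> ratfun \<Rightarrow> ratfun" where
  "dilate r f = rcompose f (rconst (complex_of_real r) * rX)"


section \<open>Function spaces on the disk and the circle\<close>

text \<open>Normalized Lebesgue measure on the unit circle, as a measure on the complex plane.\<close>

definition circle_measure :: "complex measure" where
  "circle_measure = distr (uniform_measure lborel {0..2 * pi}) borel cis"

definition fourier_coeff :: "(complex \<Rightarrow> complex) \<Rightarrow> int \<Rightarrow> complex" where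
  "fourier_coeff f j = (LINT z|circle_measure. f z * z powi (- j))"

definition Linf_norm :: "(complex \<Rightarrow> complex) \<Rightarrow> ereal" where
  "Linf_norm f = esssup circle_measure (\<lambda>z. ereal (norm (f z)))"

definition Hinf :: "(complex \<Rightarrow> complex) set" where
  "Hinf = {F. F holomorphic_on ball 0 1 \<and> bounded (F ` ball 0 1)}"

text \<open>\<open>H\<^sup>\<infinity>\<close> as a subspace of \<open>L\<^sup>\<infinity>\<close> of the circle, through radial boundary values.\<close>

definition Hinf_boundary :: "(complex \<Rightarrow> complex) set" where
  "Hinf_boundary = {f \<in> borel_measurable borel. \<exists>F\<in>Hinf.
     AE z in circle_measure. ((\<lambda>r. F (complex_of_real r * z)) \<longlongrightarrow> f z) (at_left 1)}"

definition badly_approximable :: "ratfun \<Rightarrow> bool" where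
  "badly_approximable u \<longleftrightarrow>
     (INF f\<in>Hinf_boundary. Linf_norm (\<lambda>z. eval u z - f z)) = Linf_norm (eval u)"

definition unimodular_on_circle :: "ratfun \<Rightarrow> bool" where
  "unimodular_on_circle u \<longleftrightarrow> (\<forall>z\<in>sphere 0 1. norm (eval u z) = 1)"

text \<open>The Riesz projection of a rational function without poles on the unit circle is again
  rational; it is determined by its power series on the disk.\<close>

definition P_plus :: "ratfun \<Rightarrow> ratfun" where
  "P_plus f = (THE g. \<forall>z\<in>ball 0 1. (\<lambda>j. fourier_coeff (eval f) (int j) * z ^ j) sums eval g z)"


section \<open>Rational matrix functions and the McMillan degree\<close>

type_synonym ('n, 'm) ratmat = "ratfun^'n^'m"

definition mat_has_pole :: "('n::finite, 'm::finite) ratmat \<Rightarrow> csphere \<Rightarrow> bool" where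
  "mat_has_pole \<Phi> p \<longleftrightarrow> (\<exists>i j. has_pole (\<Phi> $ i $ j) p)"

definition mat_P_plus :: "('n::finite, 'm::finite) ratmat \<Rightarrow> ('n, 'm) ratmat" where
  "mat_P_plus \<Phi> = map_matrix P_plus \<Phi>"

definition mat_P_minus :: "('n::finite, 'm::finite) ratmat \<Rightarrow> ('n, 'm) ratmat" where
  "mat_P_minus \<Phi> = \<Phi> - mat_P_plus \<Phi>"

definition mat_sharp :: "('n::finite, 'm::finite) ratmat \<Rightarrow> ('n, 'm) ratmat" where
  "mat_sharp G = map_matrix sharp G"

definition mat_star :: "('n::finite, 'm::finite) ratmat \<Rightarrow> ('m, 'n) ratmat" where
  "mat_star G = transpose (mat_sharp G)"

definition mat_scale :: "ratfun \<Rightarrow> ('n::finite, 'm::finite) ratmat \<Rightarrow> ('n, 'm) ratmat" where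
  "mat_scale c G = map_matrix (\<lambda>x. c * x) G"

definition adjoint_mat :: "complex^'n::finite^'m::finite \<Rightarrow> complex^'m^'n" where
  "adjoint_mat A = (\<chi> i j. cnj (A $ j $ i))"

definition unitary_mat :: "complex^'n::finite^'n \<Rightarrow> bool" where
  "unitary_mat U \<longleftrightarrow> adjoint_mat U ** U = mat 1 \<and> U ** adjoint_mat U = mat 1"

definition orthogonal_projection :: "complex^'n::finite^'n \<Rightarrow> bool" where
  "orthogonal_projection P \<longleftrightarrow> P ** P = P \<and> adjoint_mat P = P"

definition bp_factor :: "complex \<times> (complex^'n^'n) \<Rightarrow> ('n::finite, 'n) ratmat" where
  "bp_factor = (\<lambda>(a, P).
     mat_scale (Fract [:a, - 1:] [:1, - cnj a:]) (map_matrix rconst P)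
     + map_matrix rconst (mat 1 - P))"

text \<open>\<open>B\<close> is a finite Blaschke--Potapov product of degree \<open>k\<close>.\<close>

definition blaschke_potapov :: "('n::finite, 'n) ratmat \<Rightarrow> nat \<Rightarrow> bool" where
  "blaschke_potapov B k \<longleftrightarrow> (\<exists>U fs. unitary_mat U
     \<and> (\<forall>(a, P)\<in>set fs. a \<in> ball 0 1 \<and> orthogonal_projection P)
     \<and> B = map_matrix rconst U ** foldr (**) (map bp_factor fs) (mat 1)
     \<and> k = (\<Sum>(a, P)\<leftarrow>fs. rank P))"

definition bounded_analytic :: "('n::finite, 'm::finite) ratmat \<Rightarrow> bool" where
  "bounded_analytic \<Phi> \<longleftrightarrow> (\<forall>i j. eval (\<Phi> $ i $ j) \<in> Hinf)"

text \<open>The degree is built up in stages: all poles in the disk; no poles on the circle; arbitrary.\<close>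

definition degree_disk :: "('n::finite, 'm::finite) ratmat \<Rightarrow> nat" where
  "degree_disk \<Phi> = (LEAST k. \<exists>B. blaschke_potapov B k \<and> bounded_analytic (\<Phi> ** B))"

definition degree_no_circle_poles :: "('n::finite, 'm::finite) ratmat \<Rightarrow> nat" where
  "degree_no_circle_poles \<Phi> =
     degree_disk (mat_P_minus \<Phi>) + degree_disk (map_matrix rflat (mat_P_plus \<Phi>))"

definition no_circle_poles :: "('n::finite, 'm::finite) ratmat \<Rightarrow> bool" where
  "no_circle_poles \<Phi> \<longleftrightarrow> (\<forall>a\<in>sphere 0 1. \<not> mat_has_pole \<Phi> (Fin a))"

text \<open>The value does not depend on the admissible radius, so any one can be chosen.\<close>

definition mcmillan_degree :: "('n::finite, 'm::finite) ratmat \<Rightarrow> nat" where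
  "mcmillan_degree \<Phi> =
    (if \<forall>p. mat_has_pole \<Phi> p \<longrightarrow> p \<in> Fin ` ball 0 1 then degree_disk \<Phi>
     else if \<forall>a\<in>cball 0 1. \<not> mat_has_pole \<Phi> (Fin a) then degree_disk (map_matrix rflat \<Phi>)
     else if no_circle_poles \<Phi> then degree_no_circle_poles \<Phi>
     else degree_no_circle_poles
       (map_matrix (dilate (SOME r. 0 < r \<and> no_circle_poles (map_matrix (dilate r) \<Phi>))) \<Phi>))"

text \<open>The principal part at a finite point consists of the negative powers of \<open>z - a\<close> in the
  Laurent expansion, the one at infinity of the positive powers of \<open>z\<close>.\<close>

fun is_principal_part :: "csphere \<Rightarrow> ratfun \<Rightarrow> ratfun \<Rightarrow> bool" where
  "is_principal_part (Fin a) f g \<longleftrightarrow>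
     (\<forall>\<mu>. has_pole g \<mu> \<longrightarrow> \<mu> = Fin a) \<and> \<not> has_pole (f - g) (Fin a)
     \<and> (eval g \<longlongrightarrow> 0) at_infinity"
| "is_principal_part Infty f g \<longleftrightarrow>
     (\<forall>\<mu>. has_pole g \<mu> \<longrightarrow> \<mu> = Infty) \<and> \<not> has_pole (f - g) Infty \<and> eval g 0 = 0"

definition principal_part :: "csphere \<Rightarrow> ratfun \<Rightarrow> ratfun" where
  "principal_part p f = (THE g. is_principal_part p f g)"

definition degree_at :: "csphere \<Rightarrow> ('n::finite, 'm::finite) ratmat \<Rightarrow> nat" where
  "degree_at p \<Phi> = mcmillan_degree (map_matrix (principal_part p) \<Phi>)"


section \<open>The family and its disturbing numbers\<close>

definition column :: "ratfun \<Rightarrow> ratfun \<Rightarrow> (1, 2) ratmat" where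
  "column a b = vector [vector [a], vector [b]]"

definition inner_co_outer :: "ratfun \<Rightarrow> ratfun \<Rightarrow> bool" where
  "inner_co_outer a b \<longleftrightarrow> eval a \<in> Hinf \<and> eval b \<in> Hinf
     \<and> (\<forall>z\<in>sphere 0 1. (norm (eval a z))\<^sup>2 + (norm (eval b z))\<^sup>2 = 1)
     \<and> \<not> (\<exists>z\<in>ball 0 1. eval a z = 0 \<and> eval b z = 0)"

text \<open>The two-column matrix \<open>(a b)\<close>.\<close>

definition hblock :: "(1, 2) ratmat \<Rightarrow> (1, 2) ratmat \<Rightarrow> (2, 2) ratmat" where
  "hblock a b = (\<chi> i j. if j = 1 then a $ i $ 1 else b $ i $ 1)"

text \<open>The matrix with rows \<open>a\<close> and \<open>b\<close>.\<close>

definition vblock :: "(2, 1) ratmat \<Rightarrow> (2, 1) ratmat \<Rightarrow> (2, 2) ratmat" where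
  "vblock a b = (\<chi> i j. if i = 1 then a $ 1 $ j else b $ 1 $ j)"

definition diag2 :: "ratfun \<Rightarrow> ratfun \<Rightarrow> (2, 2) ratmat" where
  "diag2 a b = vector [vector [a, 0], vector [0, b]]"

text \<open>In the following, \<open>v\<close> and \<open>w\<close> are given by their entries, \<open>\<xi> = column (- w2) w1\<close> and
  \<open>\<theta> = column (- v2) v1\<close>.\<close>

definition Psi ::
  "ratfun \<Rightarrow> ratfun \<Rightarrow> ratfun \<Rightarrow> ratfun \<Rightarrow> ratfun \<Rightarrow> ratfun \<Rightarrow> real \<Rightarrow> (2, 2) ratmat" where
  "Psi u0 u1 v1 v2 w1 w2 t =
     hblock (mat_sharp (column w1 w2)) (column (- w2) w1)
     ** diag2 u0 (rconst (complex_of_real t) * u1)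
     ** vblock (mat_star (column v1 v2)) (transpose (column (- v2) v1))"

definition Psi_term0 ::
  "ratfun \<Rightarrow> ratfun \<Rightarrow> ratfun \<Rightarrow> ratfun \<Rightarrow> ratfun \<Rightarrow> (2, 2) ratmat" where
  "Psi_term0 u0 v1 v2 w1 w2 =
     mat_scale u0 (mat_sharp (column w1 w2) ** mat_star (column v1 v2))"

definition Psi_term1 ::
  "ratfun \<Rightarrow> ratfun \<Rightarrow> ratfun \<Rightarrow> ratfun \<Rightarrow> ratfun \<Rightarrow> (2, 2) ratmat" where
  "Psi_term1 u1 v1 v2 w1 w2 =
     mat_scale u1 (column (- w2) w1 ** transpose (column (- v2) v1))"

definition cancellation_at ::
  "ratfun \<Rightarrow> ratfun \<Rightarrow> ratfun \<Rightarrow> ratfun \<Rightarrow> ratfun \<Rightarrow> ratfun \<Rightarrow> real \<Rightarrow> csphere \<Rightarrow> bool" where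
  "cancellation_at u0 u1 v1 v2 w1 w2 t p \<longleftrightarrow>
     (let A = Psi_term0 u0 v1 v2 w1 w2; C = Psi_term1 u1 v1 v2 w1 w2;
          tC = mat_scale (rconst (complex_of_real t)) C
      in mat_has_pole A p \<and> mat_has_pole tC p
         \<and> degree_at p (A + tC) < max (degree_at p A) (degree_at p C))"

definition nondisturbing ::
  "ratfun \<Rightarrow> ratfun \<Rightarrow> ratfun \<Rightarrow> ratfun \<Rightarrow> ratfun \<Rightarrow> ratfun \<Rightarrow> csphere set \<Rightarrow> real \<Rightarrow> bool" where
  "nondisturbing u0 u1 v1 v2 w1 w2 \<Lambda> t \<longleftrightarrow>
     (\<forall>p\<in>\<Lambda>. \<not> cancellation_at u0 u1 v1 v2 w1 w2 t p)"


section \<open>Consistency of the definitions\<close>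

lemma Psi_eq_sum:
  "Psi u0 u1 v1 v2 w1 w2 t = Psi_term0 u0 v1 v2 w1 w2
     + mat_scale (rconst (complex_of_real t)) (Psi_term1 u1 v1 v2 w1 w2)"
  unfolding Psi_def Psi_term0_def Psi_term1_def
  by (simp add: vec_eq_iff forall_2 matrix_matrix_mult_def sum_2 hblock_def vblock_def diag2_def
      mat_scale_def transpose_def algebra_simps)

lemma den_nonzero [simp]: "den f \<noteq> 0"
  by (simp add: den_def)

lemma Fract_num_den [simp]: "Fract (num f) (den f) = f"
  by (simp add: num_def den_def)

lemma eval_Fract_aux:
  assumes "poly q z \<noteq> 0"
  shows "poly (den (Fract p q)) z \<noteq> 0 \<and> eval (Fract p q) z = poly p z / poly q z"
proof -
  let ?f = "Fract p q"
  have "q \<noteq> 0" using assms by auto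
  moreover have "Fract (num ?f) (den ?f) = Fract p q" by simp
  ultimately have eq: "num ?f * q = p * den ?f"
    using eq_fract(1)[OF den_nonzero, of q "num ?f" ?f p] by blast
  have eqz: "poly (num ?f) z * poly q z = poly p z * poly (den ?f) z"
    using arg_cong[OF eq, of "\<lambda>r. poly r z"] by simp
  have cop: "coprime (num ?f) (den ?f)" by (simp add: num_def den_def coprime_quot_of_fract)
  have nz: "poly (den ?f) z \<noteq> 0"
  proof
    assume 0: "poly (den ?f) z = 0"
    with eqz assms have "poly (num ?f) z = 0" by simp
    with 0 have "[:- z, 1:] dvd num ?f" "[:- z, 1:] dvd den ?f"
      by (simp_all add: poly_eq_0_iff_dvd)
    with cop have "is_unit [:- z, 1:]" by (meson coprime_common_divisor)
    thus False by (simp add: is_unit_iff_degree)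
  qed
  with eqz assms show ?thesis by (simp add: eval_def field_simps)
qed

lemma eval_add:
  assumes "\<not> has_pole f (Fin z)" "\<not> has_pole g (Fin z)"
  shows "\<not> has_pole (f + g) (Fin z)" "eval (f + g) z = eval f z + eval g z"
proof -
  have *: "f + g = Fract (num f * den g + num g * den f) (den f * den g)"
    by (subst (1) Fract_num_den[of f, symmetric], subst (1) Fract_num_den[of g, symmetric])
      (simp only: add_fract den_nonzero not_False_eq_True)
  have nz: "poly (den f * den g) z \<noteq> 0" using assms by simp
  note E = eval_Fract_aux[OF nz, of "num f * den g + num g * den f", folded *]
  show "\<not> has_pole (f + g) (Fin z)" using E by simp
  show "eval (f + g) z = eval f z + eval g z"
    unfolding conjunct2[OF E] unfolding eval_def using assms by (simp add: add_frac_eq)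
qed

lemma eval_mult:
  assumes "\<not> has_pole f (Fin z)" "\<not> has_pole g (Fin z)"
  shows "\<not> has_pole (f * g) (Fin z)" "eval (f * g) z = eval f z * eval g z"
proof -
  have *: "f * g = Fract (num f * num g) (den f * den g)"
    by (subst (1) Fract_num_den[of f, symmetric], subst (1) Fract_num_den[of g, symmetric])
      (simp only: mult_fract)
  have nz: "poly (den f * den g) z \<noteq> 0" using assms by simp
  note E = eval_Fract_aux[OF nz, of "num f * num g", folded *]
  show "\<not> has_pole (f * g) (Fin z)" using E by simp
  show "eval (f * g) z = eval f z * eval g z"
    unfolding conjunct2[OF E] unfolding eval_def using assms by (simp)
qed

lemma eval_divide:
  assumes "\<not> has_pole f (Fin z)" "\<not> has_pole g (Fin z)" "eval g z \<noteq> 0"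
  shows "\<not> has_pole (f / g) (Fin z)" "eval (f / g) z = eval f z / eval g z"
proof -
  have *: "f / g = Fract (num f * den g) (den f * num g)"
    by (subst (1) Fract_num_den[of f, symmetric], subst (1) Fract_num_den[of g, symmetric])
      (simp only: divide_fract)
  have nz: "poly (den f * num g) z \<noteq> 0" using assms by (simp add: eval_def)
  note E = eval_Fract_aux[OF nz, of "num f * den g", folded *]
  show "\<not> has_pole (f / g) (Fin z)" using E by simp
  show "eval (f / g) z = eval f z / eval g z"
    unfolding conjunct2[OF E] unfolding eval_def using assms by (simp)
qed

lemma eval_rconst: "\<not> has_pole (rconst c) (Fin z)" "eval (rconst c) z = c"
  using eval_Fract_aux[of 1 z "[:c:]"] by (auto simp: rconst_def to_fract_def)

lemma eval_rX: "\<not> has_pole rX (Fin z)" "eval rX z = z"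
  using eval_Fract_aux[of 1 z "[:0, 1:]"] by (auto simp: rX_def to_fract_def)

lemma eval_one: "\<not> has_pole 1 (Fin z)" "eval 1 z = 1"
  using eval_rconst[of 1 z] by (simp_all add: rconst_def flip: one_pCons)

lemma eval_poly_rconst:
  assumes "\<not> has_pole g (Fin z)"
  shows "\<not> has_pole (poly (map_poly rconst p) g) (Fin z)
    \<and> eval (poly (map_poly rconst p) g) z = poly p (eval g z)"
proof (induction p)
  case 0
  show ?case using eval_rconst[of 0 z] by (simp add: rconst_def)
next
  case (pCons a p)
  have "map_poly rconst (pCons a p) = pCons (rconst a) (map_poly rconst p)"
    by (rule map_poly_pCons) (simp add: rconst_def)
  thus ?case
    using pCons.IH assms eval_rconst[of a z] eval_mult[of g z] eval_add[of "rconst a" z]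
    by (auto simp del: has_pole.simps)
qed

lemma eval_rcompose:
  assumes "\<not> has_pole g (Fin z)" "\<not> has_pole f (Fin (eval g z))"
  shows "eval (rcompose f g) z = eval f (eval g z)"
  using eval_poly_rconst[OF assms(1)] eval_divide assms(2)
  by (simp add: rcompose_def eval_def[of f] del: has_pole.simps(2))

lemma eval_inverse_rX:
  assumes "z \<noteq> 0" shows "\<not> has_pole (1 / rX) (Fin z)" "eval (1 / rX) z = 1 / z"
  using eval_divide[of 1 z rX] eval_one eval_rX assms by auto

lemma eval_rflat:
  assumes "z \<noteq> 0" "\<not> has_pole f (Fin (1 / z))"
  shows "eval (rflat f) z = eval f (1 / z)"
  using eval_rcompose[of "1 / rX" z f] eval_inverse_rX assms by (simp add: rflat_def)

lemma eval_dilate: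
  assumes "\<not> has_pole f (Fin (r * z))"
  shows "eval (dilate r f) z = eval f (r * z)"
  using eval_rcompose[of "rconst (complex_of_real r) * rX" z f]
    eval_mult[of "rconst (complex_of_real r)" z rX] eval_rconst eval_rX assms
  by (simp add: dilate_def del: has_pole.simps)

lemma poly_map_cnj: "poly (map_poly cnj p) z = cnj (poly p (cnj z))"
  by (induction p) (simp_all add: map_poly_pCons)

lemma eval_sharp:
  assumes "z \<noteq> 0" "\<not> has_pole f (Fin (1 / cnj z))"
  shows "eval (sharp f) z = cnj (eval f (1 / cnj z))"
proof -
  have "poly (map_poly cnj (den f)) (1 / z) \<noteq> 0"
    using assms by (simp add: poly_map_cnj)
  from eval_Fract_aux[OF this, of "map_poly cnj (num f)"]
  have "\<not> has_pole (conj_coeffs f) (Fin (1 / z))"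
    "eval (conj_coeffs f) (1 / z) = cnj (eval f (1 / cnj z))"
    by (simp_all add: conj_coeffs_def poly_map_cnj eval_def[of f])
  thus ?thesis
    using eval_rcompose[of "1 / rX" z "conj_coeffs f"] eval_inverse_rX[OF assms(1)]
    by (simp add: sharp_def)
qed

end

theory Submission
  imports
    Defs
    "HOL-Complex_Analysis.Cauchy_Integral_Formula"
    "HOL-Computational_Algebra.Fundamental_Theorem_Algebra"
begin

text \<open>
  The determinant of \<open>\<Psi>\<close> is \<open>t u\<^sub>0 u\<^sub>1\<close>, since the two outer factors have determinant 1. A
  badly approximable unimodular function has fewer zeros than poles in the disk
  (\<open>badly_approximable_zeros_poles\<close>), so \<open>\<Psi>\<close> has at least two more poles than zeros there, counted
  by the McMillan degree. The poles are counted by \<open>deg P\<^sub>- \<Psi>\<close>; the zeros are the poles of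
  \<open>\<Psi>\<^sup>-\<^sup>1\<close> in the disk, while \<open>deg P\<^sub>+ \<Psi>\<close> counts the poles of \<open>\<Psi>\<close> outside the disk, which are
  reflections of the poles of \<open>\<Psi>\<^sup>*\<close> in the disk. Up to transposition,
  \<^item> \<open>\<Psi>\<^sup>* = A + t C\<close> and
  \<^item> \<open>\<Psi>\<^sup>-\<^sup>1 = A + t\<^sup>-\<^sup>1 C\<close>,

  with \<open>A = u\<^sub>0\<^sup>-\<^sup>1 w v\<^sup>t\<close> and \<open>C = u\<^sub>1\<^sup>-\<^sup>1 \<xi>\<^sup># \<theta>\<^sup>*\<close>. Hence the inequality can fail only if at some
  point of the disk the poles of \<open>A\<close> and \<open>t\<^sup>-\<^sup>1 C\<close> cancel in the inverse. This makes \<open>t\<close>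
  exceptional at that point. Such a point is a pole of \<open>u\<^sub>1\<close>, it determines \<open>t\<close> because \<open>A\<close> and \<open>C\<close>
  cancel in only one proportion, and there is a cancellation in the sum defining \<open>\<Psi>\<close> itself: by
  Cramer's rule the entries of \<open>\<Psi>\<close> are those of \<open>u\<^sub>0 u\<^sub>1 (t A + C)\<close>, and their poles have smaller
  order than the pole of \<open>u\<^sub>1\<close>. Both claims follow
  (\<open>degree_inequality\<close>, \<open>exceptional_unique\<close>, \<open>exceptional_imp_pole\<close>,
  \<open>exceptional_imp_cancellation\<close>).

  No Smith--McMillan form enters. In size 2 the degree in the disk is the least degree of a
  polynomial \<open>q\<close> for which \<open>q\<close> times the entries and \<open>q\<close> times the determinant have no poles in
  the disk (\<open>degree_disk_le\<close>, \<open>degree_disk_denominator\<close>). In this form the degree is visibly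
  invariant under transposition, passes from a matrix to its inverse by Cramer's rule, and can be
  tested point by point.
\<close>

section \<open>The local ring of rational functions regular at a point\<close>

definition regular_at :: "complex \<Rightarrow> ratfun \<Rightarrow> bool" where
  "regular_at a f \<longleftrightarrow> poly (den f) a \<noteq> 0"

lemma has_pole_Fin_iff: "has_pole f (Fin a) \<longleftrightarrow> \<not> regular_at a f"
  by (simp add: regular_at_def)

lemma regular_at_Fract:
  assumes "poly q a \<noteq> 0"
  shows "regular_at a (Fract p q)" and "eval (Fract p q) a = poly p a / poly q a"
  using eval_Fract_aux[OF assms, of p] by (auto simp: regular_at_def)

lemma regular_at_add [intro]: "regular_at a f \<Longrightarrow> regular_at a g \<Longrightarrow> regular_at a (f + g)"
  and eval_add': "regular_at a f \<Longrightarrow> regular_at a g \<Longrightarrow> eval (f + g) a = eval f a + eval g a"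
  using eval_add[of f a g] by (auto simp: has_pole_Fin_iff simp del: has_pole.simps)

lemma regular_at_mult [intro]: "regular_at a f \<Longrightarrow> regular_at a g \<Longrightarrow> regular_at a (f * g)"
  and eval_mult': "regular_at a f \<Longrightarrow> regular_at a g \<Longrightarrow> eval (f * g) a = eval f a * eval g a"
  using eval_mult[of f a g] by (auto simp: has_pole_Fin_iff simp del: has_pole.simps)

lemma regular_at_rconst [simp, intro]: "regular_at a (rconst c)"
  and eval_rconst' [simp]: "eval (rconst c) a = c"
  using eval_rconst[of c a] by (auto simp: has_pole_Fin_iff simp del: has_pole.simps)

lemma regular_at_to_fract [simp, intro]: "regular_at a (to_fract p)"
  and eval_to_fract [simp]: "eval (to_fract p) a = poly p a"
  using regular_at_Fract[of 1 a p] by (auto simp: to_fract_def)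

lemma regular_at_0 [simp, intro]: "regular_at a 0" and eval_0 [simp]: "eval 0 a = 0"
  using regular_at_to_fract[of a 0] eval_to_fract[of 0 a] by auto

lemma regular_at_1 [simp, intro]: "regular_at a 1" and eval_1 [simp]: "eval 1 a = 1"
  using regular_at_to_fract[of a 1] eval_to_fract[of 1 a] by auto

lemma rconst_0 [simp]: "rconst 0 = 0" and rconst_1 [simp]: "rconst 1 = 1"
  and rconst_mult: "rconst (c * d) = rconst c * rconst d"
  and rconst_add: "rconst (c + d) = rconst c + rconst d"
  and rconst_diff: "rconst (c - d) = rconst c - rconst d"
  and rconst_uminus: "rconst (- c) = - rconst c"
  and rconst_eq_0_iff [simp]: "rconst c = 0 \<longleftrightarrow> c = 0"
  by (simp_all add: rconst_def flip: one_pCons to_fract_mult to_fract_add to_fract_diff to_fract_uminus)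

lemma rconst_sum: "rconst (sum g A) = (\<Sum>i\<in>A. rconst (g i))"
  by (induction A rule: infinite_finite_induct) (simp_all add: rconst_add)

lemma regular_at_uminus [intro]: "regular_at a f \<Longrightarrow> regular_at a (- f)"
  and eval_uminus: "regular_at a f \<Longrightarrow> eval (- f) a = - eval f a"
  using regular_at_mult[of a "rconst (- 1)" f] eval_mult'[of a "rconst (- 1)" f]
    regular_at_rconst[of a "- 1"] eval_rconst'[of "- 1" a]
  by (simp_all add: rconst_uminus)

lemma regular_at_diff [intro]: "regular_at a f \<Longrightarrow> regular_at a g \<Longrightarrow> regular_at a (f - g)"
  and eval_diff: "regular_at a f \<Longrightarrow> regular_at a g \<Longrightarrow> eval (f - g) a = eval f a - eval g a"
  using regular_at_add[of a f "- g"] eval_add'[of a f "- g"] regular_at_uminus[of a g]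
  by (auto simp: eval_uminus)

lemma regular_at_sum [intro]: "(\<And>i. i \<in> A \<Longrightarrow> regular_at a (f i)) \<Longrightarrow> regular_at a (sum f A)"
  by (induction A rule: infinite_finite_induct) auto

lemma regular_at_power [intro]: "regular_at a f \<Longrightarrow> regular_at a (f ^ n)"
  by (induction n) auto

lemma regular_at_divide [intro]:
  "regular_at a f \<Longrightarrow> regular_at a g \<Longrightarrow> eval g a \<noteq> 0 \<Longrightarrow> regular_at a (f / g)"
  and eval_divide':
  "regular_at a f \<Longrightarrow> regular_at a g \<Longrightarrow> eval g a \<noteq> 0 \<Longrightarrow> eval (f / g) a = eval f a / eval g a"
  using eval_divide[of f a g] by (auto simp: has_pole_Fin_iff simp del: has_pole.simps)

lemma ratfun_eq_to_fract: "f = to_fract (num f) / to_fract (den f)"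
  by (simp flip: Fract_conv_to_fract)

lemma finite_not_regular_at: "finite {a. \<not> regular_at a f}"
  unfolding regular_at_def using poly_roots_finite[of "den f"] by simp

lemma eval_zeros_finite:
  assumes "f \<noteq> 0" shows "finite {a. eval f a = 0}"
proof -
  have "num f \<noteq> 0" using assms ratfun_eq_to_fract[of f] by auto
  moreover have "{a. eval f a = 0} \<subseteq> {a. poly (num f) a = 0} \<union> {a. poly (den f) a = 0}"
    by (auto simp: eval_def)
  ultimately show ?thesis
    using poly_roots_finite[of "num f"] poly_roots_finite[of "den f"] den_nonzero[of f]
    by (meson finite_UnI finite_subset)
qed

text \<open>A nonzero rational function has finitely many zeros, so an identity between rational
  functions may be checked pointwise off a finite set, or on the circle.\<close>

lemma ratfun_eqI:
  assumes "infinite S" and eq: "\<And>z. z \<in> S \<Longrightarrow> regular_at z f \<Longrightarrow> regular_at z g \<Longrightarrow> eval f z = eval g z"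
  shows "f = g"
proof (rule ccontr)
  assume "f \<noteq> g"
  hence "finite {a. eval (f - g) a = 0}" by (intro eval_zeros_finite) simp
  moreover have "S \<subseteq> {a. eval (f - g) a = 0} \<union> {a. \<not> regular_at a f} \<union> {a. \<not> regular_at a g}"
    using eq by (auto simp: eval_diff)
  ultimately show False
    using assms(1) finite_not_regular_at[of f] finite_not_regular_at[of g]
    by (meson finite_UnI finite_subset)
qed

lemma num_den_coprime: "poly (num f) a = 0 \<Longrightarrow> poly (den f) a = 0 \<Longrightarrow> False"
proof -
  assume "poly (num f) a = 0" "poly (den f) a = 0"
  hence "[:- a, 1:] dvd num f" "[:- a, 1:] dvd den f"
    by (simp_all add: poly_eq_0_iff_dvd)
  moreover have "coprime (num f) (den f)" by (simp add: num_def den_def coprime_quot_of_fract)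
  ultimately have "is_unit [:- a, 1:]" by (meson coprime_common_divisor)
  thus False by (simp add: is_unit_iff_degree)
qed

lemma regular_at_imp_Fract:
  assumes "regular_at a f" obtains p q where "f = Fract p q" "poly q a \<noteq> 0"
  using that[of "num f" "den f"] assms by (simp add: regular_at_def)

section \<open>Orders of zeros and poles\<close>

abbreviation lin :: "complex \<Rightarrow> ratfun" where "lin a \<equiv> to_fract [:- a, 1:]"

text \<open>The order of \<open>f\<close> at \<open>a\<close> is at least \<open>n\<close>. A predicate instead of an integer-valued order
  spares the exceptional value of the zero function.\<close>

definition ord_ge :: "complex \<Rightarrow> int \<Rightarrow> ratfun \<Rightarrow> bool" where
  "ord_ge a n f \<longleftrightarrow> regular_at a (f * lin a powi (- n))"

lemma lin_nonzero [simp]: "lin a \<noteq> 0" by simp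

lemma ord_ge_0_iff: "ord_ge a 0 f \<longleftrightarrow> regular_at a f"
  by (simp add: ord_ge_def)

lemma ord_ge_add [intro]: "ord_ge a n f \<Longrightarrow> ord_ge a n g \<Longrightarrow> ord_ge a n (f + g)"
  and ord_ge_diff [intro]: "ord_ge a n f \<Longrightarrow> ord_ge a n g \<Longrightarrow> ord_ge a n (f - g)"
  and ord_ge_uminus [intro]: "ord_ge a n f \<Longrightarrow> ord_ge a n (- f)"
  unfolding ord_ge_def by (auto simp: ring_distribs)

lemma ord_ge_uminus_iff [simp]: "ord_ge a n (- f) \<longleftrightarrow> ord_ge a n f"
  using ord_ge_uminus[of a n f] ord_ge_uminus[of a n "- f"] by auto

lemma ord_ge_mult: 
  assumes "ord_ge a n f" "ord_ge a m g" shows "ord_ge a (n + m) (f * g)"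
proof -
  have "f * g * lin a powi (- (n + m)) = (f * lin a powi (- n)) * (g * lin a powi (- m))"
    using power_int_add[of "lin a" "- n" "- m"] by (simp add: mult_ac)
  thus ?thesis using assms regular_at_mult unfolding ord_ge_def by metis
qed

lemma ord_ge_mult': "ord_ge a n f \<Longrightarrow> ord_ge a m g \<Longrightarrow> k = n + m \<Longrightarrow> ord_ge a k (f * g)"
  using ord_ge_mult by blast

lemma ord_ge_lin_powi: "ord_ge a n (lin a powi n)"
  by (simp add: ord_ge_def flip: power_int_add)

lemma ord_ge_mono:
  assumes "ord_ge a n f" "m \<le> n" shows "ord_ge a m f"
proof -
  have "lin a powi (- m) = lin a powi (- n) * lin a powi (n - m)"
    by (simp flip: power_int_add)
  also have "lin a powi (n - m) = lin a ^ nat (n - m)"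
    using assms(2) by (simp add: power_int_def)
  finally have E: "f * lin a powi (- m) = (f * lin a powi (- n)) * lin a ^ nat (n - m)"
    by (simp only: mult.assoc)
  have "regular_at a (f * lin a powi (- n) * lin a ^ nat (n - m))"
    by (rule regular_at_mult[OF assms(1)[unfolded ord_ge_def] regular_at_power[OF regular_at_to_fract]])
  thus ?thesis unfolding ord_ge_def E .
qed

lemma ord_ge_rconst_mult: "ord_ge a n f \<Longrightarrow> ord_ge a n (rconst c * f)"
  using ord_ge_mult[of a 0 "rconst c" n f] by (simp add: ord_ge_0_iff)

lemma ord_ge_rconst_mult_iff: "c \<noteq> 0 \<Longrightarrow> ord_ge a n (rconst c * f) \<longleftrightarrow> ord_ge a n f"
  using ord_ge_rconst_mult[of a n "rconst c * f" "1 / c"] ord_ge_rconst_mult[of a n f c]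
    rconst_mult[of "1 / c" c] by (auto simp: mult.assoc[symmetric])

definition unit_at :: "complex \<Rightarrow> ratfun \<Rightarrow> bool" where
  "unit_at a f \<longleftrightarrow> regular_at a f \<and> eval f a \<noteq> 0"

lemma unit_at_mult: "unit_at a f \<Longrightarrow> unit_at a g \<Longrightarrow> unit_at a (f * g)"
  by (auto simp: unit_at_def eval_mult')

lemma unit_at_nonzero: "unit_at a f \<Longrightarrow> f \<noteq> 0"
  by (auto simp: unit_at_def)

lemma unit_at_inverse: "unit_at a f \<Longrightarrow> unit_at a (inverse f)"
  using eval_divide'[of a 1 f] regular_at_divide[of a 1 f]
  by (auto simp: unit_at_def divide_inverse)

lemma unit_at_to_fract [simp]: "unit_at a (to_fract p) \<longleftrightarrow> poly p a \<noteq> 0"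
  by (simp add: unit_at_def)

lemma unit_at_divide: "unit_at a f \<Longrightarrow> unit_at a g \<Longrightarrow> unit_at a (f / g)"
  by (simp add: divide_inverse unit_at_mult unit_at_inverse)

lemma ord_ge_unit_mult_iff:
  assumes "unit_at a e" shows "ord_ge a n (e * f) \<longleftrightarrow> ord_ge a n f"
proof -
  have "ord_ge a 0 e" "ord_ge a 0 (inverse e)"
    using assms unit_at_inverse[OF assms] by (auto simp: ord_ge_0_iff unit_at_def)
  moreover have "f = inverse e * (e * f)" using unit_at_nonzero[OF assms] by simp
  ultimately show ?thesis by (metis ord_ge_mult add_0)
qed

lemma poly_order_split:
  fixes p :: "complex poly"
  assumes "p \<noteq> 0" obtains r where "p = [:- a, 1:] ^ order a p * r" "poly r a \<noteq> 0"
  using order_decomp[OF assms, of a] poly_eq_0_iff_dvd by metis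

lemma ratfun_local_form:
  assumes "f \<noteq> 0"
  obtains k e where "f = lin a powi k * e" "unit_at a e"
proof -
  have "num f \<noteq> 0" using assms ratfun_eq_to_fract[of f] by auto
  then obtain r where r: "num f = [:- a, 1:] ^ order a (num f) * r" "poly r a \<noteq> 0"
    by (rule poly_order_split)
  obtain s where s: "den f = [:- a, 1:] ^ order a (den f) * s" "poly s a \<noteq> 0"
    by (rule poly_order_split[OF den_nonzero])
  have pw: "to_fract (p ^ n) = to_fract p ^ n" for p :: "complex poly" and n
    by (induction n) simp_all
  have "f = (lin a ^ order a (num f) * to_fract r) / (lin a ^ order a (den f) * to_fract s)"
    by (metis ratfun_eq_to_fract r(1) s(1) to_fract_mult pw)
  also have "\<dots> = lin a powi (int (order a (num f)) - int (order a (den f))) * (to_fract r / to_fract s)"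
    by (simp add: power_int_diff)
  finally show ?thesis by (rule that) (use r s in \<open>simp add: unit_at_divide\<close>)
qed

lemma ord_ge_lin_powi_iff: "ord_ge a n (lin a powi k) \<longleftrightarrow> n \<le> k"
proof
  assume "ord_ge a n (lin a powi k)"
  hence *: "regular_at a (lin a powi (k - n))" by (simp add: ord_ge_def flip: power_int_add)
  show "n \<le> k"
  proof (rule ccontr)
    assume "\<not> n \<le> k"
    hence k: "lin a powi (k - n) = inverse (lin a ^ nat (n - k))"
      by (simp add: power_int_def power_inverse)
    have "n - k = int (nat (n - k))" "nat (n - k) > 0" using \<open>\<not> n \<le> k\<close> by auto
    hence "eval (lin a powi (k - n) * lin a ^ nat (n - k)) a = 0"
      using * by (subst eval_mult') (auto simp: power_eq_if[of _ "nat (n - k)"] eval_mult' regular_at_power)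
    thus False by (simp add: k)
  qed
qed (use ord_ge_lin_powi ord_ge_mono in blast)

lemma ord_ge_to_fract_mult_iff:
  assumes "q \<noteq> 0"
  shows "regular_at a (to_fract q * f) \<longleftrightarrow> ord_ge a (- int (order a q)) f"
proof -
  obtain r where r: "q = [:- a, 1:] ^ order a q * r" "poly r a \<noteq> 0"
    using assms by (rule poly_order_split)
  have pw: "to_fract (p ^ n) = to_fract p ^ n" for p :: "complex poly" and n
    by (induction n) simp_all
  have A: "to_fract q * f = to_fract r * (f * lin a powi int (order a q))"
    by (subst r(1)) (simp add: pw)
  have "regular_at a (to_fract r * (f * lin a powi int (order a q)))
      \<longleftrightarrow> regular_at a (f * lin a powi int (order a q))"
    using ord_ge_unit_mult_iff[of a "to_fract r" 0] r(2) by (simp add: ord_ge_0_iff)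
  thus ?thesis unfolding A ord_ge_def minus_minus .
qed

section \<open>Bounded analytic rational functions\<close>

definition regular_on :: "complex set \<Rightarrow> ratfun \<Rightarrow> bool" where
  "regular_on S f \<longleftrightarrow> (\<forall>z\<in>S. regular_at z f)"

lemma continuous_on_eval: "regular_on S f \<Longrightarrow> continuous_on S (eval f)"
  unfolding eval_def[abs_def] regular_on_def regular_at_def
  by (intro continuous_intros) auto

lemma holomorphic_on_eval: "regular_on S f \<Longrightarrow> eval f holomorphic_on S"
  unfolding eval_def[abs_def] regular_on_def regular_at_def
  by (intro holomorphic_intros) auto

lemma Hinf_iff: "eval f \<in> Hinf \<longleftrightarrow> regular_on (cball 0 1) f"
proof
  assume reg: "regular_on (cball 0 1) f"
  have "compact (eval f ` cball 0 1)"
    using continuous_on_eval[OF reg] by (intro compact_continuous_image) auto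
  hence "bounded (eval f ` ball 0 1)"
    by (meson ball_subset_cball bounded_subset compact_imp_bounded image_mono)
  moreover have "eval f holomorphic_on ball 0 1"
    using reg by (intro holomorphic_on_eval) (auto simp: regular_on_def)
  ultimately show "eval f \<in> Hinf" by (simp add: Hinf_def)
next
  assume "eval f \<in> Hinf"
  then obtain M where M: "\<And>z. z \<in> ball 0 1 \<Longrightarrow> norm (eval f z) \<le> M"
    unfolding Hinf_def bounded_iff by blast
  \<comment> \<open>The bound \<open>|num| \<le> M |den|\<close> passes to the closed disk by continuity; at a zero of the
    denominator it would make the numerator vanish as well.\<close>
  define F where "F = {z. poly (den f) z = 0}"
  define T where "T = {z. norm (poly (num f) z) \<le> M * norm (poly (den f) z)}"
  have "closed T" unfolding T_def by (intro closed_Collect_le continuous_intros)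
  have "ball 0 1 \<subseteq> F \<union> T"
  proof
    fix z :: complex assume "z \<in> ball 0 1"
    from M[OF this] show "z \<in> F \<union> T"
      by (cases "poly (den f) z = 0") (auto simp: F_def T_def eval_def norm_divide field_simps)
  qed
  show "regular_on (cball 0 1) f"
    unfolding regular_on_def
  proof
    fix a :: complex assume "a \<in> cball 0 1"
    hence "a islimpt ball 0 1" by (simp add: islimpt_ball)
    hence "a islimpt (F \<union> T)" using \<open>ball 0 1 \<subseteq> F \<union> T\<close> islimpt_subset by blast
    moreover have "finite F" unfolding F_def using poly_roots_finite[of "den f"] by simp
    ultimately have "a \<in> T"
      using \<open>closed T\<close> islimpt_Un_finite closed_limpt by blast
    thus "regular_at a f"
      using num_den_coprime[of f a] by (auto simp: T_def regular_at_def)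
  qed
qed

definition regular_mat :: "complex set \<Rightarrow> ('n::finite, 'm::finite) ratmat \<Rightarrow> bool" where
  "regular_mat S \<Phi> \<longleftrightarrow> (\<forall>i j. regular_on S (\<Phi> $ i $ j))"

lemma bounded_analytic_iff: "bounded_analytic \<Phi> \<longleftrightarrow> regular_mat (cball 0 1) \<Phi>"
  by (simp add: bounded_analytic_def regular_mat_def Hinf_iff)

lemma regular_on_subset: "regular_on S f \<Longrightarrow> T \<subseteq> S \<Longrightarrow> regular_on T f"
  by (auto simp: regular_on_def)

lemma regular_mat_subset: "regular_mat S \<Phi> \<Longrightarrow> T \<subseteq> S \<Longrightarrow> regular_mat T \<Phi>"
  by (auto simp: regular_on_def regular_mat_def)

lemma regular_on_intros [intro]:
  "regular_on S f \<Longrightarrow> regular_on S g \<Longrightarrow> regular_on S (f + g)"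
  "regular_on S f \<Longrightarrow> regular_on S g \<Longrightarrow> regular_on S (f - g)"
  "regular_on S f \<Longrightarrow> regular_on S g \<Longrightarrow> regular_on S (f * g)"
  "regular_on S f \<Longrightarrow> regular_on S (- f)"
  "regular_on S (to_fract p)"
  "regular_on S (rconst c)"
  "regular_on S 0"
  "regular_on S 1"
  by (auto simp: regular_on_def)

lemma regular_on_sum: "(\<And>i. i \<in> A \<Longrightarrow> regular_on S (f i)) \<Longrightarrow> regular_on S (sum f A)"
  by (auto simp: regular_on_def)

lemma regular_mat_mult:
  assumes "regular_mat S A" "regular_mat S B" shows "regular_mat S (A ** B)"
  using assms by (auto simp: regular_mat_def matrix_matrix_mult_def intro!: regular_on_sum)

lemma regular_mat_add:
  assumes "regular_mat S A" "regular_mat S B" shows "regular_mat S (A + B)"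
  using assms by (auto simp: regular_mat_def)

lemma regular_mat_rconst: "regular_mat S (map_matrix rconst A)"
  by (auto simp: regular_mat_def map_matrix_def)

lemma regular_mat_scale: "regular_on S c \<Longrightarrow> regular_mat S A \<Longrightarrow> regular_mat S (mat_scale c A)"
  by (auto simp: regular_mat_def map_matrix_def mat_scale_def)

lemma mat_scale_nth [simp]: "mat_scale c A $ i $ j = c * A $ i $ j"
  by (simp add: mat_scale_def map_matrix_def)

lemma map_matrix_nth [simp]: "map_matrix g A $ i $ j = g (A $ i $ j)"
  by (simp add: map_matrix_def)

lemma mat_scale_mult_left: "mat_scale c A ** B = mat_scale c (A ** B)"
  and mat_scale_mult_right: "A ** mat_scale c B = mat_scale c (A ** B)"
  by (simp_all add: vec_eq_iff matrix_matrix_mult_def sum_distrib_left mult_ac)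

lemma map_matrix_rconst_mult:
  "map_matrix rconst (A ** B) = map_matrix rconst A ** map_matrix rconst B"
  by (simp add: vec_eq_iff matrix_matrix_mult_def rconst_sum rconst_mult)

lemma map_matrix_rconst_diff:
  "map_matrix rconst (A - B) = map_matrix rconst A - map_matrix rconst B"
  by (simp add: vec_eq_iff rconst_diff)

lemma map_matrix_rconst_1: "map_matrix rconst (mat 1) = mat 1"
  by (simp add: vec_eq_iff mat_def)

lemma ratmat_add_mult_distrib: "(A + B) ** C = A ** C + B ** (C :: ('n::finite, 'm::finite) ratmat)"
  by (simp add: vec_eq_iff matrix_matrix_mult_def distrib_right sum.distrib)

section \<open>Blaschke--Potapov factors\<close>

text \<open>Multiplication by \<open>c\<close> on the range of the projection \<open>P\<close>, and the identity on its kernel. For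
  fixed \<open>P\<close> these matrices are multiplied by multiplying the scalars, which inverts the
  Blaschke--Potapov factors.\<close>

definition proj_scale :: "ratfun \<Rightarrow> complex^'n^'n \<Rightarrow> ('n::finite, 'n) ratmat" where
  "proj_scale c P = mat_scale c (map_matrix rconst P) + map_matrix rconst (mat 1 - P)"

lemma bp_factor_eq: "bp_factor (a, P) = proj_scale (Fract [:a, - 1:] [:1, - cnj a:]) P"
  by (simp add: bp_factor_def proj_scale_def)

lemma proj_scale_mult:
  fixes P :: "complex^'n::finite^'n"
  assumes "P ** P = P"
  shows "proj_scale c P ** proj_scale d P = proj_scale (c * d) P"
proof -
  define Q where "Q = map_matrix rconst P"
  have QQ: "Q ** Q = Q" using assms unfolding Q_def by (metis map_matrix_rconst_mult)
  have eq: "proj_scale c P = mat_scale (c - 1) Q + mat 1" for c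
    by (simp add: proj_scale_def map_matrix_rconst_diff map_matrix_rconst_1 Q_def[symmetric])
      (simp add: vec_eq_iff algebra_simps)
  have "proj_scale c P ** proj_scale d P
      = mat_scale ((c - 1) * (d - 1)) Q + mat_scale (c - 1) Q + mat_scale (d - 1) Q + mat 1"
    unfolding eq
    by (simp add: matrix_add_ldistrib ratmat_add_mult_distrib mat_scale_mult_left mat_scale_mult_right QQ)
      (simp add: vec_eq_iff algebra_simps)
  also have "\<dots> = proj_scale (c * d) P"
    unfolding eq by (simp add: vec_eq_iff algebra_simps)
  finally show ?thesis .
qed

lemma proj_scale_1 [simp]: "proj_scale 1 P = mat 1"
  by (simp add: proj_scale_def map_matrix_rconst_diff map_matrix_rconst_1)
    (simp add: vec_eq_iff)

lemma det_proj_scale: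
  fixes P :: "complex^2^2"
  shows "det (proj_scale c P)
    = 1 + (c - 1) * rconst (P $ 1 $ 1 + P $ 2 $ 2) + (c - 1)\<^sup>2 * rconst (det P)"
  by (simp add: proj_scale_def det_2 mat_def rconst_diff rconst_add rconst_mult rconst_uminus
      algebra_simps power2_eq_square)

abbreviation blaschke :: "complex \<Rightarrow> ratfun" where "blaschke a \<equiv> Fract [:a, - 1:] [:1, - cnj a:]"

lemma bl_eq: "blaschke a = - lin a / to_fract [:1, - cnj a:]"
  by (simp add: Fract_conv_to_fract flip: to_fract_uminus)

lemma one_minus_cnj_mult_nonzero:
  assumes "a \<in> ball 0 1" "z \<in> cball 0 1" shows "1 - cnj a * z \<noteq> 0"
proof
  assume "1 - cnj a * z = 0"
  hence "norm (cnj a * z) = 1" by simp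
  hence "norm (cnj a) * norm z = 1" unfolding norm_mult .
  moreover have "norm (cnj a) * norm z \<le> norm a * 1"
    using assms by (intro mult_mono) auto
  ultimately show False using assms by simp
qed

lemma unit_at_cnj_factor:
  assumes "a \<in> ball 0 1" "z \<in> cball 0 1" shows "unit_at z (to_fract [:1, - cnj a:])"
  using one_minus_cnj_mult_nonzero[OF assms] by (simp add: mult.commute)

lemma regular_on_bl: "a \<in> ball 0 1 \<Longrightarrow> regular_on (cball 0 1) (blaschke a)"
  using unit_at_cnj_factor[of a] unfolding regular_on_def bl_eq
  by (auto simp: unit_at_def simp del: minus_divide_left intro!: regular_at_divide regular_at_uminus)

lemma regular_mat_bp_factor:
  assumes "a \<in> ball 0 1" shows "regular_mat (cball 0 1) (bp_factor (a, P))"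
  unfolding bp_factor_eq proj_scale_def
  by (intro regular_mat_add regular_mat_scale regular_mat_rconst regular_on_bl assms)

definition valid_factors :: "(complex \<times> (complex^'n^'n)) list \<Rightarrow> bool" where
  "valid_factors fs \<longleftrightarrow> (\<forall>(a, P)\<in>set fs. a \<in> ball 0 1 \<and> orthogonal_projection (P :: complex^'n::finite^'n))"

abbreviation bp_prod :: "(complex \<times> (complex^'n^'n)) list \<Rightarrow> ('n::finite, 'n) ratmat" where
  "bp_prod fs \<equiv> foldr (**) (map bp_factor fs) (mat 1)"

abbreviation rank_sum :: "(complex \<times> (complex^'n^'n)) list \<Rightarrow> nat" where
  "rank_sum fs \<equiv> (\<Sum>(a, P)\<leftarrow>fs. rank (P :: complex^'n::finite^'n))"

lemma rank_eq_0_imp: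
  fixes P :: "complex^'n::finite^'n"
  assumes "rank P = 0" shows "P = 0"
proof -
  have "rows P \<subseteq> {0}" using assms by (simp add: row_rank_def_gen)
  hence "row i P = 0" for i by (auto simp: rows_def)
  thus ?thesis by (simp add: vec_eq_iff row_def)
qed

lemma rank_less_2_imp_det:
  fixes P :: "complex^2^2"
  assumes "rank P < 2" shows "det P = 0"
proof (rule ccontr)
  assume "det P \<noteq> 0"
  hence "invertible P" by (simp add: invertible_det_nz)
  then obtain Q where "Q ** P = mat 1" by (auto simp: invertible_def)
  hence "vec.span (rows P) = UNIV" using matrix_left_invertible_span_rows_gen by blast
  hence "rank P = 2" unfolding row_rank_def_gen
    using vec.dim_span[of "rows P"] vec_dim_card[where 'n=2 and 'a=complex] by simp
  thus False using assms by simp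
qed

section \<open>The degree as the least degree of a common denominator\<close>

text \<open>A polynomial that clears the poles in the disk of all entries and of the determinant. For
  sizes 1 and 2 these are all the minors, so the least such polynomial is the pole polynomial of the
  matrix in the disk.\<close>

definition pole_denominator :: "complex poly \<Rightarrow> ('n::finite, 'n) ratmat \<Rightarrow> bool" where
  "pole_denominator q \<Phi> \<longleftrightarrow> q \<noteq> 0 \<and> (\<forall>i j. regular_on (ball 0 1) (to_fract q * \<Phi> $ i $ j))
     \<and> regular_on (ball 0 1) (to_fract q * det \<Phi>)"

lemma regular_on_prod: "(\<And>i. i \<in> A \<Longrightarrow> regular_on S (f i)) \<Longrightarrow> regular_on S (prod f A)"
  by (induction A rule: infinite_finite_induct) auto

lemma regular_on_power: "regular_on S f \<Longrightarrow> regular_on S (f ^ n)"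
  by (induction n) auto

lemma regular_on_det: 
  fixes A :: "('n::finite, 'n) ratmat"
  assumes "regular_mat S A" shows "regular_on S (det A)"
proof -
  have "regular_on S (of_int (sign p) * (\<Prod>i\<in>UNIV. A $ i $ p i))" for p
    using assms by (auto simp: regular_mat_def sign_def intro!: regular_on_intros regular_on_prod)
  thus ?thesis unfolding det_def by (intro regular_on_sum)
qed

lemma to_fract_power: "to_fract (p ^ n) = to_fract p ^ n"
  by (induction n) simp_all

lemma bl_nonzero [simp]: "blaschke a \<noteq> 0"
  unfolding bl_eq by simp

lemma lin_mult_inverse_bl: "lin a * inverse (blaschke a) = - to_fract [:1, - cnj a:]"
  unfolding bl_eq by (simp add: field_simps)

lemma regular_on_lin_power_mult_inverse_bl:
  assumes "n \<ge> m" shows "regular_on S (lin a ^ n * inverse (blaschke a) ^ m)"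
proof -
  have "lin a ^ n * inverse (blaschke a) ^ m = lin a ^ (n - m) * (lin a * inverse (blaschke a)) ^ m"
    using assms by (simp add: power_mult_distrib flip: power_add mult.assoc)
  also have "regular_on S \<dots>" unfolding lin_mult_inverse_bl
    by (intro regular_on_intros regular_on_power)
  finally show ?thesis .
qed

lemma proj_scale_0: "proj_scale c 0 = mat 1"
  by (simp add: proj_scale_def map_matrix_rconst_diff map_matrix_rconst_1)
    (simp add: vec_eq_iff)

lemma regular_on_mat_1: "regular_on S ((mat 1 :: ('n::finite, 'n) ratmat) $ i $ j)"
  by (auto simp: mat_def)

lemma regular_mat_inverse_bp_factor:
  fixes P :: "complex^'n::finite^'n"
  shows "regular_on S (lin a ^ rank P * proj_scale (inverse (blaschke a)) P $ i $ j)"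
proof (cases "rank P = 0")
  case True
  thus ?thesis using rank_eq_0_imp[of P] by (simp add: proj_scale_0 regular_on_mat_1)
next
  case False
  hence "lin a ^ rank P * proj_scale (inverse (blaschke a)) P $ i $ j
    = (lin a ^ rank P * inverse (blaschke a) ^ 1) * rconst (P $ i $ j) + lin a ^ rank P * rconst ((mat 1 - P) $ i $ j)"
    by (simp add: proj_scale_def algebra_simps)
  also have "regular_on S \<dots>" using False
    by (intro regular_on_intros regular_on_power regular_on_lin_power_mult_inverse_bl) auto
  finally show ?thesis .
qed

text \<open>By an eigenbasis, the determinant of an inverse factor has in every size a pole whose order is the
  rank of the projection. For the sizes 1 and 2 the bound needs only elementary facts about the rank.\<close>

definition det_inverse_regular :: "'n::finite itself \<Rightarrow> bool" where
  "det_inverse_regular _ \<longleftrightarrow> (\<forall>a (P :: complex^'n^'n).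
     regular_on (ball 0 1) (lin a ^ rank P * det (proj_scale (inverse (blaschke a)) P)))"

lemma det_inverse_regular_1: "det_inverse_regular TYPE(1)"
  unfolding det_inverse_regular_def det_1 by (intro allI regular_mat_inverse_bp_factor)

lemma det_inverse_regular_2: "det_inverse_regular TYPE(2)"
  unfolding det_inverse_regular_def
proof (intro allI)
  fix a and P :: "complex^2^2"
  define c where "c = inverse (blaschke a)"
  have reg: "regular_on (ball 0 1) (lin a ^ rank P * c ^ m)" if "m \<le> rank P" for m
    unfolding c_def using that by (rule regular_on_lin_power_mult_inverse_bl)
  have eq: "lin a ^ rank P * det (proj_scale c P) = lin a ^ rank P
    + (lin a ^ rank P * c ^ 1 - lin a ^ rank P) * rconst (P $ 1 $ 1 + P $ 2 $ 2)
    + (lin a ^ rank P * c ^ 2 - (1 + 1) * (lin a ^ rank P * c ^ 1) + lin a ^ rank P) * rconst (det P)"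
    unfolding det_proj_scale by (simp add: algebra_simps power2_eq_square)
  consider "rank P = 0" | "rank P = 1" | "2 \<le> rank P" by linarith
  hence "regular_on (ball 0 1) (lin a ^ rank P * det (proj_scale c P))"
  proof cases
    case 1
    thus ?thesis using rank_eq_0_imp[of P] by (simp add: proj_scale_0) auto
  next
    case 2
    hence "det P = 0" by (intro rank_less_2_imp_det) simp
    thus ?thesis unfolding eq using 2 reg[of 1]
      by (auto intro!: regular_on_intros regular_on_power)
  next
    case 3
    have "regular_on (ball 0 1) (X0 + (X1 - X0) * rconst x + (X2 - (1 + 1) * X1 + X0) * rconst y)"
      if "regular_on (ball 0 1) X0" "regular_on (ball 0 1) X1" "regular_on (ball 0 1) X2" for X0 X1 X2 x y
      by (intro regular_on_intros that)
    note Y = this[OF _ reg[of 1] reg[of 2]]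
    show ?thesis unfolding eq by (rule Y) (use 3 in \<open>auto intro!: regular_on_power\<close>)
  qed
  thus "regular_on (ball 0 1) (lin a ^ rank P * det (proj_scale (inverse (blaschke a)) P))"
    by (simp only: c_def)
qed

lemma bp_prod_inverse:
  fixes fs :: "(complex \<times> (complex^'n::finite^'n)) list"
  assumes "det_inverse_regular TYPE('n)" "valid_factors fs"
  shows "\<exists>C q. bp_prod fs ** C = mat 1 \<and> q \<noteq> 0 \<and> degree q \<le> rank_sum fs
    \<and> (\<forall>i j. regular_on (ball 0 1) (to_fract q * C $ i $ j))
    \<and> regular_on (ball 0 1) (to_fract q * det C)"
  using assms(2)
proof (induction fs)
  case Nil
  show ?case by (rule exI[of _ "mat 1"], rule exI[of _ 1]) (auto simp: regular_on_mat_1 det_I)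
next
  case (Cons f fs)
  obtain a P where f: "f = (a, P)" by force
  have P: "P ** P = P" and fs: "valid_factors fs"
    using Cons.prems by (auto simp: valid_factors_def f orthogonal_projection_def)
  from Cons.IH[OF fs] obtain C q where C: "bp_prod fs ** C = mat 1" "q \<noteq> 0" "degree q \<le> rank_sum fs"
    "\<And>i j. regular_on (ball 0 1) (to_fract q * C $ i $ j)" "regular_on (ball 0 1) (to_fract q * det C)"
    by blast
  define G where "G = proj_scale (inverse (blaschke a)) P"
  define q' where "q' = q * [:- a, 1:] ^ rank P"
  have "bp_prod (f # fs) ** (C ** G) = bp_factor f ** ((bp_prod fs ** C) ** G)"
    by (simp add: matrix_mul_assoc)
  also have "\<dots> = mat 1"
    unfolding C(1) matrix_mul_lid by (simp only: f bp_factor_eq G_def proj_scale_mult[OF P] right_inverse[OF bl_nonzero] proj_scale_1)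
  finally have 1: "bp_prod (f # fs) ** (C ** G) = mat 1" .
  have 2: "q' \<noteq> 0" using C(2) by (simp add: q'_def)
  have "degree q' = degree q + rank P"
    unfolding q'_def using C(2) by (simp add: degree_mult_eq degree_power_eq)
  hence 3: "degree q' \<le> rank_sum (f # fs)" using C(3) by (simp add: f)
  have 4: "regular_on (ball 0 1) (to_fract q' * (C ** G) $ i $ j)" for i j
  proof -
    have "to_fract q' * (C ** G) $ i $ j
      = (\<Sum>k\<in>UNIV. (to_fract q * C $ i $ k) * (lin a ^ rank P * G $ k $ j))"
      by (simp add: matrix_matrix_mult_def q'_def to_fract_power sum_distrib_left mult_ac)
    also have "regular_on (ball 0 1) \<dots>" unfolding G_def
      by (intro regular_on_sum regular_on_intros(3) C(4) regular_mat_inverse_bp_factor)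
    finally show ?thesis .
  qed
  have "to_fract q' * det (C ** G) = (to_fract q * det C) * (lin a ^ rank P * det G)"
    by (simp add: det_mul q'_def to_fract_power mult_ac)
  also have "regular_on (ball 0 1) \<dots>"
    by (rule regular_on_intros(3)[OF C(5)])
      (use assms(1) in \<open>simp only: det_inverse_regular_def G_def\<close>)
  finally show ?case using 1 2 3 4 by blast
qed

text \<open>If a Blaschke--Potapov product \<open>B\<close> of degree \<open>k\<close> cancels the poles of \<open>\<Phi>\<close>, then the
  polynomial with the zeros of \<open>det B\<close> is a common denominator, because \<open>\<Phi> = (\<Phi> B) B\<^sup>-\<^sup>1\<close>.\<close>

lemma pole_denominator_of_blaschke_potapov:
  fixes \<Phi> :: "('n::finite, 'n) ratmat"
  assumes "det_inverse_regular TYPE('n)" "blaschke_potapov B k" "bounded_analytic (\<Phi> ** B)"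
  obtains q where "pole_denominator q \<Phi>" "degree q \<le> k"
proof -
  obtain U fs where U: "unitary_mat U" and fs: "valid_factors fs"
    and B: "B = map_matrix rconst U ** bp_prod fs" and k: "k = rank_sum fs"
    using assms(2) by (auto simp: blaschke_potapov_def valid_factors_def)
  obtain C q where C: "bp_prod fs ** C = mat 1" "q \<noteq> 0" "degree q \<le> k"
    "\<And>i j. regular_on (ball 0 1) (to_fract q * C $ i $ j)" "regular_on (ball 0 1) (to_fract q * det C)"
    using bp_prod_inverse[OF assms(1) fs] k by blast
  define V where "V = map_matrix rconst (adjoint_mat U)"
  have "B ** (C ** V) = map_matrix rconst U ** ((bp_prod fs ** C) ** V)"
    unfolding B by (simp add: matrix_mul_assoc)
  also have "\<dots> = mat 1" unfolding C(1) V_def matrix_mul_lid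
    using U by (simp add: unitary_mat_def map_matrix_rconst_1 flip: map_matrix_rconst_mult)
  finally have "B ** (C ** V) = mat 1" .
  hence eq: "\<Phi> = (\<Phi> ** B) ** (C ** V)"
    by (metis matrix_mul_assoc matrix_mul_rid)
  define M where "M = \<Phi> ** B"
  have M: "regular_mat (ball 0 1) M"
    using assms(3) ball_subset_cball unfolding M_def bounded_analytic_iff by (rule regular_mat_subset)
  have V: "regular_mat (ball 0 1) V" unfolding V_def by (rule regular_mat_rconst)
  have CV: "regular_mat (ball 0 1) (mat_scale (to_fract q) C ** V)"
    using C(4) by (intro regular_mat_mult V) (auto simp: regular_mat_def)
  have "mat_scale (to_fract q) \<Phi> = M ** (mat_scale (to_fract q) C ** V)"
    by (subst eq) (simp add: mat_scale_mult_left mat_scale_mult_right M_def)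
  also have "regular_mat (ball 0 1) \<dots>" by (intro regular_mat_mult M CV)
  finally have 1: "regular_on (ball 0 1) (to_fract q * \<Phi> $ i $ j)" for i j
    by (auto simp: regular_mat_def)
  have "to_fract q * det \<Phi> = det M * ((to_fract q * det C) * det V)"
    by (subst eq) (simp add: det_mul M_def mult_ac)
  also have "regular_on (ball 0 1) \<dots>"
    by (intro regular_on_intros(3) regular_on_det M V C(5))
  finally show ?thesis using 1 C(2,3) by (intro that[of q]) (auto simp: pole_denominator_def)
qed

lemma unitary_mat_1: "unitary_mat (mat 1)"
proof -
  have "adjoint_mat (mat 1) = (mat 1 :: complex^'n::finite^'n)"
    by (auto simp: adjoint_mat_def mat_def vec_eq_iff)
  thus ?thesis by (simp add: unitary_mat_def)
qed

text \<open>Conversely, a common denominator of degree \<open>k\<close> yields a product of degree at most \<open>k\<close>: each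
  factor has a projection of rank at most one and lowers the degree of the denominator.\<close>

lemma blaschke_potapov_exists:
  fixes \<Phi> :: "('n::finite, 'n) ratmat"
  assumes step: "\<And>q (\<Phi> :: ('n, 'n) ratmat). pole_denominator q \<Phi> \<Longrightarrow> regular_mat (sphere 0 1) \<Phi> \<Longrightarrow>
      \<not> regular_mat (ball 0 1) \<Phi> \<Longrightarrow>
      \<exists>a P q'. a \<in> ball 0 1 \<and> orthogonal_projection P \<and> rank P \<le> 1
        \<and> pole_denominator q' (\<Phi> ** bp_factor (a, P)) \<and> degree q' < degree q"
    and "pole_denominator q \<Phi>" "regular_mat (sphere 0 1) \<Phi>"
  shows "\<exists>B k. blaschke_potapov B k \<and> bounded_analytic (\<Phi> ** B) \<and> k \<le> degree q"
proof -
  have "\<exists>fs. valid_factors fs \<and> regular_mat (ball 0 1) (\<Phi> ** bp_prod fs) \<and> rank_sum fs \<le> degree q"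
    using assms(2,3)
  proof (induction "degree q" arbitrary: q \<Phi> rule: less_induct)
    case less
    show ?case
    proof (cases "regular_mat (ball 0 1) \<Phi>")
      case True
      thus ?thesis by (intro exI[of _ "[]"]) (auto simp: valid_factors_def)
    next
      case False
      obtain a P q' where aP: "a \<in> ball 0 1" "orthogonal_projection P" "rank P \<le> 1"
        "pole_denominator q' (\<Phi> ** bp_factor (a, P))" "degree q' < degree q"
        using step[OF less.prems False] by blast
      have "regular_mat (sphere 0 1) (\<Phi> ** bp_factor (a, P))"
        using less.prems(2) regular_mat_subset[OF regular_mat_bp_factor[OF aP(1)] sphere_cball]
        by (intro regular_mat_mult)
      from less.hyps[OF aP(5,4) this] obtain fs where
        "valid_factors fs" "regular_mat (ball 0 1) (\<Phi> ** bp_factor (a, P) ** bp_prod fs)"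
        "rank_sum fs \<le> degree q'" by blast
      thus ?thesis using aP
        by (intro exI[of _ "(a, P) # fs"]) (auto simp: valid_factors_def matrix_mul_assoc)
    qed
  qed
  then obtain fs where fs: "valid_factors fs" "regular_mat (ball 0 1) (\<Phi> ** bp_prod fs)"
    "rank_sum fs \<le> degree q" by blast
  have "regular_mat (cball 0 1) (bp_prod fs)" using fs(1)
    by (induction fs) (auto simp: valid_factors_def regular_mat_def regular_on_mat_1
        intro!: regular_mat_mult[unfolded regular_mat_def, rule_format]
        regular_mat_bp_factor[unfolded regular_mat_def, rule_format])
  hence "regular_mat (sphere 0 1) (\<Phi> ** bp_prod fs)"
    using assms(3) regular_mat_subset[OF _ sphere_cball] by (intro regular_mat_mult) blast+
  with fs(2) have "regular_mat (cball 0 1) (\<Phi> ** bp_prod fs)"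
    by (force simp: regular_mat_def regular_on_def)
  moreover have "blaschke_potapov (bp_prod fs) (rank_sum fs)"
    unfolding blaschke_potapov_def
    by (rule exI[of _ "mat 1"], rule exI[of _ fs])
      (use fs(1) in \<open>simp add: valid_factors_def map_matrix_rconst_1 unitary_mat_1\<close>)
  ultimately show ?thesis using fs(3) by (auto simp: bounded_analytic_iff)
qed

lemma regular_at_divide_lin:
  assumes "regular_at z g" "z \<noteq> a \<or> eval g a = 0" shows "regular_at z (g / lin a)"
proof (cases "z = a")
  case False
  thus ?thesis using assms by (intro regular_at_divide) auto
next
  case True
  obtain p q where pq: "g = Fract p q" "poly q z \<noteq> 0" using assms(1) by (rule regular_at_imp_Fract)
  have "poly p a = 0" using assms(2) True pq regular_at_Fract(2)[of q z p] by simp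
  then obtain r where r: "p = [:- a, 1:] * r" unfolding poly_eq_0_iff_dvd by (rule dvdE)
  have "g / lin a = Fract r q" unfolding pq(1) r Fract_conv_to_fract to_fract_mult by simp
  thus ?thesis using regular_at_Fract(1)[OF pq(2)] by simp
qed

text \<open>Multiplying by \<open>q\<close> can only remove a pole at a root of \<open>q\<close>.\<close>

lemma pole_denominator_root:
  assumes "pole_denominator q \<Phi>" "\<not> regular_mat (ball 0 1) \<Phi>"
  obtains a r where "a \<in> ball 0 1" "q = [:- a, 1:] * r" "r \<noteq> 0" "degree r < degree q"
proof -
  obtain a i j where a: "a \<in> ball 0 1" "\<not> regular_at a (\<Phi> $ i $ j)"
    using assms(2) by (auto simp: regular_mat_def regular_on_def)
  have q: "q \<noteq> 0" "regular_at a (to_fract q * \<Phi> $ i $ j)"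
    using assms(1) a(1) by (auto simp: pole_denominator_def regular_on_def)
  have "poly q a = 0"
  proof (rule ccontr)
    assume "poly q a \<noteq> 0"
    thus False using ord_ge_unit_mult_iff[of a "to_fract q" 0] q(2) a(2) by (simp add: ord_ge_0_iff)
  qed
  then obtain r where r: "q = [:- a, 1:] * r" unfolding poly_eq_0_iff_dvd by (rule dvdE)
  with q have "r \<noteq> 0" by auto
  moreover have "degree q = Suc (degree r)" unfolding r using \<open>r \<noteq> 0\<close> by (subst degree_mult_eq) auto
  ultimately show ?thesis using a(1) r by (intro that) auto
qed

lemma rank_le_1_of_kernel:
  fixes P :: "complex^2^2"
  assumes "P *v e = 0" "e \<noteq> 0" shows "rank P \<le> 1"
proof (rule ccontr)
  assume "\<not> rank P \<le> 1"
  moreover have "rank P \<le> 2"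
    unfolding row_rank_def_gen using vec.dim_subset[OF subset_UNIV, of "rows P"] unfolding vec_dim_card by simp
  ultimately have "rank P = 2" by simp
  moreover have "vec.dim (UNIV :: (complex^2) set) = 2"
    by (simp only: vec_dim_card) simp
  ultimately have "vec.dim (rows P) = vec.dim (UNIV :: (complex^2) set)"
    by (simp only: row_rank_def_gen)
  hence "vec.span (rows P) = UNIV"
    by (intro vec.subspace_dim_equal vec.subspace_span vec.subspace_UNIV)
      (simp_all only: vec.dim_span subset_UNIV order.refl)
  then obtain Q where "Q ** P = mat 1" using matrix_left_invertible_span_rows_gen by blast
  hence "e = Q *v (P *v e)" by (simp add: matrix_vector_mul_assoc)
  thus False using assms by simp
qed

lemma regular_on_mult_bl:
  assumes "a \<in> ball 0 1" "regular_on (ball 0 1) (to_fract ([:- a, 1:] * r) * f)"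
  shows "regular_on (ball 0 1) (to_fract r * (blaschke a * f))"
proof -
  have "to_fract r * (blaschke a * f) = - (to_fract ([:- a, 1:] * r) * f) / to_fract [:1, - cnj a:]"
    unfolding bl_eq to_fract_mult by (simp add: mult_ac)
  moreover have "regular_at z (- (to_fract ([:- a, 1:] * r) * f) / to_fract [:1, - cnj a:])"
    if "z \<in> ball 0 1" for z
    using that assms unit_at_cnj_factor[OF assms(1), of z]
    by (intro regular_at_divide regular_at_uminus) (auto simp: regular_on_def unit_at_def)
  ultimately show ?thesis by (simp add: regular_on_def)
qed

lemma bp_step_1:
  fixes \<Phi> :: "(1, 1) ratmat"
  assumes "pole_denominator q \<Phi>" "\<not> regular_mat (ball 0 1) \<Phi>"
  shows "\<exists>a P q'. a \<in> ball 0 1 \<and> orthogonal_projection P \<and> rank P \<le> 1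
        \<and> pole_denominator q' (\<Phi> ** bp_factor (a, P)) \<and> degree q' < degree q"
proof -
  obtain a r where a: "a \<in> ball 0 1" "q = [:- a, 1:] * r" "r \<noteq> 0" "degree r < degree q"
    using assms by (rule pole_denominator_root)
  have "orthogonal_projection (mat 1 :: complex^1^1)"
    by (auto simp: orthogonal_projection_def adjoint_mat_def mat_def matrix_matrix_mult_def vec_eq_iff)
  moreover have "rank (mat 1 :: complex^1^1) \<le> 1"
    unfolding row_rank_def_gen
    using vec.dim_subset[OF subset_UNIV, of "rows (mat 1 :: complex^1^1)"] unfolding vec_dim_card by simp
  moreover have "(\<Phi> ** bp_factor (a, mat 1)) $ 1 $ 1 = blaschke a * \<Phi> $ 1 $ 1"
    by (simp add: bp_factor_eq proj_scale_def matrix_matrix_mult_def mat_def mult_ac)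
  hence "pole_denominator r (\<Phi> ** bp_factor (a, mat 1))"
    using assms(1) regular_on_mult_bl[OF a(1)] a(2,3)
    by (auto simp: pole_denominator_def det_1 forall_1)
  ultimately show ?thesis using a by blast
qed

lemma singular_unit_vector:
  fixes a b c d :: complex
  assumes "a * d = b * c"
  obtains x y where "a * x + b * y = 0" "c * x + d * y = 0" "x * cnj x + y * cnj y = 1"
proof -
  obtain x y where xy: "a * x + b * y = 0" "c * x + d * y = 0" "x \<noteq> 0 \<or> y \<noteq> 0"
  proof (cases "a = 0 \<and> b = 0")
    case True
    show ?thesis
    proof (cases "c = 0 \<and> d = 0")
      case True
      with \<open>a = 0 \<and> b = 0\<close> show ?thesis using that[of 1 0] by auto
    next
      case False
      with \<open>a = 0 \<and> b = 0\<close> show ?thesis using that[of "- d" c] by auto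
    qed
  next
    case False
    thus ?thesis using that[of "- b" a] assms by (auto simp: algebra_simps)
  qed
  define s where "s = complex_of_real (sqrt ((norm x)\<^sup>2 + (norm y)\<^sup>2))"
  have pos: "(norm x)\<^sup>2 + (norm y)\<^sup>2 > 0" using xy(3) by (auto simp: add_pos_nonneg add_nonneg_pos)
  have "s * s = complex_of_real ((norm x)\<^sup>2 + (norm y)\<^sup>2)"
    using pos unfolding s_def by (simp flip: of_real_mult)
  hence s: "cnj s = s" "s \<noteq> 0" "s * s = x * cnj x + y * cnj y"
    using pos by (auto simp: s_def complex_norm_square[symmetric])
  have "a * (x / s) + b * (y / s) = (a * x + b * y) / s" "c * (x / s) + d * (y / s) = (c * x + d * y) / s"
    using s(2) by (auto simp: field_simps)
  moreover have "(x / s) * cnj (x / s) + (y / s) * cnj (y / s) = (x * cnj x + y * cnj y) / (s * s)"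
    using s(1,2) by (simp add: field_simps)
  ultimately show ?thesis using xy s(2) by (intro that[of "x / s" "y / s"]) (auto simp flip: s(3))
qed

text \<open>If \<open>q\<close> is a common denominator with a root at \<open>a\<close>, the value of \<open>q \<Phi>\<close> at \<open>a\<close> is a
  singular matrix, since \<open>det (q \<Phi>) = q (q det \<Phi>)\<close>. The factor whose projection has a unit kernel
  vector \<open>e\<close> of that matrix as its kernel then uses up one linear factor of \<open>q\<close>.\<close>

lemma bp_step_2:
  fixes \<Phi> :: "(2, 2) ratmat"
  assumes "pole_denominator q \<Phi>" "\<not> regular_mat (ball 0 1) \<Phi>"
  shows "\<exists>a P q'. a \<in> ball 0 1 \<and> orthogonal_projection P \<and> rank P \<le> 1
        \<and> pole_denominator q' (\<Phi> ** bp_factor (a, P)) \<and> degree q' < degree q"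
proof -
  obtain a r where a: "a \<in> ball 0 1" "q = [:- a, 1:] * r" "r \<noteq> 0" "degree r < degree q"
    using assms by (rule pole_denominator_root)
  have reg: "\<And>i j. regular_on (ball 0 1) (to_fract q * \<Phi> $ i $ j)" "regular_on (ball 0 1) (to_fract q * det \<Phi>)"
    using assms(1) by (auto simp: pole_denominator_def)
  have "poly q a = 0" by (simp add: a(2))
  define m where "m i j = eval (to_fract q * \<Phi> $ i $ j) a" for i j
  have rega: "regular_at a (to_fract q * \<Phi> $ i $ j)" "regular_at a (to_fract q * det \<Phi>)" for i j
    using reg a(1) by (auto simp: regular_on_def)
  have "m 1 1 * m 2 2 - m 1 2 * m 2 1
      = eval ((to_fract q * \<Phi> $ 1 $ 1) * (to_fract q * \<Phi> $ 2 $ 2)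
          - (to_fract q * \<Phi> $ 1 $ 2) * (to_fract q * \<Phi> $ 2 $ 1)) a"
    using rega by (simp add: m_def eval_diff eval_mult' regular_at_mult)
  also have "(to_fract q * \<Phi> $ 1 $ 1) * (to_fract q * \<Phi> $ 2 $ 2)
      - (to_fract q * \<Phi> $ 1 $ 2) * (to_fract q * \<Phi> $ 2 $ 1) = to_fract q * (to_fract q * det \<Phi>)"
    by (simp add: det_2 algebra_simps)
  also have "eval \<dots> a = 0" using rega(2) \<open>poly q a = 0\<close> by (simp add: eval_mult')
  finally have "m 1 1 * m 2 2 = m 1 2 * m 2 1" by simp
  then obtain x y where xy: "m 1 1 * x + m 1 2 * y = 0" "m 2 1 * x + m 2 2 * y = 0"
    "x * cnj x + y * cnj y = 1" by (rule singular_unit_vector)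
  define e :: "complex^2" where "e = vector [x, y]"
  have e: "e $ 1 = x" "e $ 2 = y" by (simp_all add: e_def)
  define P :: "complex^2^2" where "P = mat 1 - (\<chi> i j. e $ i * cnj (e $ j))"
  have P: "P $ i $ j = (if i = j then 1 else 0) - e $ i * cnj (e $ j)" for i j
    by (simp add: P_def mat_def)
  have xy': "x * cnj x = 1 - y * cnj y" "cnj x * x = 1 - y * cnj y" using xy(3) by (auto simp: algebra_simps)
  have PP: "P ** P = P"
    unfolding vec_eq_iff forall_2 matrix_matrix_mult_def sum_2 using xy(3)
    by (simp add: P e) algebra
  have "orthogonal_projection P"
    unfolding orthogonal_projection_def using PP
    by (auto simp: vec_eq_iff adjoint_mat_def P)
  moreover have "rank P \<le> 1"
  proof (rule rank_le_1_of_kernel)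
    show "P *v e = 0" unfolding vec_eq_iff forall_2 matrix_vector_mult_def sum_2 using xy(3)
      by (simp add: P e) algebra
    show "e \<noteq> 0" using xy(3) e by auto
  qed
  moreover have "pole_denominator r (\<Phi> ** bp_factor (a, P))"
  proof -
    have 1: "regular_on (ball 0 1) (to_fract r * (\<Phi> ** bp_factor (a, P)) $ i $ j)" for i j
    proof -
      define g where "g = to_fract q * \<Phi> $ i $ 1 * rconst x + to_fract q * \<Phi> $ i $ 2 * rconst y"
      have g: "regular_on (ball 0 1) g" unfolding g_def by (intro regular_on_intros reg)
      have "eval g a = m i 1 * x + m i 2 * y"
        using rega by (simp add: g_def m_def eval_add' eval_mult' regular_at_mult)
      also have "\<dots> = 0" using xy exhaust_2[of i] by auto
      finally have "regular_on (ball 0 1) (g / lin a)"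
        using g by (auto simp: regular_on_def intro!: regular_at_divide_lin)
      also have "g / lin a = to_fract r * (\<Phi> $ i $ 1 * rconst x + \<Phi> $ i $ 2 * rconst y)"
        unfolding g_def a(2) to_fract_mult by (simp add: field_simps)
      finally have 3: "regular_on (ball 0 1) (to_fract r * (\<Phi> $ i $ 1 * rconst x + \<Phi> $ i $ 2 * rconst y))" .
      have 2: "regular_on (ball 0 1) (to_fract r * (blaschke a * \<Phi> $ i $ k))" for k
        using reg(1) unfolding a(2) by (rule regular_on_mult_bl[OF a(1)])
      have "regular_on (ball 0 1) (X * rconst x + Y * rconst y + Z * rconst z)"
        if "regular_on (ball 0 1) X" "regular_on (ball 0 1) Y" "regular_on (ball 0 1) Z" for X Y Z x y z
        by (intro regular_on_intros that)
      from this[OF 2 2 3] have "regular_on (ball 0 1) 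
         (to_fract r * (blaschke a * \<Phi> $ i $ 1) * rconst (P $ 1 $ j) + to_fract r * (blaschke a * \<Phi> $ i $ 2) * rconst (P $ 2 $ j)
        + to_fract r * (\<Phi> $ i $ 1 * rconst x + \<Phi> $ i $ 2 * rconst y) * rconst (cnj (e $ j)))" .
      also have "to_fract r * (blaschke a * \<Phi> $ i $ 1) * rconst (P $ 1 $ j) + to_fract r * (blaschke a * \<Phi> $ i $ 2) * rconst (P $ 2 $ j)
        + to_fract r * (\<Phi> $ i $ 1 * rconst x + \<Phi> $ i $ 2 * rconst y) * rconst (cnj (e $ j))
        = to_fract r * (\<Phi> ** bp_factor (a, P)) $ i $ j"
        by (simp add: bp_factor_eq proj_scale_def matrix_matrix_mult_def sum_2 P_def mat_def
            e rconst_mult ring_distribs mult_ac)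
      finally show ?thesis .
    qed
    have "det (bp_factor (a, P)) = blaschke a"
    proof -
      have "P $ 1 $ 1 + P $ 2 $ 2 = 1" "det P = 0" unfolding det_2 using xy(3)
        by (simp_all add: P e algebra_simps) (algebra+)?
      thus ?thesis unfolding bp_factor_eq det_proj_scale by simp
    qed
    hence "to_fract r * det (\<Phi> ** bp_factor (a, P)) = to_fract r * (blaschke a * det \<Phi>)"
      by (simp add: det_mul mult_ac)
    with 1 show ?thesis using regular_on_mult_bl[OF a(1)] reg(2) a(2,3)
      by (auto simp: pole_denominator_def)
  qed
  ultimately show ?thesis using a by blast
qed

text \<open>The two facts that depend on the size, one for each direction of the description of the
  degree by common denominators.\<close>

definition bp_size :: "'n::finite itself \<Rightarrow> bool" where
  "bp_size T \<longleftrightarrow> det_inverse_regular T \<and>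
     (\<forall>q (\<Phi> :: ('n, 'n) ratmat). pole_denominator q \<Phi> \<longrightarrow> \<not> regular_mat (ball 0 1) \<Phi> \<longrightarrow>
        (\<exists>a P q'. a \<in> ball 0 1 \<and> orthogonal_projection P \<and> rank P \<le> 1
          \<and> pole_denominator q' (\<Phi> ** bp_factor (a, P)) \<and> degree q' < degree q))"

lemma bp_size_1: "bp_size TYPE(1)" and bp_size_2: "bp_size TYPE(2)"
  using det_inverse_regular_1 det_inverse_regular_2 bp_step_1 bp_step_2 unfolding bp_size_def by blast+

lemma degree_disk_le:
  fixes \<Phi> :: "('n::finite, 'n) ratmat"
  assumes "bp_size TYPE('n)" "pole_denominator q \<Phi>" "regular_mat (sphere 0 1) \<Phi>"
  shows "degree_disk \<Phi> \<le> degree q"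
proof -
  obtain B k where B: "blaschke_potapov B k" "bounded_analytic (\<Phi> ** B)" "k \<le> degree q"
    using blaschke_potapov_exists[OF _ assms(2,3)] assms(1) unfolding bp_size_def by blast
  have "degree_disk \<Phi> \<le> k" unfolding degree_disk_def using B by (intro Least_le) blast
  thus ?thesis using B by simp
qed

lemma degree_disk_denominator:
  fixes \<Phi> :: "('n::finite, 'n) ratmat"
  assumes "bp_size TYPE('n)" "pole_denominator q0 \<Phi>" "regular_mat (sphere 0 1) \<Phi>"
  obtains q where "pole_denominator q \<Phi>" "degree q \<le> degree_disk \<Phi>"
proof -
  have "\<exists>k B. blaschke_potapov B k \<and> bounded_analytic (\<Phi> ** B)"
    using blaschke_potapov_exists[OF _ assms(2,3)] assms(1) unfolding bp_size_def by blast
  hence "\<exists>B. blaschke_potapov B (degree_disk \<Phi>) \<and> bounded_analytic (\<Phi> ** B)"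
    unfolding degree_disk_def by (rule LeastI_ex)
  then obtain B where "blaschke_potapov B (degree_disk \<Phi>)" "bounded_analytic (\<Phi> ** B)" by blast
  with pole_denominator_of_blaschke_potapov assms(1) that show ?thesis
    unfolding bp_size_def by metis
qed

section \<open>Reflection and conjugation of rational functions\<close>

lemma ratfun_eqI_cofinite:
  assumes "\<forall>\<^sub>F z in cofinite. eval f z = eval g z" shows "f = g"
proof (rule ratfun_eqI)
  have "finite {z. eval f z \<noteq> eval g z}" using assms by (simp add: eventually_cofinite)
  hence "infinite (UNIV - {z. eval f z \<noteq> eval g z})"
    by (intro Diff_infinite_finite infinite_UNIV_char_0)
  moreover have "UNIV - {z. eval f z \<noteq> eval g z} = {z. eval f z = eval g z}" by auto
  ultimately show "infinite {z. eval f z = eval g z}" by simp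
qed auto

lemma eventually_regular_at: "\<forall>\<^sub>F z in cofinite. regular_at z f"
  using finite_not_regular_at[of f] by (simp add: eventually_cofinite)

lemma eventually_cofinite_inj:
  assumes "\<forall>\<^sub>F z in cofinite. P z" "inj h" shows "\<forall>\<^sub>F z in cofinite. P (h z)"
  using finite_vimageI[OF assms(1)[unfolded eventually_cofinite] assms(2)]
  by (simp add: eventually_cofinite vimage_def)

lemma eventually_regular_at_inverse: "\<forall>\<^sub>F z in cofinite. regular_at (1 / z) f"
  by (rule eventually_cofinite_inj[OF eventually_regular_at]) (auto simp: inj_def)

lemma eventually_regular_at_cnj: "\<forall>\<^sub>F z in cofinite. regular_at (cnj z) f"
  by (rule eventually_cofinite_inj[OF eventually_regular_at]) (auto simp: inj_def)

lemma eventually_regular_at_inverse_cnj: "\<forall>\<^sub>F z in cofinite. regular_at (1 / cnj z) f"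
  by (rule eventually_cofinite_inj[OF eventually_regular_at]) (auto simp: inj_def)

lemma eventually_nonzero_cofinite: "\<forall>\<^sub>F z::complex in cofinite. z \<noteq> 0"
  by (simp add: eventually_cofinite)

lemma eval_conj_coeffs:
  assumes "regular_at (cnj z) f"
  shows "regular_at z (conj_coeffs f)" and "eval (conj_coeffs f) z = cnj (eval f (cnj z))"
proof -
  have "poly (map_poly cnj (den f)) z \<noteq> 0" using assms by (simp add: poly_map_cnj regular_at_def)
  from regular_at_Fract[OF this, of "map_poly cnj (num f)"]
  show "regular_at z (conj_coeffs f)" "eval (conj_coeffs f) z = cnj (eval f (cnj z))"
    by (simp_all add: conj_coeffs_def poly_map_cnj eval_def[of f])
qed

lemma eval_rflat':
  assumes "z \<noteq> 0" "regular_at (1 / z) f" shows "eval (rflat f) z = eval f (1 / z)"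
  using eval_rflat[of z f] assms by (simp add: has_pole_Fin_iff del: has_pole.simps)

lemma eval_sharp':
  assumes "z \<noteq> 0" "regular_at (1 / cnj z) f" shows "eval (sharp f) z = cnj (eval f (1 / cnj z))"
  using eval_sharp[of z f] assms by (simp add: has_pole_Fin_iff del: has_pole.simps)

lemma sharp_eq_rflat: "sharp f = rflat (conj_coeffs f)"
  by (simp add: sharp_def rflat_def)

lemma conj_coeffs_add: "conj_coeffs (f + g) = conj_coeffs f + conj_coeffs g"
  by (rule ratfun_eqI_cofinite)
    (use eventually_regular_at_cnj[of f] eventually_regular_at_cnj[of g] in eventually_elim,
     simp add: eval_conj_coeffs eval_add' regular_at_add)

lemma conj_coeffs_mult: "conj_coeffs (f * g) = conj_coeffs f * conj_coeffs g"
  by (rule ratfun_eqI_cofinite)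
    (use eventually_regular_at_cnj[of f] eventually_regular_at_cnj[of g] in eventually_elim,
     simp add: eval_conj_coeffs eval_mult' regular_at_mult)

lemma conj_coeffs_to_fract: "conj_coeffs (to_fract p) = to_fract (map_poly cnj p)"
  by (rule ratfun_eqI_cofinite) (simp add: eval_conj_coeffs poly_map_cnj)

lemma conj_coeffs_rconst: "conj_coeffs (rconst c) = rconst (cnj c)"
  by (rule ratfun_eqI_cofinite) (simp add: eval_conj_coeffs)

lemma conj_coeffs_uminus: "conj_coeffs (- f) = - conj_coeffs f"
  using conj_coeffs_mult[of "rconst (- 1)" f] conj_coeffs_rconst[of "- 1"] by (simp add: rconst_uminus)

lemma regular_on_conj_coeffs:
  assumes "regular_on S f" "cnj ` S \<subseteq> S" shows "regular_on S (conj_coeffs f)"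
  using assms by (auto simp: regular_on_def intro!: eval_conj_coeffs(1))

lemma poly_rconst_inverse_rX:
  "poly (map_poly rconst p) (1 / rX) * rX ^ degree p = to_fract (reflect_poly p)"
proof (rule ratfun_eqI_cofinite)
  show "\<forall>\<^sub>F z in cofinite. eval (poly (map_poly rconst p) (1 / rX) * rX ^ degree p) z
      = eval (to_fract (reflect_poly p)) z"
    using eventually_nonzero_cofinite
  proof eventually_elim
    case (elim z)
    have X: "rX ^ degree p = to_fract ([:0, 1:] ^ degree p)"
      by (simp add: rX_def to_fract_power)
    have "regular_at z (1 / rX)" "eval (1 / rX) z = 1 / z"
      using eval_inverse_rX[OF elim] by (auto simp: has_pole_Fin_iff simp del: has_pole.simps)
    moreover from this have "regular_at z (poly (map_poly rconst p) (1 / rX))"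
      "eval (poly (map_poly rconst p) (1 / rX)) z = poly p (1 / z)"
      using eval_poly_rconst[of "1 / rX" z p] by (auto simp: has_pole_Fin_iff simp del: has_pole.simps)
    ultimately show ?case using elim
      by (simp add: X eval_mult' poly_reflect_poly_nz inverse_eq_divide)
  qed
qed

lemma rX_nonzero [simp]: "rX \<noteq> 0" by (simp add: rX_def)

lemma rflat_eq:
  "rflat f = (to_fract (reflect_poly (num f)) * rX ^ degree (den f))
     / (to_fract (reflect_poly (den f)) * rX ^ degree (num f))"
  by (simp add: rflat_def rcompose_def flip: poly_rconst_inverse_rX)

lemma regular_at_rflat:
  assumes "z \<noteq> 0" "regular_at (1 / z) f" shows "regular_at z (rflat f)"
  unfolding rflat_eq
proof (intro regular_at_divide regular_at_mult regular_at_to_fract regular_at_power)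
  show "regular_at z rX" by (simp add: rX_def)
  thus "regular_at z rX" .
  show "eval (to_fract (reflect_poly (den f)) * rX ^ degree (num f)) z \<noteq> 0"
    using assms by (simp add: rX_def regular_at_def poly_reflect_poly_nz inverse_eq_divide flip: to_fract_power to_fract_mult)
qed

lemma regular_at_0_rflat:
  assumes "\<not> has_pole f Infty" shows "regular_at 0 (rflat f)"
    and "degree (num f) < degree (den f) \<Longrightarrow> eval (rflat f) 0 = 0"
proof -
  have *: "rflat f = to_fract (reflect_poly (num f) * [:0, 1:] ^ (degree (den f) - degree (num f)))
      / to_fract (reflect_poly (den f))"
    unfolding rflat_eq using assms
    by (simp add: to_fract_power rX_def[symmetric] field_simps flip: power_add)
  have "poly (reflect_poly (den f)) 0 \<noteq> 0" by simp
  thus "regular_at 0 (rflat f)" unfolding * by (intro regular_at_divide) auto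
  show "eval (rflat f) 0 = 0" if "degree (num f) < degree (den f)"
    unfolding * using that by (subst eval_divide') (auto simp: eval_mult')
qed

lemma has_pole_Infty_Fract:
  assumes "q \<noteq> 0"
  shows "degree p \<le> degree q \<Longrightarrow> \<not> has_pole (Fract p q) Infty"
    and "p \<noteq> 0 \<Longrightarrow> degree p < degree q \<Longrightarrow> degree (num (Fract p q)) < degree (den (Fract p q))"
proof -
  let ?f = "Fract p q"
  have "Fract (num ?f) (den ?f) = Fract p q" by simp
  hence eq: "num ?f * q = p * den ?f" using assms by (metis den_nonzero eq_fract(1))
  have deg: "num ?f = 0 \<or> degree (num ?f) + degree q = degree p + degree (den ?f)"
  proof (cases "p = 0")
    case False
    hence "num ?f \<noteq> 0" using eq by auto
    thus ?thesis using eq assms False by (metis degree_mult_eq den_nonzero)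
  qed (use eq assms in auto)
  have zero: "degree (num ?f) = 0 \<and> degree (den ?f) = 0" if "num ?f = 0"
  proof -
    have "?f = 0" using that ratfun_eq_to_fract[of ?f] by simp
    thus ?thesis by (simp add: num_def den_def)
  qed
  show "degree p \<le> degree q \<Longrightarrow> \<not> has_pole ?f Infty" using deg zero by auto
  show "p \<noteq> 0 \<Longrightarrow> degree p < degree q \<Longrightarrow> degree (num ?f) < degree (den ?f)"
    using deg eq by auto
qed

lemma eventually_eval_rflat:
  "\<forall>\<^sub>F z in cofinite. regular_at (1 / z) f \<and> regular_at z (rflat f) \<and> eval (rflat f) z = eval f (1 / z)"
  using eventually_regular_at_inverse[of f] eventually_nonzero_cofinite
  by eventually_elim (simp add: eval_rflat' regular_at_rflat)

lemma rflat_add: "rflat (f + g) = rflat f + rflat g"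
  by (rule ratfun_eqI_cofinite)
    (use eventually_eval_rflat[of f] eventually_eval_rflat[of g] eventually_eval_rflat[of "f + g"]
      in eventually_elim, simp add: eval_add')

lemma rflat_mult: "rflat (f * g) = rflat f * rflat g"
  by (rule ratfun_eqI_cofinite)
    (use eventually_eval_rflat[of f] eventually_eval_rflat[of g] eventually_eval_rflat[of "f * g"]
      in eventually_elim, simp add: eval_mult')

lemma rflat_rconst: "rflat (rconst c) = rconst c"
  by (rule ratfun_eqI_cofinite)
    (use eventually_eval_rflat[of "rconst c"] in eventually_elim, simp)

lemma rflat_uminus: "rflat (- f) = - rflat f"
  using rflat_mult[of "rconst (- 1)" f] rflat_rconst[of "- 1"] by (simp add: rconst_uminus)

lemma rflat_diff: "rflat (f - g) = rflat f - rflat g"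
  using rflat_add[of f "- g"] by (simp add: rflat_uminus)

lemma sharp_add: "sharp (f + g) = sharp f + sharp g"
  and sharp_mult: "sharp (f * g) = sharp f * sharp g"
  and sharp_uminus: "sharp (- f) = - sharp f"
  and sharp_rconst: "sharp (rconst c) = rconst (cnj c)"
  by (simp_all add: sharp_eq_rflat rflat_add rflat_mult rflat_uminus rflat_rconst
      conj_coeffs_add conj_coeffs_mult conj_coeffs_uminus conj_coeffs_rconst)

lemma eventually_eval_sharp:
  "\<forall>\<^sub>F z in cofinite. regular_at (1 / cnj z) f \<and> eval (sharp f) z = cnj (eval f (1 / cnj z))"
  using eventually_regular_at_inverse_cnj[of f] eventually_nonzero_cofinite
  by eventually_elim (simp add: eval_sharp')

lemma sharp_sharp [simp]: "sharp (sharp f) = f"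
proof (rule ratfun_eqI_cofinite)
  have "\<forall>\<^sub>F z in cofinite. eval (sharp f) (1 / cnj z) = cnj (eval f (1 / cnj (1 / cnj z)))"
    by (rule eventually_cofinite_inj[of "\<lambda>z. eval (sharp f) z = cnj (eval f (1 / cnj z))"])
      (use eventually_eval_sharp[of f] in \<open>auto simp: inj_def elim: eventually_mono\<close>)
  thus "\<forall>\<^sub>F z in cofinite. eval (sharp (sharp f)) z = eval f z"
    using eventually_eval_sharp[of "sharp f"] by eventually_elim simp
qed

lemma rflat_eq_conj_coeffs_sharp: "rflat f = conj_coeffs (sharp f)"
proof (rule ratfun_eqI_cofinite)
  have "\<forall>\<^sub>F z in cofinite. eval (sharp f) (cnj z) = cnj (eval f (1 / cnj (cnj z)))"
    by (rule eventually_cofinite_inj[of "\<lambda>z. eval (sharp f) z = cnj (eval f (1 / cnj z))"])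
      (use eventually_eval_sharp[of f] in \<open>auto simp: inj_def elim: eventually_mono\<close>)
  thus "\<forall>\<^sub>F z in cofinite. eval (rflat f) z = eval (conj_coeffs (sharp f)) z"
    using eventually_eval_rflat[of f] eventually_regular_at_cnj[of "sharp f"]
    by eventually_elim (simp add: eval_conj_coeffs)
qed

lemma regular_at_conj_coeffs_iff: "regular_at z (conj_coeffs f) \<longleftrightarrow> regular_at (cnj z) f"
proof -
  have "conj_coeffs (conj_coeffs f) = f"
  proof (rule ratfun_eqI_cofinite)
    show "\<forall>\<^sub>F z in cofinite. eval (conj_coeffs (conj_coeffs f)) z = eval f z"
      using eventually_regular_at[of f]
      by eventually_elim (simp add: eval_conj_coeffs)
  qed
  thus ?thesis using eval_conj_coeffs(1)[of z f] eval_conj_coeffs(1)[of "cnj z" "conj_coeffs f"] by auto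
qed

lemma regular_at_sharp:
  assumes "z \<noteq> 0" "regular_at (1 / cnj z) f" shows "regular_at z (sharp f)"
  unfolding sharp_eq_rflat using assms
  by (intro regular_at_rflat) (auto intro!: eval_conj_coeffs(1))

lemma cnj_on_circle: "norm z = 1 \<Longrightarrow> 1 / cnj z = z"
  by (metis complex_norm_square mult.commute nonzero_eq_divide_eq norm_eq_zero of_real_1 one_power2
      complex_cnj_zero_iff zero_neq_one)

lemma eval_sharp_circle:
  assumes "z \<in> sphere 0 1" "regular_at z f"
  shows "regular_at z (sharp f)" "eval (sharp f) z = cnj (eval f z)"
proof -
  have z: "z \<noteq> 0" "1 / cnj z = z" using assms(1) cnj_on_circle[of z] by auto
  show "regular_at z (sharp f)" "eval (sharp f) z = cnj (eval f z)"
    using assms regular_at_sharp[of z f] eval_sharp'[of z f] unfolding z(2) by (simp_all add: z(1))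
qed

section \<open>Splitting off the poles in a set\<close>

lemma poly_split_roots:
  fixes p :: "complex poly"
  assumes "p \<noteq> 0"
  obtains a b where "p = a * b" "\<And>z. poly a z = 0 \<Longrightarrow> z \<in> S" "\<And>z. z \<in> S \<Longrightarrow> poly b z \<noteq> 0"
proof -
  have "\<exists>a b. p = a * b \<and> (\<forall>z. poly a z = 0 \<longrightarrow> z \<in> S) \<and> (\<forall>z\<in>S. poly b z \<noteq> 0)"
    using assms
  proof (induction "degree p" arbitrary: p rule: less_induct)
    case less
    show ?case
    proof (cases "\<forall>z\<in>S. poly p z \<noteq> 0")
      case True
      thus ?thesis by (intro exI[of _ 1] exI[of _ p]) auto
    next
      case False
      then obtain w where w: "w \<in> S" "poly p w = 0" by auto
      from w(2) obtain r where r: "p = [:- w, 1:] * r" unfolding poly_eq_0_iff_dvd by (rule dvdE)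
      hence "r \<noteq> 0" using less.prems by auto
      hence "degree r < degree p" unfolding r by (subst degree_mult_eq) auto
      from less.hyps[OF this \<open>r \<noteq> 0\<close>] obtain a b where
        "r = a * b" "\<forall>z. poly a z = 0 \<longrightarrow> z \<in> S" "\<forall>z\<in>S. poly b z \<noteq> 0" by blast
      hence "p = ([:- w, 1:] * a) * b" "\<forall>z. poly ([:- w, 1:] * a) z = 0 \<longrightarrow> z \<in> S"
        unfolding r using w(1) by (simp_all only: mult.assoc) auto
      thus ?thesis using \<open>\<forall>z\<in>S. poly b z \<noteq> 0\<close> by blast
    qed
  qed
  thus ?thesis using that by blast
qed

lemma bezout_no_common_root:
  fixes a b :: "complex poly"
  assumes "a \<noteq> 0" "\<And>z. poly a z = 0 \<Longrightarrow> poly b z \<noteq> 0"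
  obtains x y where "x * a + y * b = 1"
proof -
  have "gcd a b \<noteq> 0" using assms(1) by simp
  have "\<not> (\<exists>z. poly (gcd a b) z = 0)"
    using assms(2) by (metis dvd_trans gcd_dvd1 gcd_dvd2 poly_eq_0_iff_dvd)
  hence "degree (gcd a b) = 0"
    using fundamental_theorem_of_algebra[of "gcd a b"] constant_degree[of "gcd a b"] by blast
  hence "is_unit (gcd a b)" using is_unit_iff_degree[OF \<open>gcd a b \<noteq> 0\<close>] by blast
  hence "gcd a b = 1" by (metis is_unit_normalize normalize_gcd)
  thus ?thesis using that bezout_coefficients_fst_snd[of a b] by metis
qed

text \<open>\<open>h\<close> carries the poles of \<open>f\<close> in \<open>S\<close>. The last two conditions say that it vanishes at infinity.\<close>

definition pole_part_in :: "complex set \<Rightarrow> ratfun \<Rightarrow> ratfun \<Rightarrow> bool" where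
  "pole_part_in S f h \<longleftrightarrow> (\<forall>z. z \<notin> S \<longrightarrow> regular_at z h) \<and> regular_on S (f - h) \<and>
     \<not> has_pole h Infty \<and> eval (rflat h) 0 = 0"

text \<open>Split the denominator into a factor with roots in \<open>S\<close> and one without, expand by a Bezout
  identity between them, and reduce the numerator over the first factor by division.\<close>

lemma pole_part_in_exists: "\<exists>h. pole_part_in S f h"
proof -
  obtain a b where ab: "den f = a * b" "\<And>z. poly a z = 0 \<Longrightarrow> z \<in> S" "\<And>z. z \<in> S \<Longrightarrow> poly b z \<noteq> 0"
    using poly_split_roots[OF den_nonzero, of f S] by metis
  have nz: "a \<noteq> 0" "b \<noteq> 0" using ab(1) den_nonzero[of f] by auto
  obtain x y where xy: "x * a + y * b = 1"
    by (rule bezout_no_common_root[OF nz(1), of b]) (use ab in auto)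
  define r where "r = (num f * y) mod a"
  define h where "h = Fract r a"
  have r: "r = 0 \<or> degree r < degree a" unfolding r_def using nz(1) by (intro degree_mod_less) auto
  have split: "num f * y = num f * y div a * a + r" by (simp add: r_def)
  have "f = to_fract (num f * (x * a + y * b)) / to_fract (a * b)"
    using ratfun_eq_to_fract[of f] by (simp add: xy ab(1))
  also have "\<dots> = to_fract (num f * x) / to_fract b + to_fract (num f * y) / to_fract a"
    using nz by (simp add: field_simps)
  also have "to_fract (num f * y) / to_fract a = to_fract (num f * y div a) + h"
    unfolding h_def Fract_conv_to_fract by (subst split) (use nz in \<open>simp add: field_simps del: div_mult_mod_eq\<close>)
  finally have "f = to_fract (num f * x) / to_fract b + to_fract (num f * y div a) + h"
    by (simp only: add.assoc)
  hence fh: "f - h = to_fract (num f * x) / to_fract b + to_fract (num f * y div a)"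
    by (metis add_diff_cancel_right')
  have "regular_at z h" if "z \<notin> S" for z
    unfolding h_def using that ab(2)[of z] by (intro regular_at_Fract) auto
  moreover have "regular_at z (f - h)" if "z \<in> S" for z
    unfolding fh using ab(3)[OF that] by (intro regular_at_add regular_at_divide regular_at_to_fract) auto
  moreover have "\<not> has_pole h Infty"
    unfolding h_def using nz r by (intro has_pole_Infty_Fract) auto
  moreover have "eval (rflat h) 0 = 0"
  proof (cases "r = 0")
    case True
    hence "h = rconst 0" by (simp add: h_def Fract_conv_to_fract)
    hence "rflat h = rconst 0" using rflat_rconst by metis
    thus ?thesis by simp
  next
    case False
    thus ?thesis using r has_pole_Infty_Fract[OF nz(1)] \<open>\<not> has_pole h Infty\<close>
      by (intro regular_at_0_rflat) (auto simp: h_def simp del: has_pole.simps)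
  qed
  ultimately show ?thesis by (auto simp: pole_part_in_def regular_on_def)
qed

section \<open>Fourier coefficients and the Riesz projection\<close>

lemma borel_measurable_eval [measurable]: "eval f \<in> borel_measurable borel"
proof -
  have "poly p \<in> borel_measurable borel" for p :: "complex poly"
    by (intro borel_measurable_continuous_onI continuous_intros)
  thus ?thesis unfolding eval_def[abs_def] by (intro borel_measurable_divide)
qed

lemma measurable_cis: "cis \<in> measurable (uniform_measure lborel A) borel"
  using borel_measurable_continuous_onI[of cis] by (simp add: continuous_intros)

lemma LINT_circle_measure:
  fixes F :: "complex \<Rightarrow> complex"
  assumes meas: "F \<in> borel_measurable borel" and cont: "continuous_on (sphere 0 1) F"
  shows "(LINT z|circle_measure. F z) = integral {0..2 * pi} (\<lambda>t. F (cis t)) / (2 * pi)"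
proof -
  have cis: "cis \<in> borel_measurable borel"
    by (intro borel_measurable_continuous_onI continuous_intros)
  have cont': "continuous_on {0..2 * pi} (\<lambda>t. F (cis t))"
    by (rule continuous_on_compose2[OF cont]) (auto intro!: continuous_intros)
  have "(LINT z|circle_measure. F z) = (LINT t|uniform_measure lborel {0..2 * pi}. F (cis t))"
    unfolding circle_measure_def using meas by (intro integral_distr measurable_cis)
  also have "uniform_measure lborel {0..2 * pi}
      = density lborel (\<lambda>t. ennreal (indicator {0..2 * pi} t / (2 * pi)))"
    unfolding uniform_measure_def
    by (intro density_cong) (auto simp: indicator_def divide_ennreal simp flip: ennreal_1)
  also have "(LINT t|\<dots>. F (cis t)) = (LINT t|lborel. (indicator {0..2 * pi} t / (2 * pi)) *\<^sub>R F (cis t))"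
    using meas cis by (intro integral_density) auto
  also have "\<dots> = (LINT t|lborel. (indicator {0..2 * pi} t *\<^sub>R F (cis t)) / (2 * pi))"
    by (intro Bochner_Integration.integral_cong) (auto simp: scaleR_conv_of_real)
  also have "\<dots> = (LINT t:{0..2 * pi}|lborel. F (cis t)) / (2 * pi)"
    unfolding set_lebesgue_integral_def by (rule integral_divide_zero)
  also have "(LINT t:{0..2 * pi}|lborel. F (cis t)) = integral {0..2 * pi} (\<lambda>t. F (cis t))"
    using cont' by (intro set_borel_integral_eq_integral borel_integrable_atLeastAtMost')
  finally show ?thesis .
qed

lemma AE_circle_measure: "AE z in circle_measure. z \<in> sphere 0 1"
  unfolding circle_measure_def by (subst AE_distr_iff[OF measurable_cis]) auto

lemma LINT_circle_measure_contour:
  fixes F :: "complex \<Rightarrow> complex"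
  assumes "F \<in> borel_measurable borel" "continuous_on (sphere 0 1) F"
    and "((\<lambda>u. F u / u) has_contour_integral I) (circlepath 0 1)"
  shows "(LINT z|circle_measure. F z) = I / (2 * pi * \<i>)"
proof -
  have "((\<lambda>t. F (cis t) / cis t * \<i> * cis t) has_integral I) {0..2 * pi}"
    using assms(3) unfolding circlepath_def by (subst (asm) has_contour_integral_part_circlepath_iff) auto
  hence "((\<lambda>t. F (cis t) * \<i>) has_integral I) {0..2 * pi}" by simp
  hence "integral {0..2 * pi} (\<lambda>t. F (cis t) * \<i>) = I" by (rule integral_unique)
  hence "I = integral {0..2 * pi} (\<lambda>t. F (cis t)) * \<i>" by simp
  thus ?thesis unfolding LINT_circle_measure[OF assms(1,2)] by simp
qed

lemma borel_measurable_powi: "(\<lambda>z::complex. z powi n) \<in> borel_measurable borel"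
  unfolding power_int_def by (intro measurable_If borel_measurable_power borel_measurable_inverse) auto

lemma continuous_on_circle_powi: "continuous_on (sphere 0 1) (\<lambda>z::complex. z powi n)"
  by (intro continuous_intros) auto

lemma fourier_coeff_add:
  assumes "regular_on (sphere 0 1) f" "regular_on (sphere 0 1) g"
  shows "fourier_coeff (eval (f + g)) j = fourier_coeff (eval f) j + fourier_coeff (eval g) j"
proof -
  have cont: "continuous_on (sphere 0 1) (\<lambda>z. eval h z * z powi (- j))" if "regular_on (sphere 0 1) h" for h
    by (intro continuous_on_mult continuous_on_eval that continuous_on_circle_powi)
  have meas: "(\<lambda>z. eval h z * z powi (- j)) \<in> borel_measurable borel" for h
    by (intro borel_measurable_times borel_measurable_eval borel_measurable_powi)
  have int: "(\<lambda>t. eval h (cis t) * cis t powi (- j)) integrable_on {0..2 * pi}"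
    if "regular_on (sphere 0 1) h" for h
    by (intro integrable_continuous_real continuous_on_compose2[OF cont[OF that]])
      (auto intro!: continuous_intros)
  have "regular_on (sphere 0 1) (f + g)" using assms by auto
  note L = LINT_circle_measure[OF meas cont]
  have "integral {0..2 * pi} (\<lambda>t. eval (f + g) (cis t) * cis t powi (- j))
    = integral {0..2 * pi} (\<lambda>t. eval f (cis t) * cis t powi (- j) + eval g (cis t) * cis t powi (- j))"
    using assms by (intro integral_cong) (auto simp: regular_on_def eval_add' ring_distribs)
  also have "\<dots> = integral {0..2 * pi} (\<lambda>t. eval f (cis t) * cis t powi (- j))
      + integral {0..2 * pi} (\<lambda>t. eval g (cis t) * cis t powi (- j))"
    by (intro Henstock_Kurzweil_Integration.integral_add int assms)
  finally show ?thesis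
    unfolding fourier_coeff_def L[OF assms(1)] L[OF assms(2)] L[OF \<open>regular_on (sphere 0 1) (f + g)\<close>]
    by (simp add: add_divide_distrib)
qed

lemma fourier_coeff_regular:
  assumes "regular_on (cball 0 1) g"
  shows "fourier_coeff (eval g) (int j) = (deriv ^^ j) (eval g) 0 / fact j"
proof -
  have cont: "continuous_on (cball 0 1) (eval g)" and hol: "eval g holomorphic_on ball 0 1"
    using assms by (auto intro!: continuous_on_eval holomorphic_on_eval elim: regular_on_subset)
  have "((\<lambda>u. eval g u / (u - 0) ^ Suc j) has_contour_integral
      (2 * pi * \<i>) / fact j * (deriv ^^ j) (eval g) 0) (circlepath 0 1)"
    by (rule Cauchy_has_contour_integral_higher_derivative_circlepath[OF cont hol]) simp
  also have "(\<lambda>u. eval g u / (u - 0) ^ Suc j) = (\<lambda>u. (eval g u * u powi (- int j)) / u)"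
    by (auto simp: power_int_minus field_simps)
  finally have "fourier_coeff (eval g) (int j)
      = (2 * pi * \<i>) / fact j * (deriv ^^ j) (eval g) 0 / (2 * pi * \<i>)"
    unfolding fourier_coeff_def
    by (intro LINT_circle_measure_contour borel_measurable_times borel_measurable_eval
        borel_measurable_powi continuous_on_mult continuous_on_circle_powi
        continuous_on_subset[OF cont]) auto
  thus ?thesis by simp
qed

text \<open>On the circle the conjugate of \<open>h\<close> is \<open>sharp h\<close>, which is regular on the closed disk and vanishes
  at the origin. The conjugate of the coefficient is the mean value of \<open>z\<^sup>j sharp h\<close> over the circle.\<close>

lemma fourier_coeff_pole_part:
  assumes "\<And>z. z \<notin> ball 0 1 \<Longrightarrow> regular_at z h" "\<not> has_pole h Infty" "eval (rflat h) 0 = 0"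
  shows "fourier_coeff (eval h) (int j) = 0"
proof -
  define H where "H = sharp h"
  have rflat: "rflat h = conj_coeffs H" by (simp add: H_def rflat_eq_conj_coeffs_sharp)
  have "regular_at 0 (conj_coeffs H)" using regular_at_0_rflat(1)[OF assms(2)] rflat by simp
  hence reg0: "regular_at 0 H" by (simp add: regular_at_conj_coeffs_iff)
  hence H0: "eval H 0 = 0" using assms(3) eval_conj_coeffs(2)[of 0 H] by (simp add: rflat)
  have "regular_at z H" if "z \<in> cball 0 1" for z
  proof (cases "z = 0")
    case False
    hence "1 / cnj z \<notin> ball 0 1" using that by (simp add: norm_divide)
    thus ?thesis unfolding H_def using False by (intro regular_at_sharp assms(1))
  qed (use reg0 in simp)
  hence reg: "regular_on (cball 0 1) H" by (simp add: regular_on_def)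
  have cont: "continuous_on (cball 0 1) (\<lambda>u. eval H u * u ^ j)"
    by (intro continuous_intros continuous_on_eval reg)
  have hol: "(\<lambda>u. eval H u * u ^ j) holomorphic_on ball 0 1"
    by (intro holomorphic_intros holomorphic_on_eval regular_on_subset[OF reg]) auto
  have "((\<lambda>u. eval H u * u ^ j / (u - 0)) has_contour_integral 2 * pi * \<i> * (eval H 0 * 0 ^ j)) (circlepath 0 1)"
    using Cauchy_has_contour_integral_higher_derivative_circlepath[OF cont hol, of 0 0] by simp
  hence "((\<lambda>u. eval H u * u ^ j / u) has_contour_integral 0) (circlepath 0 1)"
    by (simp add: H0)
  hence "(LINT z|circle_measure. eval H z * z ^ j) = 0 / (2 * pi * \<i>)"
    by (intro LINT_circle_measure_contour borel_measurable_times borel_measurable_eval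
        borel_measurable_power continuous_on_subset[OF cont]) auto
  hence A: "(LINT z|circle_measure. eval H z * z ^ j) = 0" by simp
  have B: "fourier_coeff (eval h) (int j) = (LINT z|circle_measure. cnj (eval H z * z ^ j))"
    unfolding fourier_coeff_def
  proof (rule integral_cong_AE)
    show "(\<lambda>z. eval h z * z powi (- int j)) \<in> borel_measurable circle_measure"
      unfolding circle_measure_def
      using borel_measurable_times[OF borel_measurable_eval[of h] borel_measurable_powi] by simp
    have "cnj \<in> borel_measurable borel"
      by (intro borel_measurable_continuous_onI continuous_intros)
    moreover have "(\<lambda>z. eval H z * z ^ j) \<in> borel_measurable borel"
      by (intro borel_measurable_times borel_measurable_eval borel_measurable_power) auto
    ultimately show "(\<lambda>z. cnj (eval H z * z ^ j)) \<in> borel_measurable circle_measure"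
      unfolding circle_measure_def using measurable_compose by fastforce
    show "AE z in circle_measure. eval h z * z powi (- int j) = cnj (eval H z * z ^ j)"
      using AE_circle_measure
    proof eventually_elim
      case (elim z)
      hence "z \<noteq> 0" by auto
      have "cnj z = 1 / z" using cnj_on_circle[of z] elim \<open>z \<noteq> 0\<close> by (auto simp: field_simps)
      moreover have "eval H z = cnj (eval h z)"
        unfolding H_def using elim assms(1)[of z] by (intro eval_sharp_circle(2)) auto
      ultimately show ?case by (simp add: power_int_minus field_simps)
    qed
  qed
  show ?thesis unfolding B Bochner_Integration.integral_cnj A by simp
qed

text \<open>The formulas for the coefficients of both parts show that the series defining the projection is the
  Taylor series of \<open>f - h\<close> at the origin.\<close>

lemma P_plus_eq:
  assumes f: "regular_on (sphere 0 1) f" and h: "pole_part_in (ball 0 1) f h"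
  shows "P_plus f = f - h" "regular_on (cball 0 1) (P_plus f)"
proof -
  have hout: "\<And>z. z \<notin> ball 0 1 \<Longrightarrow> regular_at z h" and "\<not> has_pole h Infty" "eval (rflat h) 0 = 0"
    using h by (auto simp: pole_part_in_def)
  note h0 = fourier_coeff_pole_part[OF this]
  define g where "g = f - h"
  have hs: "regular_on (sphere 0 1) h" using hout by (auto simp: regular_on_def)
  have gs: "regular_on (sphere 0 1) g" unfolding g_def using f hs by auto
  have "regular_on (ball 0 1) g" using h by (simp add: pole_part_in_def g_def)
  with gs have g: "regular_on (cball 0 1) g" by (force simp: regular_on_def)
  have "f = g + h" by (simp add: g_def)
  hence coeff: "fourier_coeff (eval f) (int j) = (deriv ^^ j) (eval g) 0 / fact j" for j
    using fourier_coeff_add[OF gs hs] h0 fourier_coeff_regular[OF g] by simp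
  have sums: "(\<lambda>j. fourier_coeff (eval f) (int j) * z ^ j) sums eval g z" if "z \<in> ball 0 1" for z
    unfolding coeff
    using holomorphic_power_series[of "eval g" 0 1 z] that holomorphic_on_eval[OF regular_on_subset[OF g]]
    by auto
  have "P_plus f = g"
    unfolding P_plus_def
  proof (rule the_equality)
    show "\<forall>z\<in>ball 0 1. (\<lambda>j. fourier_coeff (eval f) (int j) * z ^ j) sums eval g z" using sums by blast
    fix g' assume *: "\<forall>z\<in>ball 0 1. (\<lambda>j. fourier_coeff (eval f) (int j) * z ^ j) sums eval g' z"
    have "infinite (ball 0 1 :: complex set)" using uncountable_infinite[OF uncountable_ball[of 1 "0::complex"]] by simp
    thus "g' = g" by (rule ratfun_eqI) (use * sums sums_unique2 in blast)
  qed
  thus "P_plus f = f - h" "regular_on (cball 0 1) (P_plus f)" using g by (simp_all add: g_def)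
qed

section \<open>Principal parts\<close>

lemma isCont_eval:
  assumes "regular_at a f" shows "isCont (eval f) a"
proof -
  have "continuous_on {z. regular_at z f} (eval f)"
    by (rule continuous_on_eval) (auto simp: regular_on_def)
  moreover have "open {z. regular_at z f}"
    using finite_imp_closed[OF finite_not_regular_at[of f]] by (simp add: closed_def Collect_neg_eq)
  ultimately show ?thesis using assms by (simp add: continuous_on_eq_continuous_at)
qed

lemma tendsto_eval_at_infinity:
  assumes "\<not> has_pole h Infty" shows "(eval h \<longlongrightarrow> eval (rflat h) 0) at_infinity"
proof -
  have reg: "regular_at 0 (rflat h)" using regular_at_0_rflat(1)[OF assms] .
  hence "isCont (eval (rflat h)) 0" by (rule isCont_eval)
  hence lim: "(eval (rflat h) \<longlongrightarrow> eval (rflat h) 0) (at 0)" by (simp add: isCont_def)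
  have "\<forall>\<^sub>F z in at 0. regular_at (1 / z) h"
  proof -
    have fin: "finite {z. \<not> regular_at (1 / z) h}"
      using eventually_regular_at_inverse[of h] by (simp add: eventually_cofinite)
    have "open (- ({z. \<not> regular_at (1 / z) h} - {0}))"
      by (intro open_Compl finite_imp_closed) (use fin in auto)
    hence "\<forall>\<^sub>F z in nhds 0. z \<in> - ({z. \<not> regular_at (1 / z) h} - {0})"
      by (rule eventually_nhds_in_open) auto
    thus ?thesis unfolding eventually_at_filter by eventually_elim auto
  qed
  moreover have "\<forall>\<^sub>F z :: complex in at 0. z \<noteq> 0" by (simp add: eventually_at_filter)
  ultimately have "\<forall>\<^sub>F z in at 0. eval h (inverse z) = eval (rflat h) z"
    by eventually_elim (simp add: eval_rflat' inverse_eq_divide)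
  hence "((\<lambda>z. eval h (inverse z)) \<longlongrightarrow> eval (rflat h) 0) (at 0)"
    using lim by (simp cong: filterlim_cong add: tendsto_cong)
  thus ?thesis by (simp add: at_to_infinity filterlim_filtermap)
qed

lemma regular_everywhere_imp_to_fract:
  assumes "\<And>z. regular_at z d" obtains p where "d = to_fract p"
proof -
  have "degree (den d) = 0"
    using fundamental_theorem_of_algebra[of "den d"] constant_degree[of "den d"] assms
    by (auto simp: regular_at_def)
  then obtain c where c: "den d = [:c:]" by (rule degree_eq_zeroE)
  hence "c \<noteq> 0" using den_nonzero[of d] by auto
  have "to_fract (num d) = to_fract (smult (1 / c) (num d)) * to_fract [:c:]"
    using \<open>c \<noteq> 0\<close> by (simp flip: to_fract_mult)
  hence "d = to_fract (smult (1 / c) (num d))"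
    using ratfun_eq_to_fract[of d] \<open>c \<noteq> 0\<close> by (simp add: c)
  thus ?thesis by (rule that)
qed

lemma poly_tendsto_0_at_infinity:
  fixes p :: "complex poly"
  assumes "(poly p \<longlongrightarrow> 0) at_infinity" shows "p = 0"
proof (cases "degree p = 0")
  case True
  then obtain c where c: "p = [:c:]" by (rule degree_eq_zeroE)
  hence "poly p = (\<lambda>_. c)" by auto
  hence "((\<lambda>_::complex. c) \<longlongrightarrow> 0) at_infinity" using assms by simp
  hence "c = 0" by (simp add: tendsto_const_iff[OF trivial_limit_at_infinity])
  thus ?thesis using c by simp
next
  case False
  hence "filterlim (poly p) at_infinity at_infinity" by (intro filterlim_poly_at_infinity) auto
  thus ?thesis using assms not_tendsto_and_filterlim_at_infinity[OF trivial_limit_at_infinity, of "poly p"] by blast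
qed

lemma principal_part_Fin: "is_principal_part (Fin a) f (principal_part (Fin a) f)"
  unfolding principal_part_def
proof (rule theI')
  obtain h where h: "pole_part_in {a} f h" using pole_part_in_exists by blast
  have pole: "\<mu> = Fin a" if "has_pole h \<mu>" for \<mu>
  proof (cases \<mu>)
    case (Fin z)
    thus ?thesis using that h by (auto simp: pole_part_in_def has_pole_Fin_iff simp del: has_pole.simps)
  next
    case Infty
    thus ?thesis using that h by (auto simp: pole_part_in_def)
  qed
  have lim: "(eval h \<longlongrightarrow> 0) at_infinity"
    using h tendsto_eval_at_infinity[of h] by (auto simp: pole_part_in_def)
  show "\<exists>!g. is_principal_part (Fin a) f g"
  proof (rule ex1I)
    show "is_principal_part (Fin a) f h"
      using h pole lim
      by (auto simp: pole_part_in_def has_pole_Fin_iff regular_on_def simp del: has_pole.simps)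
    fix g assume g: "is_principal_part (Fin a) f g"
    hence g1: "regular_at z g" if "z \<noteq> a" for z
      using that has_pole_Fin_iff[of g z] by (auto simp del: has_pole.simps)
    from g have g2: "regular_at a (f - g)" and g3: "(eval g \<longlongrightarrow> 0) at_infinity"
      by (auto simp: has_pole_Fin_iff simp del: has_pole.simps)
    have "regular_at z (g - h)" for z
    proof (cases "z = a")
      case True
      have "regular_at a (f - h)" using h by (simp add: pole_part_in_def regular_on_def)
      moreover have "g - h = (f - h) - (f - g)" by simp
      ultimately show ?thesis using True g2 regular_at_diff by metis
    next
      case False
      thus ?thesis using h g1 by (auto simp: pole_part_in_def)
    qed
    then obtain p where p: "g - h = to_fract p" by (rule regular_everywhere_imp_to_fract)
    have "\<forall>\<^sub>F z in at_infinity. eval g z - eval h z = poly p z"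
    proof -
      have "\<forall>\<^sub>F z in at_infinity. z \<noteq> a"
        by (rule eventually_at_infinityI[of "norm a + 1"]) auto
      thus ?thesis
      proof eventually_elim
        case (elim z)
        hence "regular_at z g" "regular_at z h" using g1 h by (auto simp: pole_part_in_def)
        thus ?case using eval_diff[of z g h] by (simp add: p)
      qed
    qed
    moreover have "((\<lambda>z. eval g z - eval h z) \<longlongrightarrow> 0 - 0) at_infinity"
      by (intro tendsto_diff g3 lim)
    ultimately have "(poly p \<longlongrightarrow> 0) at_infinity" by (simp add: tendsto_cong)
    hence "p = 0" by (rule poly_tendsto_0_at_infinity)
    thus "g = h" using p by simp
  qed
qed

section \<open>Badly approximable unimodular functions\<close>

lemma emeasure_circle_measure_nonzero: "emeasure circle_measure (space circle_measure) \<noteq> 0"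
proof -
  have "prob_space (uniform_measure lborel {0..2 * pi})"
    by (rule prob_space_uniform_measure) auto
  hence "prob_space circle_measure"
    unfolding circle_measure_def by (rule prob_space.prob_space_distr) (rule measurable_cis)
  thus ?thesis using prob_space.emeasure_space_1 by fastforce
qed

lemma Linf_norm_le:
  assumes "g \<in> borel_measurable borel" "\<And>z. z \<in> sphere 0 1 \<Longrightarrow> norm (g z) \<le> c"
  shows "Linf_norm g \<le> ereal c"
  unfolding Linf_norm_def
proof (rule esssup_I)
  show "(\<lambda>z. ereal (cmod (g z))) \<in> borel_measurable circle_measure"
    using assms(1) unfolding circle_measure_def by simp
  show "AE z in circle_measure. ereal (cmod (g z)) \<le> ereal c"
    using AE_circle_measure by eventually_elim (use assms(2) in simp)
qed

lemma Linf_norm_unimodular: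
  assumes "unimodular_on_circle u" shows "Linf_norm (eval u) = 1"
proof -
  have "Linf_norm (eval u) = esssup circle_measure (\<lambda>_. 1 :: ereal)"
    unfolding Linf_norm_def
  proof (rule esssup_AE_cong)
    show "(\<lambda>z. ereal (cmod (eval u z))) \<in> borel_measurable circle_measure"
      unfolding circle_measure_def by simp
    show "AE z in circle_measure. ereal (cmod (eval u z)) = 1"
      using AE_circle_measure
      by eventually_elim (use assms in \<open>auto simp: unimodular_on_circle_def one_ereal_def\<close>)
  qed auto
  also have "\<dots> = 1" by (rule esssup_const[OF emeasure_circle_measure_nonzero])
  finally show ?thesis .
qed

lemma eval_in_Hinf_boundary:
  assumes "regular_on (cball 0 1) f" shows "eval f \<in> Hinf_boundary"
proof -
  have "AE z in circle_measure. ((\<lambda>r. eval f (complex_of_real r * z)) \<longlongrightarrow> eval f z) (at_left 1)"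
    using AE_circle_measure
  proof eventually_elim
    case (elim z)
    hence "isCont (eval f) z" using assms by (intro isCont_eval) (auto simp: regular_on_def)
    moreover have "((\<lambda>r. complex_of_real r * z) \<longlongrightarrow> complex_of_real 1 * z) (at_left 1)"
      by (intro tendsto_intros)
    ultimately show ?case using isCont_tendsto_compose by fastforce
  qed
  moreover have "eval f \<in> Hinf" using assms by (simp add: Hinf_iff)
  ultimately show ?thesis by (auto simp: Hinf_boundary_def)
qed

text \<open>The polynomial \<open>z\<^sup>m cnj (p (1 / cnj z))\<close> with \<open>m = degree p\<close>: its zeros are the
  reflections of those of \<open>p\<close> in the circle.\<close>

definition refl_poly :: "complex poly \<Rightarrow> complex poly" where
  "refl_poly p = reflect_poly (map_poly cnj p)"

lemma poly_refl_poly: "z \<noteq> 0 \<Longrightarrow> poly (refl_poly p) z = z ^ degree p * cnj (poly p (1 / cnj z))"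
  by (simp add: refl_poly_def poly_reflect_poly_nz poly_map_cnj inverse_eq_divide degree_map_poly)

lemma poly_refl_poly_nonzero:
  assumes "p \<noteq> 0" "\<And>z. poly p z = 0 \<Longrightarrow> z \<in> ball 0 1" "z \<in> cball 0 1"
  shows "poly (refl_poly p) z \<noteq> 0"
proof (cases "z = 0")
  case True
  thus ?thesis using assms(1) by (simp add: refl_poly_def map_poly_eq_0_iff)
next
  case False
  hence "1 / cnj z \<notin> ball 0 1" using assms(3) by (simp add: norm_divide)
  thus ?thesis using assms(2)[of "1 / cnj z"] False by (auto simp: poly_refl_poly)
qed

lemma poly_circle_eq:
  assumes "z \<in> sphere 0 1" shows "poly p z = z ^ degree p * cnj (poly (refl_poly p) z)"
proof -
  have z: "z \<noteq> 0" "1 / cnj z = z" "z * cnj z = 1"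
    using assms cnj_on_circle[of z] by (auto simp: complex_norm_square[symmetric])
  thus ?thesis by (simp add: poly_refl_poly flip: power_mult_distrib mult.assoc)
qed

text \<open>A unimodular function with at least as many zeros as poles in the disk is closer than 1 to
  \<open>H\<^sup>\<infinity>\<close>. On the circle it equals \<open>z\<^sup>n (cnj p / cnj q) h\<close>, where \<open>n\<close> is the difference of these
  numbers and \<open>p\<close>, \<open>q\<close>, \<open>h\<close> are invertible on the closed disk; so \<open>z\<^sup>n (q / p) h\<close> is a positive
  multiple of it there, and a small multiple of this bounded analytic function is the approximant.\<close>

lemma badly_approximable_zeros_poles:
  assumes "unimodular_on_circle u" "badly_approximable u"
    and num: "num u = a * b" "\<And>z. poly a z = 0 \<Longrightarrow> z \<in> ball 0 1" "\<And>z. z \<in> cball 0 1 \<Longrightarrow> poly b z \<noteq> 0"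
    and den: "den u = c * d" "\<And>z. poly c z = 0 \<Longrightarrow> z \<in> ball 0 1" "\<And>z. z \<in> cball 0 1 \<Longrightarrow> poly d z \<noteq> 0"
  shows "degree a < degree c"
proof (rule ccontr)
  assume "\<not> degree a < degree c"
  define n where "n = degree a - degree c"
  have n: "degree a = n + degree c" using \<open>\<not> degree a < degree c\<close> by (simp add: n_def)
  have unit: "norm (eval u z) = 1" if "z \<in> sphere 0 1" for z
    using assms(1) that by (simp add: unimodular_on_circle_def)
  have "a \<noteq> 0" 
  proof
    assume "a = 0"
    hence "u = 0" using num(1) ratfun_eq_to_fract[of u] by simp
    thus False using unit[of 1] by simp
  qed
  have "c \<noteq> 0" using den(1) den_nonzero[of u] by auto
  define p where "p = refl_poly a"
  define q where "q = refl_poly c"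
  have pq: "poly p z \<noteq> 0" "poly q z \<noteq> 0" if "z \<in> cball 0 1" for z
    using poly_refl_poly_nonzero[OF \<open>a \<noteq> 0\<close> num(2) that] poly_refl_poly_nonzero[OF \<open>c \<noteq> 0\<close> den(2) that]
    by (simp_all add: p_def q_def)
  define g where "g = Fract (monom 1 n * q * b) (p * d)"
  have g: "regular_at z g" "eval g z = z ^ n * poly q z * poly b z / (poly p z * poly d z)" 
    if "z \<in> cball 0 1" for z
    using regular_at_Fract[of "p * d" z "monom 1 n * q * b"] pq(1)[OF that] den(3)[OF that]
    by (auto simp: g_def poly_monom)
  have regg: "regular_on (cball 0 1) g" using g(1) by (simp add: regular_on_def)
  have gu: "eval g z = complex_of_real (norm (eval g z)) * eval u z" if z: "z \<in> sphere 0 1" for z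
  proof -
    have z': "z \<in> cball 0 1" "z \<noteq> 0" using z by auto
    define \<rho> where "\<rho> = (norm (poly q z))\<^sup>2 / (norm (poly p z))\<^sup>2"
    have "eval u z = (z ^ degree a * cnj (poly p z) * poly b z) / (z ^ degree c * cnj (poly q z) * poly d z)"
      unfolding eval_def num(1) den(1) p_def q_def poly_mult
      by (subst (1 2) poly_circle_eq[OF z]) (rule refl)
    hence A: "eval u z = z ^ n * cnj (poly p z) * poly b z / (cnj (poly q z) * poly d z)"
      using z' pq[OF z'(1)] den(3)[OF z'(1)] by (simp add: n power_add)
    have "complex_of_real \<rho> * eval u z = eval g z"
      unfolding A g(2)[OF z'(1)] \<rho>_def using z' pq[OF z'(1)] den(3)[OF z'(1)]
      by (simp add: complex_norm_square field_simps del: of_real_power)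
    moreover from this have "norm (eval g z) = \<rho>"
      using unit[OF z] by (metis \<rho>_def abs_of_nonneg divide_nonneg_nonneg mult.right_neutral
          norm_mult norm_of_real zero_le_power2)
    ultimately show ?thesis by simp
  qed
  have pos: "norm (eval g z) > 0" if "z \<in> sphere 0 1" for z
    using g(2)[of z] pq[of z] num(3)[of z] den(3)[of z] that by auto
  have comp: "compact (sphere 0 1 :: complex set)" "sphere 0 1 \<noteq> ({} :: complex set)" by auto
  have cont: "continuous_on (sphere 0 1) (\<lambda>z. norm (eval g z))"
    by (intro continuous_on_norm continuous_on_eval regular_on_subset[OF regg]) auto
  obtain x y where x: "x \<in> sphere 0 1" "\<And>z. z \<in> sphere 0 1 \<Longrightarrow> norm (eval g z) \<le> norm (eval g x)"
    and y: "y \<in> sphere 0 1" "\<And>z. z \<in> sphere 0 1 \<Longrightarrow> norm (eval g y) \<le> norm (eval g z)"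
    using continuous_attains_sup[OF comp cont] continuous_attains_inf[OF comp cont] by auto
  define \<epsilon> where "\<epsilon> = 1 / norm (eval g x)"
  define f where "f = rconst (complex_of_real \<epsilon>) * g"
  have f: "regular_on (cball 0 1) f" unfolding f_def using regg by auto
  have "norm (eval u z - eval f z) \<le> 1 - \<epsilon> * norm (eval g y)" if z: "z \<in> sphere 0 1" for z
  proof -
    have "regular_at z g" using g(1)[of z] z by auto
    hence "eval f z = complex_of_real (\<epsilon> * norm (eval g z)) * eval u z"
      unfolding f_def by (subst eval_mult') (use gu[OF z] in auto)
    hence "eval u z - eval f z = complex_of_real (1 - \<epsilon> * norm (eval g z)) * eval u z"
      by (simp add: ring_distribs)
    hence "norm (eval u z - eval f z) = \<bar>1 - \<epsilon> * norm (eval g z)\<bar>"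
      using unit[OF z] by (simp only: norm_mult norm_of_real mult_1_right)
    moreover have "\<epsilon> * norm (eval g z) \<le> 1"
      unfolding \<epsilon>_def using x(2)[OF z] pos[OF x(1)] by simp
    moreover have "\<epsilon> * norm (eval g y) \<le> \<epsilon> * norm (eval g z)"
      unfolding \<epsilon>_def using y(2)[OF z] by (intro mult_left_mono) auto
    ultimately show ?thesis by linarith
  qed
  hence "Linf_norm (\<lambda>z. eval u z - eval f z) \<le> ereal (1 - \<epsilon> * norm (eval g y))"
    by (intro Linf_norm_le borel_measurable_diff borel_measurable_eval)
  also have "\<dots> < ereal 1"
    unfolding \<epsilon>_def using pos[OF x(1)] pos[OF y(1)] by simp
  finally have "(INF f\<in>Hinf_boundary. Linf_norm (\<lambda>z. eval u z - f z)) < 1"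
    using eval_in_Hinf_boundary[OF f] by (intro INF_less_iff[THEN iffD2]) (auto simp: one_ereal_def)
  thus False using assms(2) Linf_norm_unimodular[OF assms(1)]
    by (simp add: badly_approximable_def)
qed

section \<open>Degrees of projections and principal parts\<close>

definition denominator_at :: "complex \<Rightarrow> complex poly \<Rightarrow> (2, 2) ratmat \<Rightarrow> bool" where
  "denominator_at a q \<Phi> \<longleftrightarrow> (\<forall>i j. regular_at a (to_fract q * \<Phi> $ i $ j)) \<and> regular_at a (to_fract q * det \<Phi>)"

lemma pole_denominator_iff: "pole_denominator q \<Phi> \<longleftrightarrow> q \<noteq> 0 \<and> (\<forall>a\<in>ball 0 1. denominator_at a q \<Phi>)"
  by (auto simp: pole_denominator_def denominator_at_def regular_on_def)

text \<open>The mixed terms of the determinant are products of an entry of \<open>\<Phi>\<close> with a regular function, so they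
  need no other denominator than the entries.\<close>

lemma denominator_at_add_regular:
  assumes "denominator_at a q \<Phi>" "\<And>i j. regular_at a (R $ i $ j)"
  shows "denominator_at a q (\<Phi> + R)"
proof -
  have \<Phi>: "\<And>i j. regular_at a (to_fract q * \<Phi> $ i $ j)" "regular_at a (to_fract q * det \<Phi>)"
    using assms(1) by (auto simp: denominator_at_def)
  have "to_fract q * (\<Phi> + R) $ i $ j = to_fract q * \<Phi> $ i $ j + to_fract q * R $ i $ j" for i j
    by (simp add: ring_distribs)
  moreover have "to_fract q * det (\<Phi> + R) = to_fract q * det \<Phi>
      + (to_fract q * \<Phi> $ 1 $ 1) * R $ 2 $ 2 + (to_fract q * \<Phi> $ 2 $ 2) * R $ 1 $ 1
      - (to_fract q * \<Phi> $ 1 $ 2) * R $ 2 $ 1 - (to_fract q * \<Phi> $ 2 $ 1) * R $ 1 $ 2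
      + to_fract q * (R $ 1 $ 1 * R $ 2 $ 2 - R $ 1 $ 2 * R $ 2 $ 1)"
    by (simp add: det_2 algebra_simps)
  ultimately show ?thesis
    unfolding denominator_at_def using \<Phi> assms(2)
    by (simp add: regular_at_add regular_at_diff regular_at_mult)
qed

lemma denominator_at_regular:
  assumes "\<And>i j. regular_at a (\<Phi> $ i $ j)" shows "denominator_at a q \<Phi>"
  unfolding denominator_at_def det_2 using assms
  by (intro conjI allI regular_at_mult regular_at_diff regular_at_to_fract)

lemma pole_denominator_exists:
  fixes \<Phi> :: "(2, 2) ratmat"
  obtains q where "pole_denominator q \<Phi>"
proof -
  define d where "d i j = den (\<Phi> $ i $ j)" for i j
  define N where "N i j = num (\<Phi> $ i $ j)" for i j
  have \<Phi>: "\<Phi> $ i $ j = to_fract (N i j) / to_fract (d i j)" for i j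
    unfolding N_def d_def by (rule ratfun_eq_to_fract)
  have d: "d i j \<noteq> 0" for i j by (simp add: d_def)
  define q where "q = d 1 1 * d 1 2 * d 2 1 * d 2 2"
  have entries: "to_fract q * \<Phi> $ 1 $ 1 = to_fract (N 1 1 * d 1 2 * d 2 1 * d 2 2)"
    "to_fract q * \<Phi> $ 1 $ 2 = to_fract (d 1 1 * N 1 2 * d 2 1 * d 2 2)"
    "to_fract q * \<Phi> $ 2 $ 1 = to_fract (d 1 1 * d 1 2 * N 2 1 * d 2 2)"
    "to_fract q * \<Phi> $ 2 $ 2 = to_fract (d 1 1 * d 1 2 * d 2 1 * N 2 2)"
    unfolding \<Phi> q_def using d by (simp_all add: field_simps)
  have det: "to_fract q * det \<Phi> = to_fract (N 1 1 * d 1 2 * d 2 1 * N 2 2 - d 1 1 * N 1 2 * N 2 1 * d 2 2)"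
    unfolding det_2 \<Phi> q_def using d by (simp add: field_simps)
  have "pole_denominator q \<Phi>"
    unfolding pole_denominator_def forall_2 entries det using d by (auto simp: q_def simp del: to_fract_mult to_fract_diff)
  thus ?thesis by (rule that)
qed

lemma mat_has_pole_Fin: "mat_has_pole \<Phi> (Fin a) \<longleftrightarrow> (\<exists>i j. \<not> regular_at a (\<Phi> $ i $ j))"
  by (simp add: mat_has_pole_def has_pole_Fin_iff del: has_pole.simps)

lemma mcmillan_degree_poles_in_disk:
  assumes "\<And>i j z. z \<notin> ball 0 1 \<Longrightarrow> regular_at z (\<Phi> $ i $ j)" "\<And>i j. \<not> has_pole (\<Phi> $ i $ j) Infty"
  shows "mcmillan_degree \<Phi> = degree_disk \<Phi>"
proof -
  have "p \<in> Fin ` ball 0 1" if "mat_has_pole \<Phi> p" for p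
  proof (cases p)
    case (Fin a)
    hence "a \<in> ball 0 1" using that assms(1)[of a] mat_has_pole_Fin[of \<Phi> a] by blast
    thus ?thesis using Fin by simp
  next
    case Infty
    thus ?thesis using that assms(2) by (auto simp: mat_has_pole_def simp del: has_pole.simps)
  qed
  thus ?thesis by (simp add: mcmillan_degree_def)
qed

lemma mat_P_minus_props:
  assumes "regular_mat (sphere 0 1) \<Phi>"
  shows "pole_part_in (ball 0 1) (\<Phi> $ i $ j) (mat_P_minus \<Phi> $ i $ j)"
    and "regular_on (cball 0 1) (mat_P_plus \<Phi> $ i $ j)"
    and "mcmillan_degree (mat_P_minus \<Phi>) = degree_disk (mat_P_minus \<Phi>)"
    and "regular_mat (sphere 0 1) (mat_P_minus \<Phi>)"
proof -
  have 1: "pole_part_in (ball 0 1) (\<Phi> $ i $ j) (mat_P_minus \<Phi> $ i $ j)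
     \<and> regular_on (cball 0 1) (mat_P_plus \<Phi> $ i $ j)" for i j
  proof -
    obtain h where h: "pole_part_in (ball 0 1) (\<Phi> $ i $ j) h" using pole_part_in_exists by blast
    have "regular_on (sphere 0 1) (\<Phi> $ i $ j)" using assms by (simp add: regular_mat_def)
    note P = P_plus_eq[OF this h]
    have "mat_P_minus \<Phi> $ i $ j = h" by (simp add: mat_P_minus_def mat_P_plus_def P(1))
    thus ?thesis using h P(2) by (simp add: mat_P_plus_def)
  qed
  thus "pole_part_in (ball 0 1) (\<Phi> $ i $ j) (mat_P_minus \<Phi> $ i $ j)"
    "regular_on (cball 0 1) (mat_P_plus \<Phi> $ i $ j)" by auto
  show "mcmillan_degree (mat_P_minus \<Phi>) = degree_disk (mat_P_minus \<Phi>)"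
    using 1 by (intro mcmillan_degree_poles_in_disk) (auto simp: pole_part_in_def)
  show "regular_mat (sphere 0 1) (mat_P_minus \<Phi>)"
    using 1 by (auto simp: pole_part_in_def regular_mat_def regular_on_def)
qed

lemma degree_P_minus_denominator:
  fixes \<Phi> :: "(2, 2) ratmat"
  assumes "regular_mat (sphere 0 1) \<Phi>"
  obtains q where "pole_denominator q \<Phi>" "degree q \<le> mcmillan_degree (mat_P_minus \<Phi>)"
proof -
  note P = mat_P_minus_props[OF assms]
  obtain q0 where "pole_denominator q0 (mat_P_minus \<Phi>)" by (rule pole_denominator_exists)
  then obtain q where q: "pole_denominator q (mat_P_minus \<Phi>)" "degree q \<le> degree_disk (mat_P_minus \<Phi>)"
    using degree_disk_denominator[OF bp_size_2] P(4) by blast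
  have "denominator_at a q (mat_P_minus \<Phi> + mat_P_plus \<Phi>)" if "a \<in> ball 0 1" for a
    using q(1) P(2) that
    by (intro denominator_at_add_regular) (auto simp: pole_denominator_iff regular_on_def)
  hence "pole_denominator q \<Phi>"
    using q(1) by (simp add: pole_denominator_iff mat_P_minus_def)
  thus ?thesis using q(2) P(3) that by simp
qed

lemma det_map_rflat: "det (map_matrix rflat \<Phi>) = rflat (det (\<Phi> :: (2, 2) ratmat))"
  by (simp add: det_2 rflat_mult rflat_diff)

text \<open>The function \<open>z \<mapsto> \<Phi> (1 / z)\<close> is \<open>sharp \<Phi>\<close> with conjugated coefficients, and the
  antianalytic projection contributes no poles in the disk to it.\<close>

lemma degree_P_plus_le:
  fixes \<Phi> :: "(2, 2) ratmat"
  assumes "regular_mat (sphere 0 1) \<Phi>" "q \<noteq> 0"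
    and q: "\<And>i j. regular_on (ball 0 1) (to_fract q * sharp (\<Phi> $ i $ j))"
      "regular_on (ball 0 1) (to_fract q * sharp (det \<Phi>))"
  shows "mcmillan_degree (mat_P_plus \<Phi>) \<le> degree q"
proof -
  note P = mat_P_minus_props[OF assms(1)]
  have pole: "\<not> mat_has_pole (mat_P_plus \<Phi>) (Fin a)" if "a \<in> cball 0 1" for a
    using P(2) that by (auto simp: mat_has_pole_Fin regular_on_def)
  have sphere: "regular_mat (sphere 0 1) (mat_P_plus \<Phi>)"
    using P(2) by (auto simp: regular_mat_def regular_on_def)
  show ?thesis
  proof (cases "\<forall>p. mat_has_pole (mat_P_plus \<Phi>) p \<longrightarrow> p \<in> Fin ` ball 0 1")
    case True
    hence "mcmillan_degree (mat_P_plus \<Phi>) = degree_disk (mat_P_plus \<Phi>)"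
      by (simp add: mcmillan_degree_def)
    also have "pole_denominator 1 (mat_P_plus \<Phi>)"
      unfolding pole_denominator_iff using P(2)
      by (auto simp: regular_on_def intro!: denominator_at_regular)
    hence "degree_disk (mat_P_plus \<Phi>) \<le> degree (1 :: complex poly)"
      using sphere by (rule degree_disk_le[OF bp_size_2])
    finally show ?thesis by simp
  next
    case False
    have no_pole: "\<forall>a\<in>cball 0 1. \<not> mat_has_pole (mat_P_plus \<Phi>) (Fin a)" using pole by blast
    have "mcmillan_degree (mat_P_plus \<Phi>) = degree_disk (map_matrix rflat (mat_P_plus \<Phi>))"
      unfolding mcmillan_degree_def if_not_P[OF False] if_P[OF no_pole] ..
    also have "\<dots> \<le> degree (map_poly cnj q)"
    proof (rule degree_disk_le[OF bp_size_2])
      define cq where "cq = map_poly cnj q"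
      have cq: "regular_on (ball 0 1) (to_fract cq * rflat f)"
        if "regular_on (ball 0 1) (to_fract q * sharp f)" for f
      proof -
        have "to_fract cq * rflat f = conj_coeffs (to_fract q * sharp f)"
          by (simp add: cq_def rflat_eq_conj_coeffs_sharp conj_coeffs_mult conj_coeffs_to_fract)
        thus ?thesis using that by (auto intro!: regular_on_conj_coeffs)
      qed
      have den: "denominator_at a cq (map_matrix rflat \<Phi>)" if "a \<in> ball 0 1" for a
        using cq[OF q(1)] cq[OF q(2)] that
        by (auto simp: denominator_at_def regular_on_def det_map_rflat)
      have "regular_at a (rflat (mat_P_minus \<Phi> $ i $ j))" if "a \<in> ball 0 1" for a i j
      proof (cases "a = 0")
        case True
        thus ?thesis using P(1)[of i j] regular_at_0_rflat(1) by (auto simp: pole_part_in_def)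
      next
        case False
        hence "1 / a \<notin> ball 0 1" using that by (simp add: norm_divide)
        thus ?thesis using P(1)[of i j] False by (intro regular_at_rflat) (auto simp: pole_part_in_def)
      qed
      hence "denominator_at a cq (map_matrix rflat \<Phi> + (- map_matrix rflat (mat_P_minus \<Phi>)))"
        if "a \<in> ball 0 1" for a
        using den[OF that] that by (intro denominator_at_add_regular) auto
      moreover have "map_matrix rflat \<Phi> + (- map_matrix rflat (mat_P_minus \<Phi>)) = map_matrix rflat (mat_P_plus \<Phi>)"
        by (simp add: vec_eq_iff mat_P_minus_def rflat_diff)
      ultimately show "pole_denominator (map_poly cnj q) (map_matrix rflat (mat_P_plus \<Phi>))"
        using assms(2) by (auto simp: pole_denominator_iff cq_def map_poly_eq_0_iff)
      have "regular_at z (rflat (mat_P_plus \<Phi> $ i $ j))" if "z \<in> sphere 0 1" for z i j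
        using P(2)[of i j] that by (intro regular_at_rflat) (auto simp: regular_on_def norm_divide)
      thus "regular_mat (sphere 0 1) (map_matrix rflat (mat_P_plus \<Phi>))"
        by (simp add: regular_mat_def regular_on_def)
    qed
    also have "degree (map_poly cnj q) = degree q" by (simp add: degree_map_poly)
    finally show ?thesis .
  qed
qed

lemma principal_part_regular:
  assumes "z \<noteq> a" shows "regular_at z (principal_part (Fin a) f)"
  using principal_part_Fin[of a f] assms has_pole_Fin_iff[of "principal_part (Fin a) f" z]
  by (auto simp del: has_pole.simps)

lemma principal_part_remainder_regular: "regular_at a (f - principal_part (Fin a) f)"
  using principal_part_Fin[of a f] by (simp add: has_pole_Fin_iff del: has_pole.simps)

lemma degree_at_eq_degree_disk:
  assumes "a \<in> ball 0 1"
  shows "degree_at (Fin a) \<Phi> = degree_disk (map_matrix (principal_part (Fin a)) \<Phi>)"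
  unfolding degree_at_def
proof (rule mcmillan_degree_poles_in_disk)
  show "regular_at z (map_matrix (principal_part (Fin a)) \<Phi> $ i $ j)" if "z \<notin> ball 0 1" for z i j
    using that assms by (auto intro!: principal_part_regular)
  show "\<not> has_pole (map_matrix (principal_part (Fin a)) \<Phi> $ i $ j) Infty" for i j
    using principal_part_Fin[of a "\<Phi> $ i $ j"] by (auto simp del: has_pole.simps)
qed

lemma regular_mat_sphere_principal_part:
  "a \<in> ball 0 1 \<Longrightarrow> regular_mat (sphere 0 1) (map_matrix (principal_part (Fin a)) \<Phi>)"
  by (auto simp: regular_mat_def regular_on_def intro!: principal_part_regular)

text \<open>The degree of the principal part at \<open>a\<close> is governed by the matrix itself: they differ by a
  matrix that is regular at \<open>a\<close>, and the principal part has no other poles.\<close>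

lemma degree_at_le:
  fixes \<Phi> :: "(2, 2) ratmat"
  assumes a: "a \<in> ball 0 1" and ord: "\<And>i j. ord_ge a (- int m) (\<Phi> $ i $ j)" "ord_ge a (- int m) (det \<Phi>)"
  shows "degree_at (Fin a) \<Phi> \<le> m"
proof -
  let ?p = "map_matrix (principal_part (Fin a)) \<Phi>"
  define q where "q = [:- a, 1:] ^ m"
  have "denominator_at a q \<Phi>"
    using ord by (simp add: denominator_at_def q_def to_fract_power ord_ge_def mult.commute)
  hence "denominator_at a q (\<Phi> + (- (\<Phi> - ?p)))"
    by (rule denominator_at_add_regular)
      (auto intro!: regular_at_uminus principal_part_remainder_regular simp del: minus_diff_eq)
  hence "denominator_at z q ?p" for z
    by (cases "z = a") (auto intro!: denominator_at_regular principal_part_regular)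
  hence "pole_denominator q ?p" by (simp add: pole_denominator_iff q_def)
  hence "degree_disk ?p \<le> degree q"
    using regular_mat_sphere_principal_part[OF a] by (rule degree_disk_le[OF bp_size_2])
  also have "degree q = m" by (simp add: q_def degree_power_eq)
  finally show ?thesis by (simp add: degree_at_eq_degree_disk[OF a])
qed

lemma ord_ge_degree_at:
  fixes \<Phi> :: "(2, 2) ratmat"
  assumes a: "a \<in> ball 0 1" shows "ord_ge a (- int (degree_at (Fin a) \<Phi>)) (\<Phi> $ i $ j)"
proof -
  let ?p = "map_matrix (principal_part (Fin a)) \<Phi>"
  obtain q0 where "pole_denominator q0 ?p" by (rule pole_denominator_exists)
  then obtain q where q: "pole_denominator q ?p" "degree q \<le> degree_at (Fin a) \<Phi>"
    using degree_disk_denominator[OF bp_size_2] regular_mat_sphere_principal_part[OF a]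
      degree_at_eq_degree_disk[OF a] by metis
  have "q \<noteq> 0" "regular_at a (to_fract q * ?p $ i $ j)"
    using q(1) a by (auto simp: pole_denominator_iff denominator_at_def)
  hence "ord_ge a (- int (order a q)) (?p $ i $ j)" using ord_ge_to_fract_mult_iff by blast
  moreover have "order a q \<le> degree_at (Fin a) \<Phi>"
    using order_degree[OF \<open>q \<noteq> 0\<close>, of a] q(2) by simp
  ultimately have "ord_ge a (- int (degree_at (Fin a) \<Phi>)) (?p $ i $ j)"
    using ord_ge_mono by fastforce
  moreover have "ord_ge a (- int (degree_at (Fin a) \<Phi>)) (\<Phi> $ i $ j - ?p $ i $ j)"
    using ord_ge_mono[of a 0 "\<Phi> $ i $ j - ?p $ i $ j"] principal_part_remainder_regular[of a "\<Phi> $ i $ j"]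
    by (simp add: ord_ge_0_iff)
  ultimately show ?thesis using ord_ge_add[of a _ "\<Phi> $ i $ j - ?p $ i $ j" "?p $ i $ j"] by simp
qed

text \<open>A common denominator vanishes at every pole in the disk.\<close>

lemma card_poles_le_degree_P_minus:
  assumes "regular_on (sphere 0 1) u"
  shows "finite {a \<in> ball 0 1. \<not> regular_at a u}"
    and "card {a \<in> ball 0 1. \<not> regular_at a u} \<le> mcmillan_degree (mat_P_minus (mat u :: (1, 1) ratmat))"
proof -
  let ?\<Phi> = "mat u :: (1, 1) ratmat"
  show fin: "finite {a \<in> ball 0 1. \<not> regular_at a u}"
    using finite_not_regular_at[of u] by (rule rev_finite_subset) auto
  have \<Phi>: "?\<Phi> $ 1 $ 1 = u" by (simp add: mat_def)
  have "regular_mat (sphere 0 1) ?\<Phi>" using assms by (simp add: regular_mat_def forall_1 \<Phi>)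
  note P = mat_P_minus_props[OF this]
  define h where "h = mat_P_minus ?\<Phi> $ 1 $ 1"
  have h: "pole_part_in (ball 0 1) u h" using P(1)[of 1 1] by (simp add: \<Phi> h_def)
  have "to_fract (den h) * h = to_fract (num h)"
    using ratfun_eq_to_fract[of h] by (metis den_nonzero nonzero_mult_div_cancel_left
        times_divide_eq_right to_fract_eq_0_iff)
  hence "pole_denominator (den h) (mat_P_minus ?\<Phi>)"
    by (auto simp: pole_denominator_def det_1 forall_1 h_def[symmetric])
  then obtain q where q: "pole_denominator q (mat_P_minus ?\<Phi>)" "degree q \<le> degree_disk (mat_P_minus ?\<Phi>)"
    using degree_disk_denominator[OF bp_size_1] P(4) by blast
  have qh: "q \<noteq> 0" "regular_on (ball 0 1) (to_fract q * h)"
    using q(1) by (auto simp: pole_denominator_def h_def)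
  have "{a \<in> ball 0 1. \<not> regular_at a u} \<subseteq> {a. poly q a = 0}"
  proof
    fix a assume "a \<in> {a \<in> ball 0 1. \<not> regular_at a u}"
    hence a: "a \<in> ball 0 1" "\<not> regular_at a u" by auto
    have "regular_at a (u - h)" using h a(1) by (auto simp: pole_part_in_def regular_on_def)
    hence "\<not> regular_at a h" using a(2) regular_at_add[of a "u - h" h] by auto
    moreover have "regular_at a (to_fract q * h)" using qh(2) a(1) by (simp add: regular_on_def)
    ultimately show "a \<in> {a. poly q a = 0}"
      using ord_ge_unit_mult_iff[of a "to_fract q" 0 h] by (auto simp: ord_ge_0_iff)
  qed
  hence "card {a \<in> ball 0 1. \<not> regular_at a u} \<le> card {a. poly q a = 0}"
    by (intro card_mono poly_roots_finite qh(1))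
  also have "\<dots> \<le> degree q" by (rule card_poly_roots_bound[OF qh(1)])
  finally show "card {a \<in> ball 0 1. \<not> regular_at a u} \<le> mcmillan_degree (mat_P_minus ?\<Phi>)"
    using q(2) P(3) by simp
qed

section \<open>The entries of the family\<close>

lemma vec_1_nth [simp]: "(vector [x] :: 'a::zero ^ 1) $ i = x"
  by (metis vector_1 num1_eq1)

lemma Psi_term0_nth:
  "Psi_term0 u0 v1 v2 w1 w2 $ 1 $ 1 = u0 * sharp w1 * sharp v1"
  "Psi_term0 u0 v1 v2 w1 w2 $ 1 $ 2 = u0 * sharp w1 * sharp v2"
  "Psi_term0 u0 v1 v2 w1 w2 $ 2 $ 1 = u0 * sharp w2 * sharp v1"
  "Psi_term0 u0 v1 v2 w1 w2 $ 2 $ 2 = u0 * sharp w2 * sharp v2"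
  by (simp_all add: Psi_term0_def matrix_matrix_mult_def mat_star_def mat_sharp_def column_def transpose_def)

lemma Psi_term1_nth:
  "Psi_term1 u1 v1 v2 w1 w2 $ 1 $ 1 = u1 * w2 * v2"
  "Psi_term1 u1 v1 v2 w1 w2 $ 1 $ 2 = - (u1 * w2 * v1)"
  "Psi_term1 u1 v1 v2 w1 w2 $ 2 $ 1 = - (u1 * w1 * v2)"
  "Psi_term1 u1 v1 v2 w1 w2 $ 2 $ 2 = u1 * w1 * v1"
  by (simp_all add: Psi_term1_def matrix_matrix_mult_def column_def transpose_def)

lemma infinite_sphere: "infinite (sphere 0 1 :: complex set)"
proof -
  have "connected (sphere 0 1 :: complex set)" by (rule connected_sphere) simp
  hence "uncountable (sphere 0 1 :: complex set)"
    by (rule connected_uncountable[of _ 1 "- 1"]) auto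
  thus ?thesis by (rule uncountable_infinite)
qed

lemma unimodular_regular: "unimodular_on_circle u \<Longrightarrow> regular_on (sphere 0 1) u"
  unfolding unimodular_on_circle_def regular_on_def regular_at_def eval_def
  by (metis div_by_0 norm_zero zero_neq_one)

lemma unimodular_sharp: 
  assumes "unimodular_on_circle u" shows "u * sharp u = 1"
proof (rule ratfun_eqI[OF infinite_sphere])
  fix z :: complex assume z: "z \<in> sphere 0 1"
  have "regular_at z u" using unimodular_regular[OF assms] z by (simp add: regular_on_def)
  thus "eval (u * sharp u) z = eval 1 z"
    using eval_sharp_circle[OF z] assms z
    by (simp add: eval_mult' complex_norm_square[symmetric] unimodular_on_circle_def)
qed

lemma inner_sharp:
  assumes "inner_co_outer a b" shows "a * sharp a + b * sharp b = 1"
proof (rule ratfun_eqI[OF infinite_sphere])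
  fix z :: complex assume z: "z \<in> sphere 0 1"
  have "regular_at z a" "regular_at z b"
    using assms z by (auto simp: inner_co_outer_def Hinf_iff regular_on_def)
  moreover have "complex_of_real ((norm (eval a z))\<^sup>2 + (norm (eval b z))\<^sup>2) = 1"
    using assms z by (simp add: inner_co_outer_def)
  ultimately show "eval (a * sharp a + b * sharp b) z = eval 1 z"
    using eval_sharp_circle[OF z]
    by (simp add: eval_mult' eval_add' regular_at_mult complex_norm_square[symmetric])
qed

locale bad_family =
  fixes u0 u1 v1 v2 w1 w2 :: ratfun
  assumes u0: "unimodular_on_circle u0" "badly_approximable u0"
    and u1: "unimodular_on_circle u1" "badly_approximable u1"
    and v: "inner_co_outer v1 v2" and w: "inner_co_outer w1 w2"
begin

abbreviation \<Psi> :: "real \<Rightarrow> (2, 2) ratmat" where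
  "\<Psi> \<equiv> Psi u0 u1 v1 v2 w1 w2"

abbreviation T :: "real \<Rightarrow> ratfun" where "T t \<equiv> rconst (complex_of_real t)"

text \<open>The summands of \<open>sharp \<Psi> = A + t C\<close>. The inverse of \<open>\<Psi>\<close> is the transpose of
  \<open>A + t\<^sup>-\<^sup>1 C\<close>.\<close>

definition A :: "(2, 2) ratmat" where
  "A = map_matrix sharp (Psi_term0 u0 v1 v2 w1 w2)"

definition C :: "(2, 2) ratmat" where
  "C = map_matrix sharp (Psi_term1 u1 v1 v2 w1 w2)"

lemma u_nonzero [simp]: "u0 \<noteq> 0" "u1 \<noteq> 0"
  using unimodular_sharp[OF u0(1)] unimodular_sharp[OF u1(1)] by auto

lemma sharp_u: "sharp u0 = inverse u0" "sharp u1 = inverse u1"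
  using unimodular_sharp[OF u0(1)] unimodular_sharp[OF u1(1)] inverse_unique by metis+

lemma vw_regular:
  "regular_on (cball 0 1) v1" "regular_on (cball 0 1) v2" "regular_on (cball 0 1) w1" "regular_on (cball 0 1) w2"
  using v w by (auto simp: inner_co_outer_def Hinf_iff)

lemma Psi_nth: "\<Psi> t $ i $ j = Psi_term0 u0 v1 v2 w1 w2 $ i $ j + T t * Psi_term1 u1 v1 v2 w1 w2 $ i $ j"
  by (simp add: Psi_eq_sum)

lemma sharp_Psi_nth: "sharp (\<Psi> t $ i $ j) = A $ i $ j + T t * C $ i $ j"
  by (simp add: Psi_nth A_def C_def sharp_add sharp_mult sharp_rconst)

lemma A_nth:
  "A $ 1 $ 1 = inverse u0 * w1 * v1" "A $ 1 $ 2 = inverse u0 * w1 * v2"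
  "A $ 2 $ 1 = inverse u0 * w2 * v1" "A $ 2 $ 2 = inverse u0 * w2 * v2"
  by (simp_all add: A_def Psi_term0_nth sharp_mult sharp_u)

lemma C_nth:
  "C $ 1 $ 1 = inverse u1 * sharp w2 * sharp v2" "C $ 1 $ 2 = - (inverse u1 * sharp w2 * sharp v1)"
  "C $ 2 $ 1 = - (inverse u1 * sharp w1 * sharp v2)" "C $ 2 $ 2 = inverse u1 * sharp w1 * sharp v1"
  by (simp_all add: C_def Psi_term1_nth sharp_mult sharp_uminus sharp_u)

lemma det_Psi: "det (\<Psi> t) = T t * u0 * u1"
proof -
  have "det (\<Psi> t) = T t * u0 * u1 * ((v1 * sharp v1 + v2 * sharp v2) * (w1 * sharp w1 + w2 * sharp w2))"
    unfolding det_2 Psi_nth Psi_term0_nth Psi_term1_nth by (simp add: algebra_simps)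
  thus ?thesis by (simp add: inner_sharp[OF v] inner_sharp[OF w])
qed

text \<open>Cramer's rule for the inverse, cleared of the determinant \<open>t u\<^sub>0 u\<^sub>1\<close>.\<close>

lemma cofactors:
  "\<Psi> t $ 2 $ 2 = u0 * u1 * (T t * A $ 1 $ 1 + C $ 1 $ 1)"
  "\<Psi> t $ 2 $ 1 = - (u0 * u1 * (T t * A $ 1 $ 2 + C $ 1 $ 2))"
  "\<Psi> t $ 1 $ 2 = - (u0 * u1 * (T t * A $ 2 $ 1 + C $ 2 $ 1))"
  "\<Psi> t $ 1 $ 1 = u0 * u1 * (T t * A $ 2 $ 2 + C $ 2 $ 2)"
  unfolding Psi_nth Psi_term0_nth Psi_term1_nth A_nth C_nth
  by (simp_all add: field_simps)

lemma regular_mat_sphere_Psi: "regular_mat (sphere 0 1) (\<Psi> t)"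
proof -
  have sharp: "regular_on (sphere 0 1) (sharp f)" if "regular_on (cball 0 1) f" for f
    using that by (auto simp: regular_on_def intro!: eval_sharp_circle(1))
  note reg = unimodular_regular[OF u0(1)] unimodular_regular[OF u1(1)]
    vw_regular[THEN regular_on_subset[OF _ sphere_cball]] vw_regular[THEN sharp]
  show ?thesis
    unfolding regular_mat_def forall_2 Psi_nth Psi_term0_nth Psi_term1_nth
    by (intro conjI regular_on_intros reg)
qed

lemma A_regular_at:
  assumes "a \<in> ball 0 1" shows "regular_at a (u0 * A $ i $ j)"
proof -
  have "regular_at a v1" "regular_at a v2" "regular_at a w1" "regular_at a w2"
    using vw_regular assms by (auto simp: regular_on_def)
  hence "regular_at a x" if "x \<in> {w1 * v1, w1 * v2, w2 * v1, w2 * v2}" for x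
    using that by (auto intro!: regular_at_mult)
  moreover have "u0 * A $ i $ j \<in> {w1 * v1, w1 * v2, w2 * v1, w2 * v2}"
    using exhaust_2[of i] exhaust_2[of j] by (auto simp: A_nth)
  ultimately show ?thesis by blast
qed

text \<open>Since \<open>v\<close> and \<open>w\<close> are co-outer, one entry of each is invertible at any given point of the disk.\<close>

lemma unit_entries:
  assumes "a \<in> ball 0 1"
  shows "\<exists>i j. unit_at a (u0 * A $ i $ j)"
    and "\<exists>i j e. unit_at a e \<and> Psi_term1 u1 v1 v2 w1 w2 $ i $ j = e * u1"
proof -
  have "unit_at a w1 \<or> unit_at a w2" "unit_at a v1 \<or> unit_at a v2"
    using v w vw_regular assms by (auto simp: inner_co_outer_def unit_at_def regular_on_def)
  then consider "unit_at a (w1 * v1)" | "unit_at a (w1 * v2)" | "unit_at a (w2 * v1)" | "unit_at a (w2 * v2)"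
    using unit_at_mult by blast
  note cases = this
  have "u0 * A $ 1 $ 1 = w1 * v1" "u0 * A $ 1 $ 2 = w1 * v2" "u0 * A $ 2 $ 1 = w2 * v1" "u0 * A $ 2 $ 2 = w2 * v2"
    by (simp_all add: A_nth)
  thus "\<exists>i j. unit_at a (u0 * A $ i $ j)" using cases by metis
  have minus: "unit_at a (- f)" if "unit_at a f" for f
    using that by (auto simp: unit_at_def eval_uminus)
  let ?D = "Psi_term1 u1 v1 v2 w1 w2"
  have "?D $ 1 $ 1 = (w2 * v2) * u1" "?D $ 1 $ 2 = (- (w2 * v1)) * u1"
    "?D $ 2 $ 1 = (- (w1 * v2)) * u1" "?D $ 2 $ 2 = (w1 * v1) * u1"
    by (simp_all add: Psi_term1_nth mult_ac)
  thus "\<exists>i j e. unit_at a e \<and> ?D $ i $ j = e * u1" using cases minus by metis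
qed

section \<open>Exceptional parameters\<close>

text \<open>Let \<open>u\<^sub>0\<close> and \<open>u\<^sub>1\<close> have the orders \<open>k0\<close> and \<open>k1\<close> at \<open>a\<close>. The number \<open>n\<close> bounds the
  orders of the poles of the inverse of \<open>\<Psi>\<close> and of its determinant, which has the order
  \<open>- (k0 + k1)\<close>, while \<open>A\<close> alone has a pole of order \<open>k0 > n\<close>: part of the pole cancels against
  \<open>t\<^sup>-\<^sup>1 C\<close>. It follows that \<open>k1 < 0\<close>.\<close>

definition exceptional :: "complex \<Rightarrow> real \<Rightarrow> bool" where
  "exceptional a t \<longleftrightarrow> (\<exists>n k0 k1 e0 e1. u0 = lin a powi k0 * e0 \<and> unit_at a e0 \<and>
     u1 = lin a powi k1 * e1 \<and> unit_at a e1 \<and> 0 \<le> n \<and> n < k0 \<and> k0 + k1 \<le> n \<and>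
     (\<forall>i j. ord_ge a (- n) (T t * A $ i $ j + C $ i $ j)))"

lemma ord_ge_local_form:
  "unit_at a e \<Longrightarrow> ord_ge a n (lin a powi k * e) \<longleftrightarrow> n \<le> k"
  using ord_ge_unit_mult_iff[of a e n "lin a powi k"] by (simp add: mult.commute ord_ge_lin_powi_iff)

lemma ord_ge_A:
  assumes "a \<in> ball 0 1" "u0 = lin a powi k0 * e0" "unit_at a e0" shows "ord_ge a (- k0) (A $ i $ j)"
proof -
  have "A $ i $ j = lin a powi (- k0) * (inverse e0 * (u0 * A $ i $ j))"
    using assms(2) unit_at_nonzero[OF assms(3)]
    by (simp add: power_int_minus field_simps)
  moreover have "ord_ge a 0 (inverse e0 * (u0 * A $ i $ j))"
    using A_regular_at[OF assms(1), of i j] unit_at_inverse[OF assms(3)]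
    by (auto simp: ord_ge_0_iff unit_at_def)
  ultimately show ?thesis using ord_ge_mult'[OF ord_ge_lin_powi] by (metis add.right_neutral)
qed

text \<open>Two exceptional parameters at one point would make the order of \<open>A\<close> too large, but some entry of
  \<open>u\<^sub>0 A\<close> does not vanish there.\<close>

lemma exceptional_unique:
  assumes a: "a \<in> ball 0 1" and "exceptional a t" "exceptional a t'" shows "t = t'"
proof (rule ccontr)
  assume "t \<noteq> t'"
  obtain n k0 e0 where 1: "u0 = lin a powi k0 * e0" "unit_at a e0" "n < k0"
    "\<And>i j. ord_ge a (- n) (T t * A $ i $ j + C $ i $ j)"
    using assms(2) unfolding exceptional_def by blast
  obtain n' k0' e0' where 2: "u0 = lin a powi k0' * e0'" "unit_at a e0'" "n' < k0'"
    "\<And>i j. ord_ge a (- n') (T t' * A $ i $ j + C $ i $ j)"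
    using assms(3) unfolding exceptional_def by blast
  have "k0 = k0'"
    using ord_ge_local_form[OF 1(2), of k0' k0] ord_ge_local_form[OF 2(2), of k0 k0']
      ord_ge_local_form[OF 1(2), of k0 k0] ord_ge_local_form[OF 2(2), of k0' k0'] 1(1) 2(1) by simp
  define N where "N = max n n'"
  have N: "N < k0" using 1(3) 2(3) \<open>k0 = k0'\<close> by (simp add: N_def)
  have ordA: "ord_ge a (- N) (A $ i $ j)" for i j
  proof -
    have "ord_ge a (- N) (T t * A $ i $ j + C $ i $ j)"
      by (rule ord_ge_mono[OF 1(4)]) (simp add: N_def)
    moreover have "ord_ge a (- N) (T t' * A $ i $ j + C $ i $ j)"
      by (rule ord_ge_mono[OF 2(4)]) (simp add: N_def)
    ultimately have "ord_ge a (- N) ((T t * A $ i $ j + C $ i $ j) - (T t' * A $ i $ j + C $ i $ j))" by (rule ord_ge_diff)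
    also have "(T t * A $ i $ j + C $ i $ j) - (T t' * A $ i $ j + C $ i $ j)
        = rconst (complex_of_real (t - t')) * A $ i $ j"
      by (simp add: rconst_diff algebra_simps)
    finally show ?thesis using \<open>t \<noteq> t'\<close> by (subst (asm) ord_ge_rconst_mult_iff) auto
  qed
  obtain i j where unit: "unit_at a (u0 * A $ i $ j)" using unit_entries(1)[OF a] by blast
  have "ord_ge a k0 u0" using ord_ge_local_form[OF 1(2)] 1(1) by simp
  hence "ord_ge a (k0 + - N) (u0 * A $ i $ j)" using ordA by (rule ord_ge_mult)
  hence "ord_ge a (k0 + - N) 1" using ord_ge_unit_mult_iff[OF unit, of _ 1] by simp
  thus False using N ord_ge_lin_powi_iff[of a "k0 + - N" 0] by simp
qed

lemma exceptional_imp_pole: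
  assumes "exceptional a t" shows "\<not> regular_at a u1"
proof -
  obtain n k0 k1 e1 where "u1 = lin a powi k1 * e1" "unit_at a e1" "n < k0" "k0 + k1 \<le> n"
    using assms unfolding exceptional_def by blast
  thus ?thesis using ord_ge_local_form[of a e1 0 k1] by (simp add: ord_ge_0_iff)
qed

text \<open>By Cramer's rule the entries of \<open>\<Psi>\<close> have order at least \<open>k0 + k1 - n > k1\<close>, while
  \<open>u\<^sub>1 \<xi> \<theta>\<^sup>t\<close> has an entry of order \<open>k1 < 0\<close>. So the degree of the sum is smaller, and both summands
  have a pole.\<close>

lemma exceptional_imp_cancellation:
  assumes a: "a \<in> ball 0 1" and t: "t > 0" and exc: "exceptional a t"
  shows "cancellation_at u0 u1 v1 v2 w1 w2 t (Fin a)"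
proof -
  let ?A = "Psi_term0 u0 v1 v2 w1 w2" and ?C = "Psi_term1 u1 v1 v2 w1 w2"
  obtain n k0 k1 e0 e1 where k: "u0 = lin a powi k0 * e0" "unit_at a e0"
    "u1 = lin a powi k1 * e1" "unit_at a e1" "0 \<le> n" "n < k0" "k0 + k1 \<le> n"
    "\<And>i j. ord_ge a (- n) (T t * A $ i $ j + C $ i $ j)"
    using exc unfolding exceptional_def by blast
  have ordu: "ord_ge a k0 u0" "ord_ge a m u1 \<longleftrightarrow> m \<le> k1" for m
    using ord_ge_local_form[OF k(2)] ord_ge_local_form[OF k(4)] k(1,3) by simp_all
  hence uu: "ord_ge a (k0 + k1) (u0 * u1)" using ord_ge_mult by blast
  have ord\<Psi>: "ord_ge a (k0 + k1 - n) (\<Psi> t $ i $ j)" for i j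
  proof -
    have "ord_ge a (k0 + k1 - n) (u0 * u1 * (T t * A $ i $ j + C $ i $ j))" for i j
      using uu k(8) by (rule ord_ge_mult') simp
    thus ?thesis using exhaust_2[of i] exhaust_2[of j] by (auto simp: cofactors)
  qed
  have "degree_at (Fin a) (\<Psi> t) \<le> nat (n - k0 - k1)"
  proof (rule degree_at_le[OF a])
    have m: "- int (nat (n - k0 - k1)) = k0 + k1 - n" using k(7) by simp
    show "ord_ge a (- int (nat (n - k0 - k1))) (\<Psi> t $ i $ j)" for i j
      unfolding m by (rule ord\<Psi>)
    have "ord_ge a (k0 + k1) (det (\<Psi> t))"
      unfolding det_Psi mult.assoc by (intro ord_ge_rconst_mult uu)
    thus "ord_ge a (- int (nat (n - k0 - k1))) (det (\<Psi> t))"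
      unfolding m by (rule ord_ge_mono) (use k(5) in simp)
  qed
  moreover obtain i j e where e: "unit_at a e" "?C $ i $ j = e * u1"
    using unit_entries(2)[OF a] by blast
  have ordC: "ord_ge a m (?C $ i $ j) \<longleftrightarrow> m \<le> k1" for m
    unfolding e(2) by (simp add: ord_ge_unit_mult_iff[OF e(1)] ordu(2))
  hence "- int (degree_at (Fin a) ?C) \<le> k1" using ord_ge_degree_at[OF a] by blast
  ultimately have deg: "degree_at (Fin a) (\<Psi> t) < degree_at (Fin a) ?C" using k(5,6,7) by linarith
  have T: "ord_ge a m (T t * ?C $ i $ j) \<longleftrightarrow> m \<le> k1" for m
    using ord_ge_rconst_mult_iff[of "complex_of_real t" a m "?C $ i $ j"] t ordC by simp
  have poleC: "\<not> regular_at a (T t * ?C $ i $ j)"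
    using T[of 0] k(6,7) by (simp add: ord_ge_0_iff)
  have poleA: "\<not> regular_at a (?A $ i $ j)"
  proof
    assume "regular_at a (?A $ i $ j)"
    hence "ord_ge a 0 (?A $ i $ j)" by (simp only: ord_ge_0_iff)
    hence "ord_ge a (k1 + 1) (?A $ i $ j)" by (rule ord_ge_mono) (use k(6,7) in simp)
    moreover have "ord_ge a (k1 + 1) (\<Psi> t $ i $ j)"
      using ord\<Psi> by (rule ord_ge_mono) (use k(6) in simp)
    ultimately have "ord_ge a (k1 + 1) (\<Psi> t $ i $ j - ?A $ i $ j)" by (rule ord_ge_diff[rotated])
    thus False using T[of "k1 + 1"] by (simp add: Psi_nth)
  qed
  have "mat_has_pole ?A (Fin a)" "mat_has_pole (mat_scale (T t) ?C) (Fin a)"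
    unfolding mat_has_pole_Fin mat_scale_nth using poleA poleC by blast+
  thus ?thesis
    unfolding cancellation_at_def Let_def Psi_eq_sum[symmetric] using deg by (simp only: less_max_iff_disj simp_thms)
qed

end

section \<open>The inequality for unexceptional parameters\<close>

lemma badly_approximable_split:
  assumes "unimodular_on_circle u" "badly_approximable u"
  obtains a c e where "u = to_fract a / to_fract c * e" "\<And>z. z \<in> ball 0 1 \<Longrightarrow> unit_at z e"
    "\<And>z. poly c z = 0 \<Longrightarrow> z \<in> ball 0 1" "a \<noteq> 0" "c \<noteq> 0" "degree a < degree c"
proof -
  have unit: "norm (eval u z) = 1" if "z \<in> sphere 0 1" for z
    using assms(1) that by (simp add: unimodular_on_circle_def)
  have "num u \<noteq> 0"
  proof
    assume "num u = 0"
    thus False using unit[of 1] by (simp add: eval_def)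
  qed
  then obtain a b where ab: "num u = a * b" "\<And>z. poly a z = 0 \<Longrightarrow> z \<in> ball 0 1" "\<And>z. z \<in> ball 0 1 \<Longrightarrow> poly b z \<noteq> 0"
    using poly_split_roots[of "num u" "ball 0 1"] by metis
  obtain c d where cd: "den u = c * d" "\<And>z. poly c z = 0 \<Longrightarrow> z \<in> ball 0 1" "\<And>z. z \<in> ball 0 1 \<Longrightarrow> poly d z \<noteq> 0"
    using poly_split_roots[of "den u" "ball 0 1"] den_nonzero by metis
  have "poly (num u) z \<noteq> 0" "poly (den u) z \<noteq> 0" if "z \<in> sphere 0 1" for z
    using unit[OF that] by (auto simp: eval_def)
  hence b: "poly b z \<noteq> 0" and d: "poly d z \<noteq> 0" if "z \<in> cball 0 1" for z
    using ab cd that by (cases "z \<in> ball 0 1"; force)+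
  have "degree a < degree c"
    by (rule badly_approximable_zeros_poles[OF assms ab(1,2) b cd(1,2) d])
  moreover have "u = to_fract a / to_fract c * (to_fract b / to_fract d)"
    using ratfun_eq_to_fract[of u] by (simp add: ab(1) cd(1))
  moreover have "unit_at z (to_fract b / to_fract d)" if "z \<in> ball 0 1" for z
    using ab(3) cd(3) that by (intro unit_at_divide) auto
  moreover have "a \<noteq> 0" "c \<noteq> 0" using ab(1) cd(1) \<open>num u \<noteq> 0\<close> den_nonzero[of u] by auto
  ultimately show ?thesis using that cd(2) by blast
qed

context bad_family
begin

text \<open>If \<open>q u\<^sub>0 u\<^sub>1\<close> has no poles in the disk, it is a polynomial times a function that is
  invertible in the disk, and the degree drops by at least two since each of the two factors has
  fewer zeros than poles there.\<close>

lemma denominator_times_determinant: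
  assumes "q \<noteq> 0" "regular_on (ball 0 1) (to_fract q * (u0 * u1))"
  obtains q' e where "to_fract q * (u0 * u1) = to_fract q' * e" "\<And>z. z \<in> ball 0 1 \<Longrightarrow> unit_at z e"
    "q' \<noteq> 0" "degree q' + 2 \<le> degree q"
proof -
  obtain a0 c0 e0 where 0: "u0 = to_fract a0 / to_fract c0 * e0" "\<And>z. z \<in> ball 0 1 \<Longrightarrow> unit_at z e0"
    "\<And>z. poly c0 z = 0 \<Longrightarrow> z \<in> ball 0 1" "a0 \<noteq> 0" "c0 \<noteq> 0" "degree a0 < degree c0"
    using badly_approximable_split[OF u0] by metis
  obtain a1 c1 e1 where 1: "u1 = to_fract a1 / to_fract c1 * e1" "\<And>z. z \<in> ball 0 1 \<Longrightarrow> unit_at z e1"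
    "\<And>z. poly c1 z = 0 \<Longrightarrow> z \<in> ball 0 1" "a1 \<noteq> 0" "c1 \<noteq> 0" "degree a1 < degree c1"
    using badly_approximable_split[OF u1] by metis
  define f where "f = to_fract (q * a0 * a1) / to_fract (c0 * c1)"
  define e where "e = e0 * e1"
  have e: "unit_at z e" if "z \<in> ball 0 1" for z
    using that 0(2) 1(2) by (simp add: e_def unit_at_mult)
  have eq: "to_fract q * (u0 * u1) = e * f"
    unfolding f_def e_def 0(1) 1(1) by simp
  have "regular_at z f" for z
  proof (cases "z \<in> ball 0 1")
    case True
    thus ?thesis using assms(2) ord_ge_unit_mult_iff[OF e[OF True], of 0 f]
      unfolding eq by (simp add: regular_on_def ord_ge_0_iff)
  next
    case False
    thus ?thesis unfolding f_def using 0(3)[of z] 1(3)[of z]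
      by (intro regular_at_divide regular_at_to_fract) (auto simp: eval_mult')
  qed
  then obtain q' where q': "f = to_fract q'" by (rule regular_everywhere_imp_to_fract)
  hence "to_fract (q' * (c0 * c1)) = to_fract (q * a0 * a1)"
    using 0(5) 1(5) unfolding f_def by (simp add: field_simps)
  hence poly: "q' * (c0 * c1) = q * a0 * a1" by (simp only: to_fract_eq_iff)
  hence "q' \<noteq> 0" using assms(1) 0(4) 1(4) by auto
  have "degree q' + (degree c0 + degree c1) = degree q + degree a0 + degree a1"
    using arg_cong[OF poly, of degree] \<open>q' \<noteq> 0\<close> assms(1) 0(4,5) 1(4,5) by (simp add: degree_mult_eq)
  hence "degree q' + 2 \<le> degree q" using 0(6) 1(6) by linarith
  thus ?thesis using that[of q' e] eq e \<open>q' \<noteq> 0\<close> by (simp add: q' mult.commute)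
qed

text \<open>Let \<open>q\<close> be a common denominator of \<open>\<Psi>\<close> of degree at most \<open>deg P\<^sub>- \<Psi>\<close> and
  \<open>q'\<close> the polynomial part of \<open>q det \<Psi>\<close>. By Cramer's rule \<open>q'\<close> clears the poles of \<open>t A + C\<close>. If
  it did not clear those of \<open>A + t C\<close> at some point, it would not clear those of \<open>A\<close> there, and \<open>t\<close>
  would be exceptional. So \<open>q'\<close> is a common denominator of \<open>\<Psi>\<^sup>*\<close>.\<close>

lemma degree_inequality:
  assumes t: "t \<noteq> 0" and not_exc: "\<And>a. a \<in> ball 0 1 \<Longrightarrow> \<not> exceptional a t"
  shows "int (mcmillan_degree (mat_P_plus (\<Psi> t))) \<le> int (mcmillan_degree (mat_P_minus (\<Psi> t))) - 2"
proof -
  obtain q where q: "pole_denominator q (\<Psi> t)" "degree q \<le> mcmillan_degree (mat_P_minus (\<Psi> t))"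
    using degree_P_minus_denominator[OF regular_mat_sphere_Psi] by blast
  have q0: "q \<noteq> 0" and qent: "regular_at a (to_fract q * \<Psi> t $ i $ j)"
    and qdet: "regular_at a (to_fract q * (T t * u0 * u1))" if "a \<in> ball 0 1" for a i j
    using q(1) that by (auto simp: pole_denominator_iff denominator_at_def det_Psi)
  have T: "T t \<noteq> 0" using t by simp
  have "regular_at a (to_fract q * (u0 * u1))" if "a \<in> ball 0 1" for a
  proof -
    have "ord_ge a 0 (T t * (to_fract q * (u0 * u1)))"
      using qdet[OF that] by (simp add: ord_ge_0_iff mult_ac)
    thus ?thesis
      using ord_ge_rconst_mult_iff[of "complex_of_real t" a 0 "to_fract q * (u0 * u1)"] t
      by (simp add: ord_ge_0_iff)
  qed
  hence "regular_on (ball 0 1) (to_fract q * (u0 * u1))" by (simp add: regular_on_def)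
  then obtain q' e where q': "to_fract q * (u0 * u1) = to_fract q' * e"
    "\<And>z. z \<in> ball 0 1 \<Longrightarrow> unit_at z e" "q' \<noteq> 0" "degree q' + 2 \<le> degree q"
    using denominator_times_determinant[of q] q0[of 0] by auto
  \<comment> \<open>By Cramer's rule \<open>q'\<close> is a common denominator of the inverse of \<open>\<Psi>\<close>.\<close>
  have inv: "regular_at a (to_fract q' * (T t * A $ i $ j + C $ i $ j))" if a: "a \<in> ball 0 1" for a i j
  proof -
    define X where "X = T t * A $ i $ j + C $ i $ j"
    have "\<exists>k l. u0 * u1 * X = \<Psi> t $ k $ l \<or> u0 * u1 * X = - \<Psi> t $ k $ l"
      using exhaust_2[of i] exhaust_2[of j] cofactors[of t] unfolding X_def
      by (metis minus_minus)
    then obtain k l where "u0 * u1 * X = \<Psi> t $ k $ l \<or> u0 * u1 * X = - \<Psi> t $ k $ l" by blast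
    hence "regular_at a (to_fract q * (u0 * u1 * X))"
      using qent[OF a, of k l] by auto
    also have "to_fract q * (u0 * u1 * X) = e * (to_fract q' * X)"
      using q'(1) by (metis mult.assoc mult.commute)
    finally show ?thesis
      using ord_ge_unit_mult_iff[OF q'(2)[OF a], of 0] by (simp add: ord_ge_0_iff X_def)
  qed
  have det: "regular_at a (to_fract q' * (inverse u0 * inverse u1))" if a: "a \<in> ball 0 1" for a
  proof -
    have "to_fract q = e * (to_fract q' * (inverse u0 * inverse u1))"
      using q'(1) by (simp add: field_simps)
    hence "regular_at a (e * (to_fract q' * (inverse u0 * inverse u1)))" by (metis regular_at_to_fract)
    thus ?thesis using ord_ge_unit_mult_iff[OF q'(2)[OF a], of 0] by (simp add: ord_ge_0_iff)
  qed
  have ent: "regular_at a (to_fract q' * sharp (\<Psi> t $ i $ j))" if a: "a \<in> ball 0 1" for a i j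
  proof (rule ccontr)
    assume not: "\<not> regular_at a (to_fract q' * sharp (\<Psi> t $ i $ j))"
    define n where "n = int (order a q')"
    have ord: "regular_at a (to_fract q' * f) \<longleftrightarrow> ord_ge a (- n) f" for f
      unfolding n_def by (rule ord_ge_to_fract_mult_iff[OF q'(3)])
    have X: "ord_ge a (- n) (T t * A $ i $ j + C $ i $ j)" for i j using inv[OF a] by (simp add: ord)
    have "\<not> ord_ge a (- n) (A $ i $ j)"
    proof
      assume A: "ord_ge a (- n) (A $ i $ j)"
      hence "ord_ge a (- n) ((T t * A $ i $ j + C $ i $ j) - T t * A $ i $ j)"
        using X by (intro ord_ge_diff ord_ge_rconst_mult)
      hence "ord_ge a (- n) (C $ i $ j)" by simp
      hence "ord_ge a (- n) (A $ i $ j + T t * C $ i $ j)"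
        using A by (intro ord_ge_add ord_ge_rconst_mult)
      thus False using not by (simp add: ord sharp_Psi_nth)
    qed
    moreover obtain k0 e0 where 0: "u0 = lin a powi k0 * e0" "unit_at a e0"
      using ratfun_local_form[OF u_nonzero(1)] by metis
    obtain k1 e1 where 1: "u1 = lin a powi k1 * e1" "unit_at a e1"
      using ratfun_local_form[OF u_nonzero(2)] by metis
    ultimately have "n < k0"
      using ord_ge_mono[OF ord_ge_A[OF a 0], of "- n"] by (metis not_le_imp_less neg_le_iff_le)
    moreover have "k0 + k1 \<le> n"
    proof -
      have "inverse u0 * inverse u1 = lin a powi (- (k0 + k1)) * (inverse e0 * inverse e1)"
        unfolding 0(1) 1(1) power_int_minus power_int_add[OF disjI1[OF lin_nonzero]]
        by (simp add: mult_ac)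
      moreover have "ord_ge a (- n) (inverse u0 * inverse u1)" using det[OF a] by (simp only: ord)
      ultimately have "- n \<le> - (k0 + k1)"
        using ord_ge_local_form[OF unit_at_mult[OF unit_at_inverse[OF 0(2)] unit_at_inverse[OF 1(2)]]]
        by metis
      thus ?thesis by simp
    qed
    moreover have "0 \<le> n" by (simp add: n_def)
    ultimately have "exceptional a t"
      unfolding exceptional_def using 0 1 X by blast
    thus False using not_exc[OF a] by blast
  qed
  have "mcmillan_degree (mat_P_plus (\<Psi> t)) \<le> degree q'"
  proof (rule degree_P_plus_le[OF regular_mat_sphere_Psi q'(3)])
    show "regular_on (ball 0 1) (to_fract q' * sharp (\<Psi> t $ i $ j))" for i j
      using ent by (simp add: regular_on_def)
    have "regular_at a (to_fract q' * sharp (det (\<Psi> t)))" if "a \<in> ball 0 1" for a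
    proof -
      have eq: "to_fract q' * sharp (det (\<Psi> t)) = T t * (to_fract q' * (inverse u0 * inverse u1))"
        by (simp add: det_Psi sharp_mult sharp_rconst sharp_u mult_ac)
      show ?thesis unfolding eq by (rule regular_at_mult[OF regular_at_rconst det[OF that]])
    qed
    thus "regular_on (ball 0 1) (to_fract q' * sharp (det (\<Psi> t)))" by (simp add: regular_on_def)
  qed
  thus ?thesis using q(2) q'(4) by linarith
qed

end

theorem theorem3p3:
  fixes u0 u1 v1 v2 w1 w2 :: ratfun
  assumes "unimodular_on_circle u0" "badly_approximable u0"
    and "unimodular_on_circle u1" "badly_approximable u1"
    and "inner_co_outer v1 v2" "inner_co_outer w1 w2"
  defines "\<Psi> \<equiv> Psi u0 u1 v1 v2 w1 w2"
  shows "(\<forall>t\<in>{0<..1}. nondisturbing u0 u1 v1 v2 w1 w2 (Fin ` ball 0 1) t \<longrightarrow>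
            int (mcmillan_degree (mat_P_plus (\<Psi> t)))
              \<le> int (mcmillan_degree (mat_P_minus (\<Psi> t))) - 2)
       \<and> finite {t\<in>{0<..<1}. \<not> int (mcmillan_degree (mat_P_plus (\<Psi> t)))
                                  \<le> int (mcmillan_degree (mat_P_minus (\<Psi> t))) - 2}
       \<and> card {t\<in>{0<..<1}. \<not> int (mcmillan_degree (mat_P_plus (\<Psi> t)))
                                  \<le> int (mcmillan_degree (mat_P_minus (\<Psi> t))) - 2}
            \<le> mcmillan_degree (mat_P_minus (mat u1 :: (1, 1) ratmat))"
proof -
  interpret bad_family u0 u1 v1 v2 w1 w2
    using assms by unfold_locales
  define bad where "bad t \<longleftrightarrow> \<not> int (mcmillan_degree (mat_P_plus (\<Psi> t)))
      \<le> int (mcmillan_degree (mat_P_minus (\<Psi> t))) - 2" for t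
  have bad: "\<exists>a. a \<in> ball 0 1 \<and> exceptional a t" if "bad t" "t > 0" for t
    using that degree_inequality[of t] unfolding bad_def \<Psi>_def by auto
  have "\<not> bad t" if "t \<in> {0<..1}" "nondisturbing u0 u1 v1 v2 w1 w2 (Fin ` ball 0 1) t" for t
    using that bad[of t] exceptional_imp_cancellation[of _ t] unfolding nondisturbing_def by auto
  hence 1: "\<forall>t\<in>{0<..1}. nondisturbing u0 u1 v1 v2 w1 w2 (Fin ` ball 0 1) t \<longrightarrow> \<not> bad t"
    by blast
  \<comment> \<open>Each violation has a witness among the poles of \<open>u1\<close>, and no two violations share one.\<close>
  define S where "S = {t\<in>{0<..<1}. bad t}"
  define P where "P = {a \<in> ball 0 1. \<not> regular_at a u1}"
  have "\<forall>t\<in>S. \<exists>a. a \<in> ball 0 1 \<and> exceptional a t" using bad by (auto simp: S_def)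
  then obtain f where f: "\<And>t. t \<in> S \<Longrightarrow> f t \<in> ball 0 1 \<and> exceptional (f t) t" by metis
  have inj: "inj_on f S" using f exceptional_unique by (metis inj_onI)
  have sub: "f ` S \<subseteq> P" using f exceptional_imp_pole by (auto simp: P_def)
  note P = card_poles_le_degree_P_minus[OF unimodular_regular[OF assms(3)], folded P_def]
  have "finite S" using inj_on_finite[OF inj sub P(1)] .
  moreover have "card S \<le> mcmillan_degree (mat_P_minus (mat u1 :: (1, 1) ratmat))"
    using card_inj_on_le[OF inj sub P(1)] P(2) by linarith
  ultimately show ?thesis using 1 unfolding S_def bad_def by simp
qed

end
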